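(* Let $\mathcal{M}=(K_{i(e)},w_e,p_e)_{e\in E}$ be a countable Markov system on a complete metric space $(K,d)$ which is contractive, uniformly continuous and non-degenerate, with $b<\infty$. Then the following holds true. (i) Suppose $\mathcal{M}$ has a dominating Markov chain. Then $E(\mathcal{M})$ is not empty if and only if there exists $x_0\in K$ such that $(\alpha^{x_0}_n)_{n\in\mathbb{N}}$ is uniformly tight. (ii) $\Phi$ is the inverse of $F:E(\mathcal{M})\to P(\mathcal{M})$, $\Lambda\mapsto F(\Lambda)$. (Thus, the latter map does not depend on the choice of the points $x_i\in K_i$, $i\in N$, as long as $b$ remains finite.)
   Context: Setting. $(K,d)$ is a complete metric space; $P(X)$ denotes the Borel probability measures on $X$. A countable Markov system $\mathcal{M}=(K_{i(e)},w_e,p_e)_{e\in E}$ on $K$ consists of: a set $N\subset\mathbb{N}$ with $1\in N$; a partition $(K_j)_{j\in N}$ of $K$ into non-empty Borel sets; an at most countable set $E$; a surjective map $i:E\to N$ and a map $t:E\to N$; for each $e\in E$, Borel measurable $w_e:K_{i(e)}\to K_{t(e)}$ and $p_e:K_{i(e)}\to[0,1]$ with $p_e\not\equiv 0$, such that $\sum_{e\in E,\,i(e)=j}p_e(x)=1$ for all $x\in K_j$, $j\in N$. Each $p_e$ is extended to $K$ by zero and each $w_e$ is extended to a Borel map $K\to K$ arbitrarily. For Borel $f:K\to[0,\infty)$, $Uf:=\sum_{e\in E}p_e\,f\circ w_e$; $U^*\nu(f):=\int Uf\,d\nu$ for bounded such $f$, $\nu\in P(K)$. $P(\mathcal{M}):=\{\mu\in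 P(K): U^*\mu=\mu\}$. $\mathcal{M}$ is contractive with contraction rate $0<a<1$ iff $\sum_{e\in E,\,i(e)=j}p_e(x)d(w_ex,w_ey)\le a\,d(x,y)$ for all $x,y\in K_j$, $j\in N$. $\mathcal{M}$ is uniformly continuous iff $w_e|_{K_{i(e)}}$ and $p_e|_{K_{i(e)}}$ are uniformly continuous for each $e\in E$. Code space. $\bar E:=E\cup\{\infty\}$ is the one-point compactification of discrete $E$; $w_\infty:=\mathrm{id}$, $p_\infty:=0$, $i(\infty)=t(\infty):=1$. $\bar\Sigma:=\bar E^{\mathbb{Z}}$ with the product topology; $(S\sigma)_{i-1}=\sigma_i$; $P_S(\bar\Sigma)$ is the set of $S$-invariant Borel probability measures. ${}_m[e_m,\dots,e_n]:=\{\sigma\in\bar\Sigma:\sigma_i=e_i,\ m\le i\le n\}$. $\mathcal{F}$ is the $\sigma$-algebra generated by all cylinders ${}_m[e_m,\dots,e_0]$, $m\le 0$. $\Sigma_G:=\{\sigma\in\bar\Sigma: \sigma_n\in E,\ i(\sigma_{n+1})=t(\sigma_n)\ \forall n\in\mathbb{Z}\}$. Fix $x_i\in K_i$ for each $i\in N$. $D:=\{\sigma\in\Sigma_G:\lim_{m\to-\infty}w_{\sigma_0}\circ\dots\circ w_{\sigma_m}(x_{i(\sigma_m)})\text{ exists}\}$; $F:\bar\Sigma\to K$ is this limit on $D$, and $F(\sigma):=x_{t(\sigma_0)}$ for $\sigma\notin D$. $F(\Lambda):=\Lambda\circ F^{-1}$ for measures $\Lambda$ on $\bar\Sigma$. $b:=\sup_{i\in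 N}\sup_{x\in K_i}\sum_{e\in E,\,i(e)=i}p_e(x)\,d(w_e(x_{i(e)}),x_{t(e)})$. $E(\mathcal{M})$ is the set of $\Lambda\in P_S(\bar\Sigma)$ with $\Lambda(D)=1$ and $E_\Lambda(1_{{}_1[e]}|\mathcal{F})=p_e\circ F$ $\Lambda$-a.e. for all $e\in E$ (equilibrium states). $T_j:=\{\sigma\in\Sigma_G:t(\sigma_0)=j\}$. $\bar p_e$ is the continuous extension of $p_e|_{K_{i(e)}}$ to $\bar K_{i(e)}$, extended by zero to $K$. $\tilde E(\mathcal{M})$ is the set of $\Lambda\in P_S(\bar\Sigma)$ with $\Lambda(D)=1$ and $E_\Lambda(1_{{}_1[e]}|\mathcal{F})=(\bar p_e\circ F)\,1_{T_{i(e)}}$ $\Lambda$-a.e. for all $e\in E$. $\mathcal{M}$ is non-degenerate iff for every $\Lambda\in\tilde E(\mathcal{M})$ there exists $i\in N$ with $\Lambda(T_i\cap F^{-1}(K_i))>0$. For $\mu\in P(\mathcal{M})$, $\Phi(\mu)\in P_S(\bar\Sigma)$ is the unique Borel probability measure with $\Phi(\mu)({}_m[e_m,\dots,e_n])=\int p_{e_m}(x)p_{e_{m+1}}(w_{e_m}x)\cdots p_{e_n}(w_{e_{n-1}}\circ\dots\circ w_{e_m}x)\,d\mu(x)$ for all $m\le 0$, $n\ge m$, $e_m,\dots,e_n\in\bar E$. $\mathcal{M}$ has a dominating Markov chain iff $\sum_{e\in E,\,i(e)=i}\sup_{x\in K_i}p_e(x)<\infty$ for every $i\in N$. For $x\in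 K$, $\alpha^x_n(\{j\}):=\frac1n\sum_{k=1}^n {U^*}^k\delta_x(K_j)$, $j\in N$, a probability measure on $N$; $(\alpha^{x}_n)_n$ is uniformly tight iff for every $\epsilon>0$ there is a finite $V\subset N$ with $\alpha^{x}_n(N\setminus V)<\epsilon$ for all $n\in\mathbb{N}$. *)

theory Defs
  imports "HOL-Probability.Probability"
begin

section \<open>Countable Markov systems\<close>

text \<open>
  The maps \<open>wmap M e\<close> and the functions \<open>prb M e\<close> are the extensions to the whole space of the
  maps and probability functions given on the cell of the source of \<open>e\<close>: by an arbitrary Borel map
  and by zero, respectively.
  Sums of non-negative terms are written as \<open>ennreal\<close>-valued integrals with respect to the counting
  measure, so that they always make sense and may be infinite.
\<close>

record ('k, 'e) markov_system =
  vertices :: "nat set"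
  cell :: "nat \<Rightarrow> 'k set"
  edges :: "'e set"
  src :: "'e \<Rightarrow> nat"
  trg :: "'e \<Rightarrow> nat"
  wmap :: "'e \<Rightarrow> 'k \<Rightarrow> 'k"
  prb :: "'e \<Rightarrow> 'k \<Rightarrow> real"

definition out_edges :: "('k, 'e) markov_system \<Rightarrow> nat \<Rightarrow> 'e set" where
  "out_edges M j = {e \<in> edges M. src M e = j}"

definition countable_markov_system :: "('k::complete_space, 'e) markov_system \<Rightarrow> bool" where
  "countable_markov_system M \<longleftrightarrow>
     1 \<in> vertices M \<and>
     (\<forall>j\<in>vertices M. cell M j \<noteq> {} \<and> cell M j \<in> sets borel) \<and>
     disjoint_family_on (cell M) (vertices M) \<and>
     (\<Union>j\<in>vertices M. cell M j) = UNIV \<and>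
     countable (edges M) \<and>
     src M ` edges M = vertices M \<and>
     trg M ` edges M \<subseteq> vertices M \<and>
     (\<forall>e\<in>edges M.
        wmap M e \<in> borel_measurable borel \<and>
        wmap M e \<in> cell M (src M e) \<rightarrow> cell M (trg M e) \<and>
        prb M e \<in> borel_measurable borel \<and>
        (\<forall>x\<in>cell M (src M e). 0 \<le> prb M e x \<and> prb M e x \<le> 1) \<and>
        (\<exists>x\<in>cell M (src M e). prb M e x \<noteq> 0) \<and>
        (\<forall>x. x \<notin> cell M (src M e) \<longrightarrow> prb M e x = 0)) \<and>
     (\<forall>j\<in>vertices M. \<forall>x\<in>cell M j.
        (\<integral>\<^sup>+ e. ennreal (prb M e x) \<partial>count_space (out_edges M j)) = 1)"

definition contractive :: "('k::complete_space, 'e) markov_system \<Rightarrow> real \<Rightarrow> bool" where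
  "contractive M a \<longleftrightarrow>
     0 < a \<and> a < 1 \<and>
     (\<forall>j\<in>vertices M. \<forall>x\<in>cell M j. \<forall>y\<in>cell M j.
        (\<integral>\<^sup>+ e. ennreal (prb M e x * dist (wmap M e x) (wmap M e y)) \<partial>count_space (out_edges M j))
          \<le> ennreal (a * dist x y))"

definition uniformly_continuous_system :: "('k::complete_space, 'e) markov_system \<Rightarrow> bool" where
  "uniformly_continuous_system M \<longleftrightarrow>
     (\<forall>e\<in>edges M. uniformly_continuous_on (cell M (src M e)) (wmap M e) \<and>
                  uniformly_continuous_on (cell M (src M e)) (prb M e))"

definition dominating_markov_chain :: "('k::complete_space, 'e) markov_system \<Rightarrow> bool" where
  "dominating_markov_chain M \<longleftrightarrow>
     (\<forall>j\<in>vertices M.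
        (\<integral>\<^sup>+ e. (SUP x\<in>cell M j. ennreal (prb M e x)) \<partial>count_space (out_edges M j)) < \<infinity>)"

definition base_points :: "('k::complete_space, 'e) markov_system \<Rightarrow> (nat \<Rightarrow> 'k) \<Rightarrow> bool" where
  "base_points M x \<longleftrightarrow> (\<forall>j\<in>vertices M. x j \<in> cell M j)"

definition displacement_bound :: "('k::complete_space, 'e) markov_system \<Rightarrow> (nat \<Rightarrow> 'k) \<Rightarrow> ennreal" where
  "displacement_bound M x =
     (SUP j\<in>vertices M. SUP y\<in>cell M j.
        \<integral>\<^sup>+ e. ennreal (prb M e y * dist (wmap M e (x (src M e))) (x (trg M e)))
          \<partial>count_space (out_edges M j))"


section \<open>The Markov operator and its adjoint\<close>

definition markov_op :: "('k::complete_space, 'e) markov_system \<Rightarrow> ('k \<Rightarrow> ennreal) \<Rightarrow> 'k \<Rightarrow> ennreal" where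
  "markov_op M f x = (\<integral>\<^sup>+ e. ennreal (prb M e x) * f (wmap M e x) \<partial>count_space (edges M))"

text \<open>
  The functional \<open>f \<mapsto> \<integral>Uf d\<nu>\<close> is represented by the Borel measure \<open>B \<mapsto> \<integral>U1\<^sub>B d\<nu>\<close>;
  see \<open>nn_integral_adjoint_op\<close> below.
\<close>

definition adjoint_op :: "('k::complete_space, 'e) markov_system \<Rightarrow> 'k measure \<Rightarrow> 'k measure" where
  "adjoint_op M \<nu> = measure_of UNIV (sets borel) (\<lambda>B. \<integral>\<^sup>+ x. markov_op M (indicator B) x \<partial>\<nu>)"

definition invariant_measures :: "('k::complete_space, 'e) markov_system \<Rightarrow> 'k measure set" where
  "invariant_measures M =
     {\<mu>. prob_space \<mu> \<and> sets \<mu> = sets borel \<and> adjoint_op M \<mu> = \<mu>}"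

definition alpha :: "('k::complete_space, 'e) markov_system \<Rightarrow> 'k \<Rightarrow> nat \<Rightarrow> nat measure" where
  "alpha M x n = point_measure (vertices M)
     (\<lambda>j. ennreal (1 / real n * (\<Sum>k=1..n. measure ((adjoint_op M ^^ k) (return borel x)) (cell M j))))"

definition alpha_uniformly_tight :: "('k::complete_space, 'e) markov_system \<Rightarrow> 'k \<Rightarrow> bool" where
  "alpha_uniformly_tight M x \<longleftrightarrow>
     (\<forall>\<epsilon>>0. \<exists>V\<subseteq>vertices M. finite V \<and> (\<forall>n\<ge>1. measure (alpha M x n) (vertices M - V) < \<epsilon>))"


section \<open>The code space\<close>

text \<open>The symbol \<open>\<infinity>\<close> adjoined to the edges is \<open>None\<close>.\<close>

definition symbols :: "('k, 'e) markov_system \<Rightarrow> 'e option set" where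
  "symbols M = insert None (Some ` edges M)"

fun src' :: "('k, 'e) markov_system \<Rightarrow> 'e option \<Rightarrow> nat" where
  "src' M None = 1"
| "src' M (Some e) = src M e"

fun trg' :: "('k, 'e) markov_system \<Rightarrow> 'e option \<Rightarrow> nat" where
  "trg' M None = 1"
| "trg' M (Some e) = trg M e"

fun wmap' :: "('k, 'e) markov_system \<Rightarrow> 'e option \<Rightarrow> 'k \<Rightarrow> 'k" where
  "wmap' M None = id"
| "wmap' M (Some e) = wmap M e"

fun prb' :: "('k, 'e) markov_system \<Rightarrow> 'e option \<Rightarrow> 'k \<Rightarrow> real" where
  "prb' M None = (\<lambda>_. 0)"
| "prb' M (Some e) = prb M e"

definition code_topology :: "('k, 'e) markov_system \<Rightarrow> (int \<Rightarrow> 'e option) topology" where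
  "code_topology M =
     product_topology (\<lambda>_. Alexandroff_compactification (discrete_topology (edges M))) UNIV"

definition code_space :: "('k, 'e) markov_system \<Rightarrow> (int \<Rightarrow> 'e option) set" where
  "code_space M = topspace (code_topology M)"

definition code_borel :: "('k, 'e) markov_system \<Rightarrow> (int \<Rightarrow> 'e option) measure" where
  "code_borel M = sigma (code_space M) {A. openin (code_topology M) A}"

definition code_shift :: "(int \<Rightarrow> 'e option) \<Rightarrow> int \<Rightarrow> 'e option" where
  "code_shift \<sigma> = (\<lambda>i. \<sigma> (i + 1))"

definition shift_invariant_measures ::
  "('k, 'e) markov_system \<Rightarrow> (int \<Rightarrow> 'e option) measure set" where
  "shift_invariant_measures M =
     {\<Lambda>. prob_space \<Lambda> \<and> sets \<Lambda> = sets (code_borel M) \<and> distr \<Lambda> (code_borel M) code_shift = \<Lambda>}"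

definition cylinder ::
  "('k, 'e) markov_system \<Rightarrow> int \<Rightarrow> int \<Rightarrow> (int \<Rightarrow> 'e option) \<Rightarrow> (int \<Rightarrow> 'e option) set" where
  "cylinder M m n e = {\<sigma> \<in> code_space M. \<forall>i\<in>{m..n}. \<sigma> i = e i}"

definition past_algebra :: "('k, 'e) markov_system \<Rightarrow> (int \<Rightarrow> 'e option) measure" where
  "past_algebra M =
     sigma (code_space M) {cylinder M m 0 e |m e. m \<le> 0 \<and> e \<in> {m..0} \<rightarrow> symbols M}"

definition path_space :: "('k, 'e) markov_system \<Rightarrow> (int \<Rightarrow> 'e option) set" where
  "path_space M =
     {\<sigma> \<in> code_space M. \<forall>n. \<sigma> n \<in> Some ` edges M \<and> src' M (\<sigma> (n + 1)) = trg' M (\<sigma> n)}"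

definition path_space_at :: "('k, 'e) markov_system \<Rightarrow> nat \<Rightarrow> (int \<Rightarrow> 'e option) set" where
  "path_space_at M j = {\<sigma> \<in> path_space M. trg' M (\<sigma> 0) = j}"

text \<open>
  \<open>wcomp M \<sigma> m k\<close> composes the \<open>k\<close> maps with the symbols \<open>\<sigma> m, \<dots>, \<sigma> (m + k - 1)\<close>, where the map of
  \<open>\<sigma> m\<close> is applied first.
\<close>

primrec wcomp ::
  "('k, 'e) markov_system \<Rightarrow> (int \<Rightarrow> 'e option) \<Rightarrow> int \<Rightarrow> nat \<Rightarrow> 'k \<Rightarrow> 'k" where
  "wcomp M \<sigma> m 0 = id"
| "wcomp M \<sigma> m (Suc k) = wmap' M (\<sigma> (m + int k)) \<circ> wcomp M \<sigma> m k"

definition backward_iterate ::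
  "('k, 'e) markov_system \<Rightarrow> (nat \<Rightarrow> 'k) \<Rightarrow> (int \<Rightarrow> 'e option) \<Rightarrow> nat \<Rightarrow> 'k" where
  "backward_iterate M x \<sigma> n =
     wcomp M \<sigma> (- int n) (Suc n) (x (src' M (\<sigma> (- int n))))"

definition coding_domain ::
  "('k::complete_space, 'e) markov_system \<Rightarrow> (nat \<Rightarrow> 'k) \<Rightarrow> (int \<Rightarrow> 'e option) set" where
  "coding_domain M x = {\<sigma> \<in> path_space M. convergent (backward_iterate M x \<sigma>)}"

definition coding_map ::
  "('k::complete_space, 'e) markov_system \<Rightarrow> (nat \<Rightarrow> 'k) \<Rightarrow> (int \<Rightarrow> 'e option) \<Rightarrow> 'k" where
  "coding_map M x \<sigma> =
     (if \<sigma> \<in> coding_domain M x then lim (backward_iterate M x \<sigma>) else x (trg' M (\<sigma> 0)))"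

definition coding_image ::
  "('k::complete_space, 'e) markov_system \<Rightarrow> (nat \<Rightarrow> 'k)
     \<Rightarrow> (int \<Rightarrow> 'e option) measure \<Rightarrow> 'k measure" where
  "coding_image M x \<Lambda> = distr \<Lambda> borel (coding_map M x)"


section \<open>Equilibrium states\<close>

definition cond_prob_edge ::
  "('k, 'e) markov_system \<Rightarrow> (int \<Rightarrow> 'e option) measure \<Rightarrow> 'e \<Rightarrow> (int \<Rightarrow> 'e option) \<Rightarrow> real" where
  "cond_prob_edge M \<Lambda> e =
     real_cond_exp \<Lambda> (past_algebra M) (indicator (cylinder M 1 1 (\<lambda>_. Some e)))"

definition equilibrium_states ::
  "('k::complete_space, 'e) markov_system \<Rightarrow> (nat \<Rightarrow> 'k) \<Rightarrow> (int \<Rightarrow> 'e option) measure set" where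
  "equilibrium_states M x =
     {\<Lambda> \<in> shift_invariant_measures M.
        emeasure \<Lambda> (coding_domain M x) = 1 \<and>
        (\<forall>e\<in>edges M. AE \<sigma> in \<Lambda>. cond_prob_edge M \<Lambda> e \<sigma> = prb M e (coding_map M x \<sigma>))}"

text \<open>
  The description in \<open>closure_prb\<close> determines a function uniquely; it exists if \<open>prb M e\<close> is
  uniformly continuous on the cell of the source of \<open>e\<close>.
\<close>

definition closure_prb :: "('k::complete_space, 'e) markov_system \<Rightarrow> 'e \<Rightarrow> 'k \<Rightarrow> real" where
  "closure_prb M e =
     (THE g. continuous_on (closure (cell M (src M e))) g \<and>
             (\<forall>x\<in>cell M (src M e). g x = prb M e x) \<and>
             (\<forall>x. x \<notin> closure (cell M (src M e)) \<longrightarrow> g x = 0))"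

definition closure_equilibrium_states ::
  "('k::complete_space, 'e) markov_system \<Rightarrow> (nat \<Rightarrow> 'k) \<Rightarrow> (int \<Rightarrow> 'e option) measure set" where
  "closure_equilibrium_states M x =
     {\<Lambda> \<in> shift_invariant_measures M.
        emeasure \<Lambda> (coding_domain M x) = 1 \<and>
        (\<forall>e\<in>edges M. AE \<sigma> in \<Lambda>.
           cond_prob_edge M \<Lambda> e \<sigma> =
             closure_prb M e (coding_map M x \<sigma>) * indicator (path_space_at M (src M e)) \<sigma>)}"

definition non_degenerate :: "('k::complete_space, 'e) markov_system \<Rightarrow> (nat \<Rightarrow> 'k) \<Rightarrow> bool" where
  "non_degenerate M x \<longleftrightarrow>
     (\<forall>\<Lambda>\<in>closure_equilibrium_states M x. \<exists>j\<in>vertices M.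
        emeasure \<Lambda> (path_space_at M j \<inter> {\<sigma> \<in> code_space M. coding_map M x \<sigma> \<in> cell M j}) > 0)"

definition markov_path_measure ::
  "('k::complete_space, 'e) markov_system \<Rightarrow> 'k measure \<Rightarrow> (int \<Rightarrow> 'e option) measure" where
  "markov_path_measure M \<mu> =
     (THE \<Lambda>. prob_space \<Lambda> \<and> sets \<Lambda> = sets (code_borel M) \<and>
        (\<forall>m n e. m \<le> 0 \<and> m \<le> n \<and> e \<in> {m..n} \<rightarrow> symbols M \<longrightarrow>
           emeasure \<Lambda> (cylinder M m n e) =
             (\<integral>\<^sup>+ x. ennreal (\<Prod>i\<in>{m..n}. prb' M (e i) (wcomp M e m (nat (i - m)) x)) \<partial>\<mu>)))"


section \<open>Consistency of the definitions\<close>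

lemma measurable_prb_wmap:
  assumes M: "countable_markov_system M" and "e \<in> edges M"
    and [measurable]: "f \<in> borel_measurable borel"
  shows "(\<lambda>x. ennreal (prb M e x) * f (wmap M e x)) \<in> borel_measurable borel"
proof -
  have [measurable]: "wmap M e \<in> borel_measurable borel" "prb M e \<in> borel_measurable borel"
    using assms by (auto simp: countable_markov_system_def)
  show ?thesis
    by measurable
qed

lemma measurable_markov_op:
  assumes M: "countable_markov_system M" and f: "f \<in> borel_measurable borel"
  shows "markov_op M f \<in> borel_measurable borel"
proof -
  have E: "countable (edges M)"
    using M by (simp add: countable_markov_system_def)
  have "(\<lambda>(e, x). ennreal (prb M e x) * f (wmap M e x))
          \<in> borel_measurable (count_space (edges M) \<Otimes>\<^sub>M borel)"
    using measurable_prb_wmap[OF M _ f] by (intro measurable_pair_measure_countable1 E) simp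
  from measurable_pair_swap[OF this] show ?thesis
    unfolding markov_op_def[abs_def]
    by (intro sigma_finite_measure.borel_measurable_nn_integral
          sigma_finite_measure_count_space_countable E) simp
qed

lemma sets_adjoint_op [simp]: "sets (adjoint_op M \<nu>) = sets borel"
  and space_adjoint_op [simp]: "space (adjoint_op M \<nu>) = UNIV"
  using sets.sigma_sets_eq[of borel]
  by (simp_all add: adjoint_op_def sets_measure_of_conv space_measure_of_conv)

lemma emeasure_adjoint_op:
  assumes M: "countable_markov_system M" and \<nu>: "sets \<nu> = sets borel" and B: "B \<in> sets borel"
  shows "emeasure (adjoint_op M \<nu>) B = (\<integral>\<^sup>+ x. markov_op M (indicator B) x \<partial>\<nu>)"
proof (rule emeasure_measure_of[OF adjoint_op_def])
  have \<nu>_cong: "borel_measurable \<nu> = borel_measurable borel"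
    using \<nu> by (simp cong: measurable_cong_sets)
  show "countably_additive (sets (adjoint_op M \<nu>))
          (\<lambda>B. \<integral>\<^sup>+ x. markov_op M (indicator B) x \<partial>\<nu>)"
  proof (rule countably_additiveI)
    fix A :: "nat \<Rightarrow> 'a set"
    assume "range A \<subseteq> sets (adjoint_op M \<nu>)" and disj: "disjoint_family A"
    then have A: "A n \<in> sets borel" for n
      by auto
    have "markov_op M (indicator (\<Union>n. A n)) x = (\<Sum>n. markov_op M (indicator (A n)) x)" for x
    proof -
      have "markov_op M (indicator (\<Union>n. A n)) x =
              (\<integral>\<^sup>+ e. (\<Sum>n. ennreal (prb M e x) * indicator (A n) (wmap M e x)) \<partial>count_space (edges M))"
        unfolding markov_op_def using disj by (simp add: suminf_indicator)
      also have "\<dots> = (\<Sum>n. markov_op M (indicator (A n)) x)"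
        unfolding markov_op_def by (rule nn_integral_suminf) simp
      finally show ?thesis .
    qed
    then show "(\<Sum>n. \<integral>\<^sup>+ x. markov_op M (indicator (A n)) x \<partial>\<nu>) =
                 (\<integral>\<^sup>+ x. markov_op M (indicator (\<Union>n. A n)) x \<partial>\<nu>)"
      using A by (simp add: nn_integral_suminf \<nu>_cong measurable_markov_op[OF M])
  qed
  show "positive (sets (adjoint_op M \<nu>)) (\<lambda>B. \<integral>\<^sup>+ x. markov_op M (indicator B) x \<partial>\<nu>)"
    by (simp add: positive_def markov_op_def)
qed (use B in auto)

lemma nn_integral_adjoint_op:
  assumes M: "countable_markov_system M" and \<nu>: "sets \<nu> = sets borel"
    and f: "f \<in> borel_measurable borel"
  shows "(\<integral>\<^sup>+ x. f x \<partial>adjoint_op M \<nu>) = (\<integral>\<^sup>+ x. markov_op M f x \<partial>\<nu>)"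
proof -
  have \<nu>_cong: "borel_measurable \<nu> = borel_measurable borel"
    and U_cong: "borel_measurable (adjoint_op M \<nu>) = borel_measurable borel"
    using \<nu> by (simp_all cong: measurable_cong_sets)
  note [simp] = \<nu>_cong U_cong
  show ?thesis
    using f
  proof (induction rule: borel_measurable_induct)
    case (cong f g)
    then have "f = g" by auto
    with cong show ?case by simp
  next
    case (set A)
    then show ?case
      using emeasure_adjoint_op[OF M \<nu> set] by simp
  next
    case (mult u c)
    have "markov_op M (\<lambda>x. c * u x) x = c * markov_op M u x" for x
      unfolding markov_op_def by (simp add: nn_integral_cmult[symmetric] mult.left_commute)
    with mult show ?case
      by (simp add: nn_integral_cmult measurable_markov_op[OF M])
  next
    case (add u v)
    have "markov_op M (\<lambda>x. v x + u x) x = markov_op M v x + markov_op M u x" for x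
      unfolding markov_op_def by (simp add: nn_integral_add[symmetric] distrib_left)
    with add show ?case
      by (simp add: nn_integral_add measurable_markov_op[OF M])
  next
    case (seq U)
    have *: "markov_op M (SUP i. U i) x = (SUP i. markov_op M (U i) x)" for x
    proof -
      have "markov_op M (SUP i. U i) x =
              (\<integral>\<^sup>+ e. (SUP i. ennreal (prb M e x) * U i (wmap M e x)) \<partial>count_space (edges M))"
        unfolding markov_op_def by (simp add: SUP_mult_left_ennreal image_comp)
      also have "\<dots> = (SUP i. markov_op M (U i) x)"
        unfolding markov_op_def using \<open>incseq U\<close>
        by (intro nn_integral_monotone_convergence_SUP)
           (auto simp: incseq_def le_fun_def intro!: mult_left_mono)
      finally show ?thesis .
    qed
    have "incseq (\<lambda>i. markov_op M (U i))"
      using \<open>incseq U\<close> unfolding markov_op_def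
      by (auto simp: incseq_def le_fun_def intro!: mult_left_mono nn_integral_mono)
    then have "(\<integral>\<^sup>+ x. markov_op M (SUP i. U i) x \<partial>\<nu>) = (SUP i. \<integral>\<^sup>+ x. markov_op M (U i) x \<partial>\<nu>)"
      using seq unfolding *
      by (intro nn_integral_monotone_convergence_SUP) (auto simp: measurable_markov_op[OF M])
    moreover have "(\<integral>\<^sup>+ x. (SUP i. U i) x \<partial>adjoint_op M \<nu>) = (SUP i. \<integral>\<^sup>+ x. U i x \<partial>adjoint_op M \<nu>)"
      using seq nn_integral_monotone_convergence_SUP[of U "adjoint_op M \<nu>"]
      by (simp add: image_comp)
    ultimately show ?case
      using seq.IH by (simp only:)
  qed
qed

lemma code_space_eq: "code_space M = {\<sigma>. \<forall>i. \<sigma> i \<in> symbols M}"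
  by (auto simp: code_space_def code_topology_def symbols_def PiE_def)

lemma space_code_borel [simp]: "space (code_borel M) = code_space M"
  by (simp add: code_borel_def space_measure_of_conv)

lemma sets_code_borel:
  "sets (code_borel M) = sigma_sets (code_space M) {A. openin (code_topology M) A}"
  unfolding code_borel_def
  by (rule sets_measure_of) (auto simp: code_space_def dest: openin_subset)

lemma open_in_code_borel: "openin (code_topology M) A \<Longrightarrow> A \<in> sets (code_borel M)"
  unfolding sets_code_borel by (rule sigma_sets.Basic) simp

lemma cylinder_in_code_borel:
  assumes "m \<le> n"
  shows "cylinder M m n e \<in> sets (code_borel M)"
proof -
  let ?X = "Alexandroff_compactification (discrete_topology (edges M))"
  have proj: "{\<sigma> \<in> code_space M. \<sigma> i \<in> Some ` A} \<in> sets (code_borel M)" if "A \<subseteq> edges M" for i A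
  proof (rule open_in_code_borel)
    have "continuous_map (code_topology M) ?X (\<lambda>\<sigma>. \<sigma> i)"
      unfolding code_topology_def by (rule continuous_map_product_projection) simp
    moreover have "openin ?X (Some ` A)"
      using that by simp
    ultimately show "openin (code_topology M) {\<sigma> \<in> code_space M. \<sigma> i \<in> Some ` A}"
      unfolding code_space_def by (rule openin_continuous_map_preimage)
  qed
  have "{\<sigma> \<in> code_space M. \<sigma> i = a} \<in> sets (code_borel M)" for i a
  proof (cases a)
    case None
    then have *: "{\<sigma> \<in> code_space M. \<sigma> i = a} =
                 space (code_borel M) - {\<sigma> \<in> code_space M. \<sigma> i \<in> Some ` edges M}"
      by (auto simp: code_space_eq symbols_def)
    show ?thesis
      unfolding * by (intro sets.compl_sets proj order_refl)
  next
    case (Some b)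
    have eq: "c = Some b \<longleftrightarrow> c \<in> Some ` ({b} \<inter> edges M)" if "c \<in> symbols M" for c
      using that by (auto simp: symbols_def)
    have *: "{\<sigma> \<in> code_space M. \<sigma> i = a} = {\<sigma> \<in> code_space M. \<sigma> i \<in> Some ` ({b} \<inter> edges M)}"
      unfolding Some by (intro Collect_cong conj_cong refl eq) (simp add: code_space_eq)
    show ?thesis
      unfolding * by (intro proj Int_lower2)
  qed
  moreover have "cylinder M m n e = (\<Inter>i\<in>{m..n}. {\<sigma> \<in> code_space M. \<sigma> i = e i})"
    using assms by (auto simp: cylinder_def)
  ultimately show ?thesis
    using assms by (simp only:) (intro sets.finite_INT, simp_all)
qed

lemma subalgebra_past_algebra:
  assumes "sets \<Lambda> = sets (code_borel M)"
  shows "subalgebra \<Lambda> (past_algebra M)"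
proof -
  define G where "G = {cylinder M m 0 e |m e. m \<le> 0 \<and> e \<in> {m..0} \<rightarrow> symbols M}"
  have "G \<subseteq> Pow (code_space M)"
    unfolding G_def cylinder_def by blast
  then have "sets (past_algebra M) = sigma_sets (code_space M) G"
    unfolding past_algebra_def G_def[symmetric] by (rule sets_measure_of)
  moreover have "G \<subseteq> sets (code_borel M)"
    using cylinder_in_code_borel unfolding G_def by blast
  then have "sigma_sets (code_space M) G \<subseteq> sets (code_borel M)"
    using sets.sigma_sets_subset[of G "code_borel M"] by simp
  moreover have "space (past_algebra M) = code_space M"
    unfolding past_algebra_def by (simp add: space_measure_of_conv)
  moreover have "space \<Lambda> = code_space M"
    using sets_eq_imp_space_eq[OF assms] by simp
  ultimately show ?thesis
    unfolding subalgebra_def assms by simp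
qed

lemma measurable_code_shift: "code_shift \<in> measurable (code_borel M) (code_borel M)"
proof (rule measurable_sigma_sets[OF sets_code_borel])
  show "{A. openin (code_topology M) A} \<subseteq> Pow (code_space M)"
    using openin_subset unfolding code_space_def by blast
  show "code_shift \<in> space (code_borel M) \<rightarrow> code_space M"
    by (auto simp: code_shift_def code_space_eq)
  have "continuous_map (code_topology M) (code_topology M) code_shift"
    unfolding code_topology_def continuous_map_componentwise_UNIV code_shift_def
    by (intro allI continuous_map_product_projection) simp
  then have "openin (code_topology M) {\<sigma> \<in> code_space M. code_shift \<sigma> \<in> A}"
    if "openin (code_topology M) A" for A
    using that unfolding code_space_def by (rule openin_continuous_map_preimage)
  moreover have "code_shift -` A \<inter> code_space M = {\<sigma> \<in> code_space M. code_shift \<sigma> \<in> A}" for A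
    by blast
  ultimately show "code_shift -` A \<inter> space (code_borel M) \<in> sets (code_borel M)"
    if "A \<in> {A. openin (code_topology M) A}" for A
    using that by (simp add: open_in_code_borel)
qed

end

theory Submission
  imports Defs "HOL-Complex_Analysis.Great_Picard"
begin

text \<open>
  Write \<open>p\<^sub>w(z)\<close> (\<open>word_prb\<close>) for the probability that the system started at \<open>z\<close> follows the word
  \<open>w\<close> of edges, and \<open>w(z)\<close> (\<open>word_map\<close>) for the point that it reaches.  Let \<open>V(z)\<close> (\<open>lyap\<close>) be the
  distance of \<open>z\<close> to the base point of its cell.  Everything rests on two inequalities.
  Contraction on average gives \<open>\<Sum>\<^sub>w p\<^sub>w(z) d(w z, w y) \<le> a\<^sup>n d(z, y)\<close> for \<open>z, y\<close> in one cell, where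
  \<open>w\<close> runs over the words of length \<open>n\<close> (\<open>contraction_words\<close>); together with the bound \<open>b\<close> on the
  displacement of the base points it gives the drift \<open>U V \<le> a V + b\<close> (\<open>drift\<close>).  Hence every invariant
  measure integrates \<open>V\<close> (\<open>invariant_lyap\<close>), and so do the averages of the laws along any orbit,
  with a common bound (\<open>lyap_cesaro\<close>).

  Let \<open>\<Lambda>\<close> be a shift-invariant measure whose word probabilities are limits of the path laws of
  starting measures \<open>\<nu>\<^sub>n\<close> with bounded \<open>\<integral>V d\<nu>\<^sub>n\<close>.  By Fatou's lemma the bounds above pass to \<open>\<Lambda>\<close>.  The
  distance of consecutive backward iterates has geometrically small \<open>\<Lambda>\<close>-mean, so the coding map is
  defined almost everywhere (\<open>AE_coding_domain\<close>).  Moreover, the point reached after a long past word is,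
  in mean, close to the backward iterate of that word, so for a test function \<open>f\<close> the limit of
  \<open>\<integral>p\<^sub>w f(w z) d\<nu>\<^sub>n(z)\<close> is the \<open>\<Lambda>\<close>-integral of \<open>lim f(Y\<^sub>k)\<close> over the past cylinder of \<open>w\<close>, where
  \<open>Y\<^sub>k\<close> are the backward iterates (\<open>limit_integral\<close>).  This is used twice.

  For an invariant measure \<open>\<mu>\<close>, take \<open>\<nu>\<^sub>n = \<mu>\<close> and \<open>\<Lambda> = \<Phi>(\<mu>)\<close>.  Then the coding map \<open>F\<close> satisfies
  \<open>\<integral>\<^sub>[\<^sub>w\<^sub>] h(F) d\<Lambda> = \<integral>p\<^sub>w h(w z) d\<mu>(z)\<close> for every Borel \<open>h\<close>; the empty word gives \<open>F(\<Phi>(\<mu>)) = \<mu>\<close> and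
  \<open>h = p\<^sub>e\<close> gives the equilibrium property (\<open>invariant_coding\<close>).  Conversely, if \<open>\<Lambda>\<close> is an equilibrium
  state, then \<open>F(\<sigma>)\<close> almost surely lies in the cell from which \<open>\<sigma>\<^sub>1\<close> departs, because \<open>p\<^sub>e\<close> vanishes off
  the cell of the source of \<open>e\<close>.  There \<open>w\<^sub>e\<close> is continuous, so \<open>F(S\<sigma>) = w\<^sub>e(F(\<sigma>))\<close> for \<open>e = \<sigma>\<^sub>1\<close>
  (\<open>coding_map_shift\<close>); with the conditional probabilities this identity yields the invariance of
  \<open>F(\<Lambda>)\<close> and, by induction over words, \<open>\<Phi>(F(\<Lambda>)) = \<Lambda>\<close> (\<open>equilibrium_coding\<close>).  As \<open>\<Phi>\<close> does not
  involve the base points, equilibrium states and their images do not depend on them.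

  If there is an equilibrium state, there is an invariant measure, and a maximal inequality for the
  Markov operator shows that some orbit is tight (\<open>maximal_inequality\<close>, \<open>exists_tight_orbit\<close>).
  Conversely, let an orbit be tight and take for \<open>\<nu>\<^sub>n\<close> a subsequence of its averages along which all word
  probabilities converge.  Tightness controls the vertices and the dominating Markov chain controls the
  edges that leave a vertex, so no mass is lost and the limits are the word probabilities of a
  shift-invariant measure \<open>\<Lambda>\<close> (\<open>tight_limit_law\<close>).  Its conditional probabilities are the continuous
  extensions of the \<open>p\<^sub>e\<close> to the closures of the cells, evaluated at \<open>F\<close> on the codes that can be
  continued by \<open>e\<close> (\<open>closure_kernel_limit\<close>).
  Non-degeneracy now provides a set of positive measure on which \<open>F(\<sigma>)\<close> lies in the current cell itself.
  The codes with this property form a set that is shift-invariant up to null sets, and the law of \<open>F\<close>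
  conditioned on it is an invariant measure (\<open>invariant_from_closure_kernel\<close>).
\<close>

section \<open>Words of edges and their probabilities\<close>

primrec word_prb :: "('k, 'e) markov_system \<Rightarrow> 'e list \<Rightarrow> 'k \<Rightarrow> real" where
  "word_prb M [] z = 1"
| "word_prb M (e # w) z = prb M e z * word_prb M w (wmap M e z)"

primrec word_map :: "('k, 'e) markov_system \<Rightarrow> 'e list \<Rightarrow> 'k \<Rightarrow> 'k" where
  "word_map M [] z = z"
| "word_map M (e # w) z = word_map M w (wmap M e z)"

definition words :: "('k, 'e) markov_system \<Rightarrow> nat \<Rightarrow> 'e list set" where
  "words M n = {w. set w \<subseteq> edges M \<and> length w = n}"

lemma word_prb_append: "word_prb M (u @ v) z = word_prb M u z * word_prb M v (word_map M u z)"
  by (induction u arbitrary: z) simp_all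

lemma word_map_append: "word_map M (u @ v) z = word_map M v (word_map M u z)"
  by (induction u arbitrary: z) simp_all

lemma words_0 [simp]: "words M 0 = {[]}"
  by (auto simp: words_def)

lemma words_1: "words M (Suc 0) = (\<lambda>e. [e]) ` edges M"
  by (auto simp: words_def length_Suc_conv)

lemma Cons_in_words [simp]: "e # w \<in> words M (Suc n) \<longleftrightarrow> e \<in> edges M \<and> w \<in> words M n"
  by (auto simp: words_def)

lemma bij_betw_append_words:
  "bij_betw (\<lambda>(u, v). u @ v) (words M m \<times> words M n) (words M (m + n))"
proof (rule bij_betwI[where g = "\<lambda>w. (take m w, drop m w)"])
  show "(\<lambda>w. (take m w, drop m w)) \<in> words M (m + n) \<rightarrow> words M m \<times> words M n"
    by (auto simp: words_def dest: in_set_takeD in_set_dropD)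
qed (auto simp: words_def)

lemma measurable_dist_const [measurable]:
  "(\<lambda>z :: 'a::metric_space. dist z c) \<in> borel_measurable borel"
  by (intro borel_measurable_continuous_onI continuous_intros)

locale markov =
  fixes M :: "('k::complete_space, 'e) markov_system"
  assumes countable_markov_system: "countable_markov_system M"
begin

lemma countable_edges: "countable (edges M)"
  using countable_markov_system by (simp add: countable_markov_system_def)

lemma countable_words: "countable (words M n)"
proof (rule countable_subset)
  show "words M n \<subseteq> lists (edges M)"
    by (auto simp: words_def)
qed (simp add: countable_edges)

lemma cell_borel [measurable]: "j \<in> vertices M \<Longrightarrow> cell M j \<in> sets borel"
  using countable_markov_system by (simp add: countable_markov_system_def)

lemma src_in [simp]: "e \<in> edges M \<Longrightarrow> src M e \<in> vertices M"
  using countable_markov_system by (auto simp: countable_markov_system_def)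

lemma trg_in [simp]: "e \<in> edges M \<Longrightarrow> trg M e \<in> vertices M"
  using countable_markov_system by (auto simp: countable_markov_system_def)

lemma wmap_cell: "e \<in> edges M \<Longrightarrow> z \<in> cell M (src M e) \<Longrightarrow> wmap M e z \<in> cell M (trg M e)"
  using countable_markov_system by (auto simp: countable_markov_system_def)

lemma measurable_wmap [measurable]: "e \<in> edges M \<Longrightarrow> wmap M e \<in> borel_measurable borel"
  using countable_markov_system by (auto simp: countable_markov_system_def)

lemma measurable_prb [measurable]: "e \<in> edges M \<Longrightarrow> prb M e \<in> borel_measurable borel"
  using countable_markov_system by (auto simp: countable_markov_system_def)

lemma prb_outside: "e \<in> edges M \<Longrightarrow> z \<notin> cell M (src M e) \<Longrightarrow> prb M e z = 0"
  using countable_markov_system by (auto simp: countable_markov_system_def)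

lemma prb_nonneg [simp]: "e \<in> edges M \<Longrightarrow> 0 \<le> prb M e z"
  and prb_le_1 [simp]: "e \<in> edges M \<Longrightarrow> prb M e z \<le> 1"
  using countable_markov_system
  by (cases "z \<in> cell M (src M e)"; force simp: countable_markov_system_def)+

definition cell_index :: "'k \<Rightarrow> nat" where
  "cell_index z = (THE j. j \<in> vertices M \<and> z \<in> cell M j)"

lemma cell_index_eq: "j \<in> vertices M \<Longrightarrow> z \<in> cell M j \<Longrightarrow> cell_index z = j"
  using countable_markov_system unfolding cell_index_def countable_markov_system_def
  by (intro the_equality) (auto simp: disjoint_family_on_def)

lemma cell_index_in: "cell_index z \<in> vertices M"
  and in_cell_index: "z \<in> cell M (cell_index z)"
proof -
  have "(\<Union>j\<in>vertices M. cell M j) = UNIV"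
    using countable_markov_system by (simp add: countable_markov_system_def)
  then obtain j where "j \<in> vertices M" "z \<in> cell M j"
    by blast
  then show "cell_index z \<in> vertices M" "z \<in> cell M (cell_index z)"
    using cell_index_eq by auto
qed

lemma in_cell_iff: "j \<in> vertices M \<Longrightarrow> z \<in> cell M j \<longleftrightarrow> cell_index z = j"
  using cell_index_eq in_cell_index by auto

lemma measurable_cell_index [measurable]: "cell_index \<in> measurable borel (count_space (vertices M))"
proof (rule measurable_count_space_eq_countable[THEN iffD2, rotated])
  have "cell_index -` {j} \<inter> space borel = cell M j" if "j \<in> vertices M" for j
    using that by (auto simp: in_cell_iff)
  then show "cell_index \<in> space borel \<rightarrow> vertices M \<and>
      (\<forall>j\<in>vertices M. cell_index -` {j} \<inter> space borel \<in> sets borel)"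
    by (auto simp: cell_index_in)
qed auto

lemma nn_integral_out_edges:
  assumes "j \<in> vertices M" "z \<in> cell M j"
  shows "(\<integral>\<^sup>+ e. ennreal (prb M e z) * f e \<partial>count_space (out_edges M j)) =
         (\<integral>\<^sup>+ e. ennreal (prb M e z) * f e \<partial>count_space (edges M))"
proof (rule nn_integral_count_space_eq)
  fix e assume "e \<in> edges M - out_edges M j"
  then have e: "e \<in> edges M" "src M e \<noteq> j"
    by (auto simp: out_edges_def)
  then have "z \<notin> cell M (src M e)"
    using assms by (simp add: in_cell_iff)
  then show "ennreal (prb M e z) * f e = 0"
    using e by (simp add: prb_outside)
qed (auto simp: out_edges_def)

lemma sum_prb: "(\<integral>\<^sup>+ e. ennreal (prb M e z) \<partial>count_space (edges M)) = 1"
proof -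
  have "(\<integral>\<^sup>+ e. ennreal (prb M e z) * 1 \<partial>count_space (out_edges M (cell_index z))) = 1"
    using countable_markov_system cell_index_in[of z] in_cell_index[of z]
    by (auto simp: countable_markov_system_def)
  then show ?thesis
    by (subst (asm) nn_integral_out_edges[OF cell_index_in in_cell_index]) simp
qed

lemma word_prb_bounds: "set w \<subseteq> edges M \<Longrightarrow> 0 \<le> word_prb M w z \<and> word_prb M w z \<le> 1"
  by (induction w arbitrary: z) (auto intro!: mult_le_one)

lemma word_prb_nonneg [simp]: "set w \<subseteq> edges M \<Longrightarrow> 0 \<le> word_prb M w z"
  and word_prb_le_1 [simp]: "set w \<subseteq> edges M \<Longrightarrow> word_prb M w z \<le> 1"
  using word_prb_bounds by auto

lemma measurable_word_map: "set w \<subseteq> edges M \<Longrightarrow> word_map M w \<in> borel_measurable borel"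
proof (induction w)
  case (Cons e w)
  then have [measurable]: "word_map M w \<in> borel_measurable borel" "e \<in> edges M"
    by auto
  show ?case
    by simp
qed (simp add: fun_eq_iff[symmetric] cong: measurable_cong)

lemma measurable_word_prb: "set w \<subseteq> edges M \<Longrightarrow> word_prb M w \<in> borel_measurable borel"
proof (induction w)
  case (Cons e w)
  then have [measurable]: "word_prb M w \<in> borel_measurable borel" "e \<in> edges M"
    by auto
  show ?case
    by simp
qed (simp cong: measurable_cong)

lemmas [measurable] = measurable_word_map measurable_word_prb

text \<open>
  Words of positive weight are paths of the underlying graph.  They move a whole cell into one cell,
  so the two points whose distance is estimated below never get separated into different cells.
\<close>
lemma word_prb_pos_path:
  assumes "set w \<subseteq> edges M" "w \<noteq> []" "word_prb M w z \<noteq> 0"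
  shows "z \<in> cell M (src M (hd w))"
    and "y \<in> cell M (src M (hd w)) \<Longrightarrow> word_map M w y \<in> cell M (trg M (last w))"
  using assms
proof (induction w arbitrary: z y)
  case (Cons e w)
  { case 1
    then show ?case using prb_outside by fastforce }
  { case 2
    then have y: "wmap M e y \<in> cell M (trg M e)" and z: "z \<in> cell M (src M e)"
      using prb_outside wmap_cell by (fastforce, fastforce)
    show ?case
    proof (cases "w = []")
      case False
      have "wmap M e z \<in> cell M (src M (hd w))" "wmap M e z \<in> cell M (trg M e)"
        using 2 False Cons.IH(1)[of "wmap M e z"] wmap_cell[OF _ z] by auto
      moreover have "src M (hd w) \<in> vertices M" "trg M e \<in> vertices M"
        using 2 False hd_in_set[OF False] by (auto intro!: src_in trg_in)
      ultimately have "src M (hd w) = trg M e"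
        by (simp add: in_cell_iff)
      then show ?thesis
        using 2 False y Cons.IH(2)[of "wmap M e y" "wmap M e z"] by auto
    qed (use y in simp) }
qed simp_all

text \<open>
  Concatenation is a bijection, and all sets of words are countable, so that Fubini's theorem applies
  to the counting measures.
\<close>
lemma nn_integral_words_append:
  "(\<integral>\<^sup>+ w. g w \<partial>count_space (words M (m + n))) =
   (\<integral>\<^sup>+ u. \<integral>\<^sup>+ v. g (u @ v) \<partial>count_space (words M n) \<partial>count_space (words M m))"
proof -
  interpret sigma_finite_measure "count_space (words M n)"
    by (intro sigma_finite_measure_count_space_countable countable_words)
  have "(\<integral>\<^sup>+ w. g w \<partial>count_space (words M (m + n))) =
        (\<integral>\<^sup>+ p. g (case p of (u, v) \<Rightarrow> u @ v) \<partial>count_space (words M m \<times> words M n))"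
    by (rule nn_integral_bij_count_space[OF bij_betw_append_words, symmetric])
  also have "\<dots> = (\<integral>\<^sup>+ p. g (fst p @ snd p) \<partial>(count_space (words M m) \<Otimes>\<^sub>M count_space (words M n)))"
    by (simp add: pair_measure_countable countable_words case_prod_unfold)
  also have "\<dots> = (\<integral>\<^sup>+ u. \<integral>\<^sup>+ v. g (u @ v) \<partial>count_space (words M n) \<partial>count_space (words M m))"
    by (subst nn_integral_fst[symmetric])
       (simp_all add: pair_measure_countable countable_words)
  finally show ?thesis .
qed

lemma nn_integral_words_1:
  "(\<integral>\<^sup>+ w. g w \<partial>count_space (words M (Suc 0))) = (\<integral>\<^sup>+ e. g [e] \<partial>count_space (edges M))"
  unfolding words_1
  by (rule nn_integral_bij_count_space[symmetric]) (auto simp: bij_betw_def inj_on_def)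

lemma nn_integral_words_Cons:
  "(\<integral>\<^sup>+ w. g w \<partial>count_space (words M (Suc n))) =
   (\<integral>\<^sup>+ e. \<integral>\<^sup>+ w. g (e # w) \<partial>count_space (words M n) \<partial>count_space (edges M))"
  using nn_integral_words_append[where g = g and m = "Suc 0" and n = n] by (simp add: nn_integral_words_1)

lemma nn_integral_words_snoc:
  "(\<integral>\<^sup>+ w. g w \<partial>count_space (words M (Suc n))) =
   (\<integral>\<^sup>+ w. \<integral>\<^sup>+ e. g (w @ [e]) \<partial>count_space (edges M) \<partial>count_space (words M n))"
  using nn_integral_words_append[where g = g and m = n and n = "Suc 0"] by (simp add: nn_integral_words_1)

lemma nn_integral_prb_word_Cons:
  "(\<integral>\<^sup>+ w. ennreal (word_prb M w z) * g w \<partial>count_space (words M (Suc n))) =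
   (\<integral>\<^sup>+ e. ennreal (prb M e z) *
      (\<integral>\<^sup>+ w. ennreal (word_prb M w (wmap M e z)) * g (e # w) \<partial>count_space (words M n))
      \<partial>count_space (edges M))"
  unfolding nn_integral_words_Cons
proof (rule nn_integral_cong)
  fix e assume "e \<in> space (count_space (edges M))"
  then have "e \<in> edges M" by simp
  then have "(\<integral>\<^sup>+ w. ennreal (word_prb M (e # w) z) * g (e # w) \<partial>count_space (words M n)) =
    (\<integral>\<^sup>+ w. ennreal (prb M e z) * (ennreal (word_prb M w (wmap M e z)) * g (e # w))
       \<partial>count_space (words M n))"
    by (intro nn_integral_cong) (auto simp: words_def ennreal_mult mult.assoc)
  then show "(\<integral>\<^sup>+ w. ennreal (word_prb M (e # w) z) * g (e # w) \<partial>count_space (words M n)) =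
      ennreal (prb M e z) *
        (\<integral>\<^sup>+ w. ennreal (word_prb M w (wmap M e z)) * g (e # w) \<partial>count_space (words M n))"
    by (simp add: nn_integral_cmult)
qed

lemma sum_word_prb: "(\<integral>\<^sup>+ w. ennreal (word_prb M w z) \<partial>count_space (words M n)) = 1"
proof (induction n arbitrary: z)
  case 0
  then show ?case by (simp add: nn_integral_count_space_finite)
next
  case (Suc n)
  then show ?case
    using nn_integral_prb_word_Cons[where z = z and g = "\<lambda>_. 1" and n = n] by (simp add: sum_prb)
qed

subsection \<open>The Markov operator and invariant measures\<close>

lemma markov_op_mono: "(\<And>z. f z \<le> g z) \<Longrightarrow> markov_op M f z \<le> markov_op M g z"
  unfolding markov_op_def by (intro nn_integral_mono mult_left_mono) auto

lemma markov_op_const [simp]: "markov_op M (\<lambda>_. c) z = c"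
  unfolding markov_op_def by (simp add: nn_integral_multc sum_prb)

lemma markov_op_affine: "markov_op M (\<lambda>z. c * f z + d) z = c * markov_op M f z + d"
proof -
  have "markov_op M (\<lambda>z. c * f z + d) z =
     (\<integral>\<^sup>+ e. c * (ennreal (prb M e z) * f (wmap M e z)) + ennreal (prb M e z) * d \<partial>count_space (edges M))"
    unfolding markov_op_def by (simp add: distrib_left mult.left_commute)
  also have "\<dots> = c * markov_op M f z + d"
    by (simp add: nn_integral_add nn_integral_cmult nn_integral_multc sum_prb markov_op_def)
  finally show ?thesis .
qed

lemma markov_op_add: "markov_op M (\<lambda>z. f z + g z) z = markov_op M f z + markov_op M g z"
  unfolding markov_op_def by (simp add: distrib_left nn_integral_add)

lemma measurable_markov_op_pow:
  "f \<in> borel_measurable borel \<Longrightarrow> (markov_op M ^^ n) f \<in> borel_measurable borel"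
  by (induction n) (simp_all add: measurable_markov_op[OF countable_markov_system])

lemma prob_space_adjoint_op:
  assumes "prob_space \<nu>" "sets \<nu> = sets borel"
  shows "prob_space (adjoint_op M \<nu>)"
proof
  have "emeasure (adjoint_op M \<nu>) UNIV = (\<integral>\<^sup>+ x. markov_op M (\<lambda>_. 1) x \<partial>\<nu>)"
    by (subst emeasure_adjoint_op[OF countable_markov_system]) (use assms in \<open>auto simp: indicator_def\<close>)
  then show "emeasure (adjoint_op M \<nu>) (space (adjoint_op M \<nu>)) = 1"
    using assms by (simp add: prob_space.emeasure_space_1)
qed

lemma nn_integral_adjoint_op_pow:
  assumes "sets \<nu> = sets borel" "f \<in> borel_measurable borel"
  shows "(\<integral>\<^sup>+ z. f z \<partial>(adjoint_op M ^^ n) \<nu>) = (\<integral>\<^sup>+ z. (markov_op M ^^ n) f z \<partial>\<nu>)"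
  using assms(2)
proof (induction n arbitrary: f)
  case (Suc n)
  have "sets ((adjoint_op M ^^ n) \<nu>) = sets borel"
    using assms(1) by (cases n) simp_all
  then have "(\<integral>\<^sup>+ z. f z \<partial>(adjoint_op M ^^ Suc n) \<nu>) =
             (\<integral>\<^sup>+ z. markov_op M f z \<partial>(adjoint_op M ^^ n) \<nu>)"
    using Suc.prems by (simp add: nn_integral_adjoint_op[OF countable_markov_system])
  also have "\<dots> = (\<integral>\<^sup>+ z. (markov_op M ^^ Suc n) f z \<partial>\<nu>)"
    by (subst Suc.IH)
       (simp_all add: Suc.prems measurable_markov_op[OF countable_markov_system] funpow_swap1)
  finally show ?case .
qed simp

lemma invariant_nn_integral:
  assumes "\<mu> \<in> invariant_measures M" "f \<in> borel_measurable borel"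
  shows "(\<integral>\<^sup>+ z. markov_op M f z \<partial>\<mu>) = (\<integral>\<^sup>+ z. f z \<partial>\<mu>)"
  using assms nn_integral_adjoint_op[OF countable_markov_system, of \<mu> f]
  by (simp add: invariant_measures_def)

lemma invariant_nn_integral_pow:
  assumes "\<mu> \<in> invariant_measures M" "f \<in> borel_measurable borel"
  shows "(\<integral>\<^sup>+ z. (markov_op M ^^ n) f z \<partial>\<mu>) = (\<integral>\<^sup>+ z. f z \<partial>\<mu>)"
  using assms
  by (induction n) (simp_all add: invariant_nn_integral measurable_markov_op_pow)

end

section \<open>Contraction and drift towards the base points\<close>

locale contractive_markov = markov M for M :: "('k::complete_space, 'e) markov_system" +
  fixes x :: "nat \<Rightarrow> 'k" and a :: real and b :: real
  assumes base_points: "base_points M x"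
    and contractive: "contractive M a"
    and b_nonneg [simp]: "0 \<le> b"
    and displacement: "displacement_bound M x = ennreal b"
begin

lemma a_pos [simp]: "0 < a" and a_less_1 [simp]: "a < 1"
  using contractive by (auto simp: contractive_def)

lemma a_nonneg [simp]: "0 \<le> a"
  using a_pos by linarith

lemma base_in_cell: "j \<in> vertices M \<Longrightarrow> x j \<in> cell M j"
  using base_points by (simp add: base_points_def)

lemma contraction_step:
  assumes "j \<in> vertices M" "z \<in> cell M j" "y \<in> cell M j"
  shows "(\<integral>\<^sup>+ e. ennreal (prb M e z) * ennreal (dist (wmap M e z) (wmap M e y)) \<partial>count_space (edges M))
         \<le> ennreal (a * dist z y)"
proof -
  have "(\<integral>\<^sup>+ e. ennreal (prb M e z) * ennreal (dist (wmap M e z) (wmap M e y)) \<partial>count_space (out_edges M j))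
     = (\<integral>\<^sup>+ e. ennreal (prb M e z * dist (wmap M e z) (wmap M e y)) \<partial>count_space (out_edges M j))"
    by (intro nn_integral_cong) (simp add: ennreal_mult'' out_edges_def)
  then show ?thesis
    using contractive assms
    by (simp add: nn_integral_out_edges[OF assms(1,2), symmetric] contractive_def)
qed

text \<open>
  The weights are those of the path of \<open>z\<close>, and \<open>y\<close> is carried along.  After an edge of positive
  weight both points are in one cell again, so the contraction estimate can be iterated.
\<close>
lemma contraction_words:
  assumes "j \<in> vertices M" "z \<in> cell M j" "y \<in> cell M j"
  shows "(\<integral>\<^sup>+ w. ennreal (word_prb M w z) * ennreal (dist (word_map M w z) (word_map M w y))
            \<partial>count_space (words M n)) \<le> ennreal (a ^ n * dist z y)"
  using assms
proof (induction n arbitrary: j z y)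
  case 0
  then show ?case by (simp add: nn_integral_count_space_finite)
next
  case (Suc n)
  have "(\<integral>\<^sup>+ w. ennreal (word_prb M w z) * ennreal (dist (word_map M w z) (word_map M w y))
            \<partial>count_space (words M (Suc n))) =
        (\<integral>\<^sup>+ e. ennreal (prb M e z) * (\<integral>\<^sup>+ w. ennreal (word_prb M w (wmap M e z)) *
            ennreal (dist (word_map M w (wmap M e z)) (word_map M w (wmap M e y)))
            \<partial>count_space (words M n)) \<partial>count_space (edges M))"
    by (subst nn_integral_prb_word_Cons) simp
  also have "\<dots> \<le> (\<integral>\<^sup>+ e. ennreal (prb M e z) * ennreal (a ^ n * dist (wmap M e z) (wmap M e y))
                      \<partial>count_space (edges M))"
  proof (rule nn_integral_mono)
    fix e assume "e \<in> space (count_space (edges M))"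
    then have e: "e \<in> edges M" by simp
    show "ennreal (prb M e z) * (\<integral>\<^sup>+ w. ennreal (word_prb M w (wmap M e z)) *
            ennreal (dist (word_map M w (wmap M e z)) (word_map M w (wmap M e y)))
            \<partial>count_space (words M n))
          \<le> ennreal (prb M e z) * ennreal (a ^ n * dist (wmap M e z) (wmap M e y))"
    proof (cases "prb M e z = 0")
      case False
      then have "src M e = j"
        using prb_outside[OF e, of z] Suc.prems e src_in[OF e] in_cell_iff by metis
      then show ?thesis
        using Suc.prems e by (intro mult_left_mono Suc.IH[of "trg M e"] wmap_cell) auto
    qed simp
  qed
  also have "\<dots> = ennreal (a ^ n) * (\<integral>\<^sup>+ e. ennreal (prb M e z) *
      ennreal (dist (wmap M e z) (wmap M e y)) \<partial>count_space (edges M))"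
    by (subst nn_integral_cmult[symmetric]) (simp_all add: ennreal_mult mult_ac)
  also have "\<dots> \<le> ennreal (a ^ n) * ennreal (a * dist z y)"
    by (intro mult_left_mono contraction_step[OF Suc.prems]) simp
  also have "\<dots> = ennreal (a ^ Suc n * dist z y)"
    by (simp add: ennreal_mult'[symmetric] mult_ac)
  finally show ?case .
qed

text \<open>
  A Lyapunov function: the Markov operator contracts it up to an additive constant.
\<close>
definition lyap :: "'k \<Rightarrow> real" where
  "lyap z = dist z (x (cell_index z))"

lemma lyap_nonneg [simp]: "0 \<le> lyap z"
  by (simp add: lyap_def)

lemma measurable_lyap [measurable]: "lyap \<in> borel_measurable borel"
  unfolding lyap_def
  by (rule measurable_compose_countable'[where I = "vertices M" and g = cell_index
        and f = "\<lambda>j z. dist z (x j)"]) auto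

lemma displacement_step:
  assumes "j \<in> vertices M" "z \<in> cell M j"
  shows "(\<integral>\<^sup>+ e. ennreal (prb M e z) * ennreal (dist (wmap M e (x (src M e))) (x (trg M e)))
            \<partial>count_space (edges M)) \<le> ennreal b"
proof -
  have "(\<integral>\<^sup>+ e. ennreal (prb M e z) * ennreal (dist (wmap M e (x (src M e))) (x (trg M e)))
            \<partial>count_space (edges M)) =
        (\<integral>\<^sup>+ e. ennreal (prb M e z * dist (wmap M e (x (src M e))) (x (trg M e)))
            \<partial>count_space (out_edges M j))"
    by (subst nn_integral_out_edges[OF assms, symmetric], intro nn_integral_cong)
       (simp add: ennreal_mult'' out_edges_def)
  also have "\<dots> \<le> displacement_bound M x"
    unfolding displacement_bound_def using assms by (intro SUP_upper2[of j] SUP_upper2[of z]) auto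
  finally show ?thesis
    by (simp add: displacement)
qed

lemma contraction_base:
  "(\<integral>\<^sup>+ e. ennreal (prb M e z) * ennreal (dist (wmap M e z) (wmap M e (x (src M e))))
      \<partial>count_space (edges M)) \<le> ennreal (a * lyap z)"
proof -
  have "(\<integral>\<^sup>+ e. ennreal (prb M e z) * ennreal (dist (wmap M e z) (wmap M e (x (src M e))))
      \<partial>count_space (edges M)) =
    (\<integral>\<^sup>+ e. ennreal (prb M e z) * ennreal (dist (wmap M e z) (wmap M e (x (cell_index z))))
      \<partial>count_space (edges M))"
  proof (rule nn_integral_cong)
    fix e assume "e \<in> space (count_space (edges M))"
    then show "ennreal (prb M e z) * ennreal (dist (wmap M e z) (wmap M e (x (src M e)))) =
       ennreal (prb M e z) * ennreal (dist (wmap M e z) (wmap M e (x (cell_index z))))"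
      using cell_index_eq[of "src M e" z] by (cases "z \<in> cell M (src M e)") (auto simp: prb_outside)
  qed
  also have "\<dots> \<le> ennreal (a * lyap z)"
    unfolding lyap_def by (rule contraction_step[OF cell_index_in in_cell_index base_in_cell[OF cell_index_in]])
  finally show ?thesis .
qed

lemma lyap_wmap_le:
  assumes "e \<in> edges M" "prb M e z \<noteq> 0"
  shows "lyap (wmap M e z) \<le> dist (wmap M e z) (wmap M e (x (src M e))) +
                             dist (wmap M e (x (src M e))) (x (trg M e))"
proof -
  have "wmap M e z \<in> cell M (trg M e)"
    using assms prb_outside by (intro wmap_cell) auto
  then show ?thesis
    using assms(1) cell_index_eq[of "trg M e" "wmap M e z"] by (simp add: lyap_def dist_triangle)
qed

text \<open>
  The distance of \<open>w\<^sub>e z\<close> to its base point is compared with the image of the old base point: the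
  first leg is contracted on average and the second one is a displacement of base points.
\<close>
lemma drift: "markov_op M (\<lambda>z. ennreal (lyap z)) z \<le> ennreal a * ennreal (lyap z) + ennreal b"
proof -
  have "markov_op M (\<lambda>z. ennreal (lyap z)) z \<le>
     (\<integral>\<^sup>+ e. ennreal (prb M e z) * ennreal (dist (wmap M e z) (wmap M e (x (src M e)))) +
        ennreal (prb M e z) * ennreal (dist (wmap M e (x (src M e))) (x (trg M e)))
        \<partial>count_space (edges M))"
    unfolding markov_op_def
  proof (rule nn_integral_mono)
    fix e assume "e \<in> space (count_space (edges M))"
    then show "ennreal (prb M e z) * ennreal (lyap (wmap M e z)) \<le>
        ennreal (prb M e z) * ennreal (dist (wmap M e z) (wmap M e (x (src M e)))) +
        ennreal (prb M e z) * ennreal (dist (wmap M e (x (src M e))) (x (trg M e)))"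
      using lyap_wmap_le[of e z]
      by (cases "prb M e z = 0")
         (auto simp: distrib_left[symmetric] ennreal_plus[symmetric]
               simp del: ennreal_plus intro!: mult_left_mono)
  qed
  also have "\<dots> \<le> ennreal (a * lyap z) + ennreal b"
    by (subst nn_integral_add)
       (auto intro!: add_mono contraction_base displacement_step[OF cell_index_in in_cell_index])
  finally show ?thesis
    by (simp add: ennreal_mult)
qed

lemma drift_pow:
  "(markov_op M ^^ n) (\<lambda>z. ennreal (lyap z)) z \<le> ennreal (a ^ n) * ennreal (lyap z) + ennreal (b / (1 - a))"
proof -
  have *: "(markov_op M ^^ n) (\<lambda>z. ennreal (lyap z)) z \<le>
      ennreal (a ^ n) * ennreal (lyap z) + ennreal (b * (\<Sum>i<n. a ^ i))"
  proof (induction n arbitrary: z)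
    case (Suc n)
    have "(markov_op M ^^ Suc n) (\<lambda>z. ennreal (lyap z)) z \<le>
      markov_op M (\<lambda>z. ennreal (a ^ n) * ennreal (lyap z) + ennreal (b * (\<Sum>i<n. a ^ i))) z"
      using Suc by (simp add: markov_op_mono)
    also have "\<dots> \<le> ennreal (a ^ n) * (ennreal a * ennreal (lyap z) + ennreal b) +
                     ennreal (b * (\<Sum>i<n. a ^ i))"
      unfolding markov_op_affine by (intro add_mono mult_left_mono drift) auto
    also have "\<dots> = ennreal (a ^ Suc n) * ennreal (lyap z) + ennreal (b * (\<Sum>i<Suc n. a ^ i))"
      by (simp add: ennreal_mult[symmetric] ennreal_plus[symmetric] sum_nonneg algebra_simps
               del: ennreal_plus)
    finally show ?case .
  qed simp
  have "(\<Sum>i<n. a ^ i) \<le> 1 / (1 - a)"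
    using sum_gp_strict[of a n] a_less_1 zero_le_power[OF a_nonneg, of n]
      less_imp_le[OF a_less_1]
    by (auto intro!: divide_right_mono)
  then have "b * (\<Sum>i<n. a ^ i) \<le> b / (1 - a)"
    using mult_left_mono[OF _ b_nonneg] by fastforce
  with * show ?thesis
    by (meson add_left_mono ennreal_leI order_trans)
qed

text \<open>
  The integral of \<open>lyap\<close> could be infinite at first, and then integrating the drift inequality says
  nothing.  The truncation \<open>min lyap N\<close> is integrable and has the same integral as its \<open>n\<close>-th image
  under the Markov operator, which is at most \<open>min (a\<^sup>n lyap + b / (1 - a)) N\<close>; the limits \<open>n \<rightarrow> \<infinity>\<close> and
  \<open>N \<rightarrow> \<infinity>\<close> give the bound.
\<close>
lemma invariant_lyap:
  assumes \<mu>: "\<mu> \<in> invariant_measures M"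
  shows "(\<integral>\<^sup>+ z. ennreal (lyap z) \<partial>\<mu>) \<le> ennreal (b / (1 - a))"
proof -
  let ?c = "b / (1 - a)"
  interpret prob_space \<mu>
    using \<mu> by (simp add: invariant_measures_def)
  have [measurable_cong]: "sets \<mu> = sets borel"
    using \<mu> by (simp add: invariant_measures_def)
  have c: "0 \<le> ?c"
    using b_nonneg a_less_1 by (intro divide_nonneg_pos) linarith+
  have trunc: "(\<integral>\<^sup>+ z. ennreal (min (lyap z) (real N)) \<partial>\<mu>) \<le> ennreal ?c" for N
  proof -
    have le: "(\<integral>\<^sup>+ z. ennreal (min (lyap z) (real N)) \<partial>\<mu>)
              \<le> (\<integral>\<^sup>+ z. ennreal (min (a ^ n * lyap z + ?c) (real N)) \<partial>\<mu>)" for n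
    proof -
      have "(markov_op M ^^ n) (\<lambda>z. ennreal (min (lyap z) (real N))) z
              \<le> ennreal (min (a ^ n * lyap z + ?c) (real N))" for z
      proof -
        have mono: "(markov_op M ^^ n) f z \<le> (markov_op M ^^ n) g z" if "\<And>z. f z \<le> g z" for f g n z
          using that by (induction n arbitrary: z) (auto intro: markov_op_mono)
        have const: "(markov_op M ^^ n) (\<lambda>_. c) z = c" for c n z
        proof (induction n arbitrary: z)
          case (Suc n)
          then have "(markov_op M ^^ n) (\<lambda>_. c) = (\<lambda>_. c)"
            by (simp add: fun_eq_iff)
          then show ?case
            by simp
        qed simp
        have "(markov_op M ^^ n) (\<lambda>z. ennreal (min (lyap z) (real N))) z \<le> ennreal (real N)"
          using mono[of "\<lambda>z. ennreal (min (lyap z) (real N))" "\<lambda>_. ennreal (real N)" n z]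
          by (simp only: const) (simp add: ennreal_leI)
        moreover have "(markov_op M ^^ n) (\<lambda>z. ennreal (min (lyap z) (real N))) z
             \<le> ennreal (a ^ n * lyap z + ?c)"
        proof -
          have "ennreal (a ^ n * lyap z + ?c) = ennreal (a ^ n) * ennreal (lyap z) + ennreal ?c"
            by (subst ennreal_plus[OF _ c]) (auto simp: ennreal_mult)
          then show ?thesis
            using order_trans[OF mono[of "\<lambda>z. ennreal (min (lyap z) (real N))" "\<lambda>z. ennreal (lyap z)" n z] drift_pow]
            by (simp only:) (simp add: ennreal_leI)
        qed
        ultimately show ?thesis
          by (simp add: min_def)
      qed
      then have "(\<integral>\<^sup>+ z. (markov_op M ^^ n) (\<lambda>z. ennreal (min (lyap z) (real N))) z \<partial>\<mu>)
          \<le> (\<integral>\<^sup>+ z. ennreal (min (a ^ n * lyap z + ?c) (real N)) \<partial>\<mu>)"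
        by (intro nn_integral_mono)
      then show ?thesis
        by (subst (asm) invariant_nn_integral_pow[OF \<mu>]) simp_all
    qed
    have "(\<lambda>n. \<integral>\<^sup>+ z. ennreal (min (a ^ n * lyap z + ?c) (real N)) \<partial>\<mu>)
            \<longlonglongrightarrow> (\<integral>\<^sup>+ z. ennreal (min (0 * lyap z + ?c) (real N)) \<partial>\<mu>)"
    proof (rule nn_integral_dominated_convergence[where w = "\<lambda>_. ennreal (real N)"])
      have "(\<lambda>n. a ^ n) \<longlonglongrightarrow> 0"
        by (rule LIMSEQ_realpow_zero) auto
      then show "AE z in \<mu>. (\<lambda>n. ennreal (min (a ^ n * lyap z + ?c) (real N)))
          \<longlonglongrightarrow> ennreal (min (0 * lyap z + ?c) (real N))"
        by (intro AE_I2 tendsto_ennrealI tendsto_min tendsto_add tendsto_mult tendsto_const)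
    qed (auto simp: emeasure_space_1 ennreal_mult_less_top intro!: ennreal_leI)
    then have "(\<integral>\<^sup>+ z. ennreal (min (lyap z) (real N)) \<partial>\<mu>) \<le> (\<integral>\<^sup>+ z. ennreal (min (0 * lyap z + ?c) (real N)) \<partial>\<mu>)"
      by (rule LIMSEQ_le_const) (use le in blast)
    also have "\<dots> \<le> ennreal ?c"
      by (simp add: emeasure_space_1 ennreal_leI)
    finally show ?thesis .
  qed
  have "(\<lambda>N. \<integral>\<^sup>+ z. ennreal (min (lyap z) (real N)) \<partial>\<mu>) \<longlonglongrightarrow> (\<integral>\<^sup>+ z. ennreal (lyap z) \<partial>\<mu>)"
  proof (rule nn_integral_LIMSEQ)
    show "(\<lambda>N. ennreal (min (lyap z) (real N))) \<longlonglongrightarrow> ennreal (lyap z)" for z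
    proof (rule tendsto_eventually)
      obtain N0 where "lyap z \<le> real N0"
        using real_arch_simple by blast
      then show "\<forall>\<^sub>F N in sequentially. ennreal (min (lyap z) (real N)) = ennreal (lyap z)"
        unfolding eventually_sequentially by (intro exI[of _ N0]) (auto simp: min_def)
    qed
  qed (auto simp: incseq_def le_fun_def intro!: ennreal_leI)
  then show ?thesis
    by (rule LIMSEQ_le_const2) (use trunc in blast)
qed

end

section \<open>Measures on the code space\<close>

definition word_cylinder :: "('k, 'e) markov_system \<Rightarrow> int \<Rightarrow> 'e list \<Rightarrow> (int \<Rightarrow> 'e option) set" where
  "word_cylinder M m w = {\<sigma> \<in> code_space M. \<forall>i<length w. \<sigma> (m + int i) = Some (w ! i)}"

definition code_word :: "(int \<Rightarrow> 'e option) \<Rightarrow> int \<Rightarrow> nat \<Rightarrow> 'e list" where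
  "code_word \<sigma> m k = map (\<lambda>i. the (\<sigma> (m + int i))) [0..<k]"

lemma length_code_word [simp]: "length (code_word \<sigma> m k) = k"
  by (simp add: code_word_def)

lemma nth_code_word [simp]: "i < k \<Longrightarrow> code_word \<sigma> m k ! i = the (\<sigma> (m + int i))"
  by (simp add: code_word_def)

lemma code_word_Suc: "code_word \<sigma> m (Suc k) = code_word \<sigma> m k @ [the (\<sigma> (m + int k))]"
  by (simp add: code_word_def)

lemma wcomp_eq_word_map:
  "(\<And>i. i < k \<Longrightarrow> \<sigma> (m + int i) \<noteq> None) \<Longrightarrow> wcomp M \<sigma> m k z = word_map M (code_word \<sigma> m k) z"
proof (induction k)
  case (Suc k)
  then obtain e where "\<sigma> (m + int k) = Some e"
    by blast
  with Suc show ?case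
    by (simp add: code_word_Suc word_map_append)
qed (simp add: code_word_def)

lemma prod_prb'_eq_word_prb:
  "(\<And>i. i < k \<Longrightarrow> \<sigma> (m + int i) \<noteq> None) \<Longrightarrow>
    (\<Prod>i<k. prb' M (\<sigma> (m + int i)) (wcomp M \<sigma> m i z)) = word_prb M (code_word \<sigma> m k) z"
proof (induction k)
  case (Suc k)
  then obtain e where "\<sigma> (m + int k) = Some e"
    by blast
  with Suc show ?case
    by (simp add: code_word_Suc word_prb_append wcomp_eq_word_map)
qed (simp add: code_word_def)

lemma prod_int_interval:
  fixes m n :: int
  assumes "m \<le> n"
  shows "(\<Prod>i\<in>{m..n}. f i) = (\<Prod>i<nat (n - m + 1). f (m + int i))"
proof (rule prod.reindex_bij_witness[of _ "\<lambda>i. m + int i" "\<lambda>i. nat (i - m)"])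
qed (use assms in auto)

lemma cylinder_eq_word_cylinder:
  assumes "m \<le> n" "\<And>i. i \<in> {m..n} \<Longrightarrow> e i \<noteq> None"
  shows "cylinder M m n e = word_cylinder M m (code_word e m (nat (n - m + 1)))"
proof -
  have "(\<forall>i\<in>{m..n}. \<sigma> i = e i) \<longleftrightarrow> (\<forall>i<nat (n - m + 1). \<sigma> (m + int i) = Some (the (e (m + int i))))" for \<sigma>
  proof
    assume L: "\<forall>i\<in>{m..n}. \<sigma> i = e i"
    show "\<forall>i<nat (n - m + 1). \<sigma> (m + int i) = Some (the (e (m + int i)))"
    proof (intro allI impI)
      fix i assume "i < nat (n - m + 1)"
      then have "m + int i \<in> {m..n}" by auto
      with L assms(2) show "\<sigma> (m + int i) = Some (the (e (m + int i)))" by simp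
    qed
  next
    assume R: "\<forall>i<nat (n - m + 1). \<sigma> (m + int i) = Some (the (e (m + int i)))"
    show "\<forall>i\<in>{m..n}. \<sigma> i = e i"
    proof
      fix i assume i: "i \<in> {m..n}"
      then have "nat (i - m) < nat (n - m + 1)" "m + int (nat (i - m)) = i" by auto
      with R have "\<sigma> i = Some (the (e i))" by metis
      with assms(2)[OF i] show "\<sigma> i = e i" by simp
    qed
  qed
  then show ?thesis
    by (simp add: cylinder_def word_cylinder_def)
qed

context markov
begin

lemma countable_symbols: "countable (symbols M)"
  by (simp add: symbols_def countable_edges)

text \<open>
  A countable base of the one-point compactification: isolated points and the complements of finite
  sets of edges.
\<close>
definition symbol_base :: "'e option set set" where
  "symbol_base = (\<lambda>e. {Some e}) ` edges M \<union> (\<lambda>F. symbols M - Some ` F) ` {F. finite F \<and> F \<subseteq> edges M}"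

lemma countable_symbol_base: "countable symbol_base"
  unfolding symbol_base_def
  by (intro countable_Un countable_image countable_edges countable_Collect_finite_subset)

lemma symbol_base:
  assumes "openin (Alexandroff_compactification (discrete_topology (edges M))) V" "s \<in> V"
  shows "\<exists>B\<in>symbol_base. s \<in> B \<and> B \<subseteq> V"
  using assms(1) unfolding openin_Alexandroff_compactification
proof (elim disjE exE conjE)
  fix U assume U: "openin (discrete_topology (edges M)) U" and V: "V = Some ` U"
  then obtain e where "s = Some e" "e \<in> U" "U \<subseteq> edges M"
    using \<open>s \<in> V\<close> by auto
  then show ?thesis
    unfolding symbol_base_def V by (intro bexI[of _ "{Some e}"]) auto
next
  fix C assume C: "compactin (discrete_topology (edges M)) C"
    and V: "V = insert None (Some ` (topspace (discrete_topology (edges M)) - C))"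
  then have C: "C \<subseteq> edges M" "finite C"
    by (auto simp: compactin_discrete_topology)
  have "V = symbols M - Some ` C"
    using C unfolding V symbols_def by auto
  with C \<open>s \<in> V\<close> show ?thesis
    unfolding symbol_base_def by (intro bexI[of _ V]) auto
qed

text \<open>
  As the alphabet has a countable base, each open set of the product is a countable union of boxes
  with finitely many restricted coordinates.  The Borel sets are thus generated by the coordinates, which
  gives access to Kolmogorov's extension theorem and to uniqueness from finite-dimensional laws.
\<close>
lemma sets_code_borel_eq_PiM: "sets (code_borel M) = sets (PiM UNIV (\<lambda>_. count_space (symbols M)))"
proof
  let ?P = "PiM UNIV (\<lambda>_. count_space (symbols M)) :: (int \<Rightarrow> 'e option) measure"
  have sp: "space ?P = code_space M"
    by (auto simp: space_PiM code_space_eq PiE_def)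
  have coord: "{\<sigma> \<in> code_space M. \<sigma> i \<in> A} \<in> sets ?P" for i A
  proof -
    have "{\<sigma> \<in> code_space M. \<sigma> i \<in> A} = (\<lambda>\<sigma>. \<sigma> i) -` (A \<inter> symbols M) \<inter> space ?P"
      unfolding sp by (auto simp: code_space_eq)
    also have "\<dots> \<in> sets ?P"
      by (rule measurable_sets[OF measurable_component_singleton]) auto
    finally show ?thesis .
  qed
  show "sets (code_borel M) \<subseteq> sets ?P"
    unfolding sets_code_borel sp[symmetric]
  proof (rule sets.sigma_sets_subset, safe)
    fix A assume A: "openin (code_topology M) A"
    let ?X = "Alexandroff_compactification (discrete_topology (edges M))"
    define box where "box p = {\<sigma> \<in> code_space M. \<forall>i\<in>fst p. \<sigma> i \<in> snd p i}"
      for p :: "int set \<times> (int \<Rightarrow> 'e option set)"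
    define I where "I = (SIGMA J:{J::int set. finite J}. PiE J (\<lambda>_. symbol_base))"
    have "countable {J::int set. finite J}"
      using countable_Collect_finite_subset[of "UNIV :: int set"] by simp
    then have "countable I"
      unfolding I_def by (intro countable_SIGMA countable_PiE countable_symbol_base) auto
    have box: "box p \<in> sets ?P" if "p \<in> I" for p
    proof -
      have "finite (fst p)"
        using that by (auto simp: I_def)
      moreover have "box p = space ?P \<inter> (\<Inter>i\<in>fst p. {\<sigma> \<in> code_space M. \<sigma> i \<in> snd p i})"
        unfolding sp box_def by auto
      ultimately show ?thesis
        by (cases "fst p = {}") (auto intro!: sets.Int sets.finite_INT coord)
    qed
    have "A = (\<Union>p\<in>{p \<in> I. box p \<subseteq> A}. box p)"
    proof (safe)
      fix \<sigma> assume \<sigma>: "\<sigma> \<in> A"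
      with A obtain U where U: "finite {i. U i \<noteq> topspace ?X}" "\<And>i. openin ?X (U i)"
          "\<sigma> \<in> PiE UNIV U" "PiE UNIV U \<subseteq> A"
        unfolding code_topology_def openin_product_topology_alt by auto
      then have "\<forall>i. \<exists>B\<in>symbol_base. \<sigma> i \<in> B \<and> B \<subseteq> U i"
        by (intro allI symbol_base) auto
      then obtain B where B: "\<And>i. B i \<in> symbol_base" "\<And>i. \<sigma> i \<in> B i" "\<And>i. B i \<subseteq> U i"
        by metis
      let ?J = "{i. U i \<noteq> topspace ?X}"
      let ?p = "(?J, restrict B ?J)"
      have "?p \<in> I"
        using U(1) B(1) by (auto simp: I_def)
      moreover have "\<sigma> \<in> code_space M"
        using A \<sigma> openin_subset[of "code_topology M" A] by (auto simp: code_space_def)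
      then have "\<sigma> \<in> box ?p"
        using B(2) by (auto simp: box_def)
      moreover have "box ?p \<subseteq> PiE UNIV U"
      proof
        fix \<tau> assume \<tau>: "\<tau> \<in> box ?p"
        have "\<tau> i \<in> U i" for i
        proof (cases "i \<in> ?J")
          case True
          then have "\<tau> i \<in> B i" using \<tau> by (simp add: box_def)
          then show ?thesis using B(3)[of i] by (rule subsetD[rotated])
        next
          case False
          then have "U i = symbols M" by (simp add: symbols_def)
          then show ?thesis using \<tau> by (auto simp: box_def code_space_eq)
        qed
        then show "\<tau> \<in> PiE UNIV U" by auto
      qed
      ultimately show "\<sigma> \<in> (\<Union>p\<in>{p \<in> I. box p \<subseteq> A}. box p)"
        using U(4) by blast
    next
      fix \<sigma> J B assume "\<sigma> \<in> box (J, B)" "box (J, B) \<subseteq> A"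
      then show "\<sigma> \<in> A" by (rule subsetD[rotated])
    qed
    also have "\<dots> \<in> sets ?P"
      using \<open>countable I\<close> box by (intro sets.countable_UN'') (auto intro: countable_subset)
    finally show "A \<in> sets ?P" .
  qed
  have single: "{\<sigma> \<in> code_space M. \<sigma> i = s} \<in> sets (code_borel M)" for i s
    using cylinder_in_code_borel[of i i M "\<lambda>_. s"] by (simp add: cylinder_def)
  show "sets ?P \<subseteq> sets (code_borel M)"
    unfolding sets_PiM_single
  proof (rule sets.sigma_sets_subset'[of _ "code_borel M"], safe)
    fix i :: int and A assume "A \<in> sets (count_space (symbols M))"
    then have A: "A \<subseteq> symbols M" by simp
    have "{f \<in> \<Pi>\<^sub>E i\<in>UNIV. space (count_space (symbols M)). f i \<in> A} = (\<Union>s\<in>A. {\<sigma> \<in> code_space M. \<sigma> i = s})"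
      by (auto simp: code_space_eq)
    also have "\<dots> \<in> sets (code_borel M)"
      using A countable_symbols by (intro sets.countable_UN'' single) (auto intro: countable_subset)
    finally show "{f \<in> \<Pi>\<^sub>E i\<in>UNIV. space (count_space (symbols M)). f i \<in> A} \<in> sets (code_borel M)" .
  next
    have "(\<Pi>\<^sub>E i\<in>UNIV. space (count_space (symbols M))) = space (code_borel M)"
      by (auto simp: code_space_eq)
    then show "(\<Pi>\<^sub>E i\<in>(UNIV :: int set). space (count_space (symbols M))) \<in> sets (code_borel M)"
      by (simp only:) (rule sets.top)
  qed
qed

lemma measurable_coordinate [measurable]: "(\<lambda>\<sigma>. \<sigma> i) \<in> measurable (code_borel M) (count_space (symbols M))"
  unfolding measurable_cong_sets[OF sets_code_borel_eq_PiM refl]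
  by (rule measurable_component_singleton) simp

lemma word_cylinder_sets [measurable]: "word_cylinder M m w \<in> sets (code_borel M)"
proof -
  have "word_cylinder M m w =
     space (code_borel M) \<inter> (\<Inter>i\<in>{..<length w}. cylinder M (m + int i) (m + int i) (\<lambda>_. Some (w ! i)))"
    by (auto simp: word_cylinder_def cylinder_def)
  also have "\<dots> \<in> sets (code_borel M)"
    by (cases "w = []")
       (auto simp del: space_code_borel intro!: sets.Int[OF sets.top] sets.finite_INT cylinder_in_code_borel)
  finally show ?thesis .
qed

text \<open>
  Each finite-dimensional box is a countable disjoint union of cylinders over one symmetric window
  that contains its coordinates.
\<close>
lemma code_measure_eqI:
  assumes P: "prob_space P" "sets P = sets (code_borel M)"
    and Q: "prob_space Q" "sets Q = sets (code_borel M)"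
    and eq: "\<And>k e. e \<in> {- int k..int k} \<rightarrow> symbols M \<Longrightarrow>
      emeasure P (cylinder M (- int k) (int k) e) = emeasure Q (cylinder M (- int k) (int k) e)"
  shows "P = Q"
proof (rule measure_eqI_PiM_infinite[where I = UNIV and M = "\<lambda>_. count_space (symbols M)"])
  show "finite_measure P"
    using P(1) by (simp add: prob_space_def)
  fix A :: "int \<Rightarrow> 'e option set" and J :: "int set"
  assume J: "finite J" and A: "\<And>i. i \<in> J \<Longrightarrow> A i \<in> sets (count_space (symbols M))"
  obtain k where k: "J \<subseteq> {- int k..int k}"
  proof -
    show thesis
    proof (rule that[of "nat (Max (abs ` J))"], rule subsetI)
      fix j assume "j \<in> J"
      then have "\<bar>j\<bar> \<le> Max (abs ` J)"
        using J by simp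
      then show "j \<in> {- int (nat (Max (abs ` J)))..int (nat (Max (abs ` J)))}"
        by auto
    qed
  qed
  let ?W = "PiE {- int k..int k} (\<lambda>i. if i \<in> J then A i else symbols M)"
  let ?S = "prod_emb UNIV (\<lambda>_. count_space (symbols M)) J (PiE J A)"
  have A': "A i \<subseteq> symbols M" if "i \<in> J" for i
    using A[OF that] by simp
  have S_iff: "\<sigma> \<in> ?S \<longleftrightarrow> (\<forall>i. \<sigma> i \<in> symbols M) \<and> (\<forall>i\<in>J. \<sigma> i \<in> A i)" for \<sigma>
    by (simp add: prod_emb_def PiE_iff conj_commute)
  have S: "?S = (\<Union>e\<in>?W. cylinder M (- int k) (int k) e)"
  proof safe
    fix \<sigma> assume "\<sigma> \<in> ?S"
    then have *: "\<And>i. \<sigma> i \<in> symbols M" "\<And>i. i \<in> J \<Longrightarrow> \<sigma> i \<in> A i"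
      by (simp_all add: S_iff)
    show "\<sigma> \<in> (\<Union>e\<in>?W. cylinder M (- int k) (int k) e)"
    proof (rule UN_I)
      show "restrict \<sigma> {- int k..int k} \<in> ?W"
        using * by (simp add: PiE_iff)
      show "\<sigma> \<in> cylinder M (- int k) (int k) (restrict \<sigma> {- int k..int k})"
        using * by (simp add: cylinder_def code_space_eq)
    qed
  next
    fix \<sigma> e assume e: "e \<in> ?W" "\<sigma> \<in> cylinder M (- int k) (int k) e"
    have "\<sigma> i \<in> A i" if "i \<in> J" for i
    proof -
      have "i \<in> {- int k..int k}"
        using that k by blast
      then have "\<sigma> i = e i" "e i \<in> (if i \<in> J then A i else symbols M)"
        using e by (simp_all add: cylinder_def PiE_iff)
      then show ?thesis using that by simp
    qed
    with e(2) show "\<sigma> \<in> ?S"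
      by (simp add: S_iff cylinder_def code_space_eq)
  qed
  have W: "countable ?W"
    using A' countable_symbols by (intro countable_PiE) (auto intro: countable_subset)
  have disj: "disjoint_family_on (cylinder M (- int k) (int k)) ?W"
    unfolding disjoint_family_on_def
  proof (intro ballI impI)
    fix e f assume ef: "e \<in> ?W" "f \<in> ?W" "e \<noteq> f"
    then obtain i where i: "i \<in> {- int k..int k}" "e i \<noteq> f i"
      using PiE_ext[OF ef(1,2)] by blast
    show "cylinder M (- int k) (int k) e \<inter> cylinder M (- int k) (int k) f = {}"
    proof (rule equals0I)
      fix \<sigma> assume "\<sigma> \<in> cylinder M (- int k) (int k) e \<inter> cylinder M (- int k) (int k) f"
      then have "\<sigma> i = e i" "\<sigma> i = f i"
        using i(1) by (auto simp: cylinder_def simp del: atLeastAtMost_iff)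
      with i(2) show False by simp
    qed
  qed
  have sum: "emeasure N ?S = (\<integral>\<^sup>+ e. emeasure N (cylinder M (- int k) (int k) e) \<partial>count_space ?W)"
    if "sets N = sets (code_borel M)" for N
    unfolding S
    by (rule emeasure_UN_countable[where I = ?W and X = "cylinder M (- int k) (int k)"])
       (simp_all add: that cylinder_in_code_borel W disj)
  have "emeasure P (cylinder M (- int k) (int k) e) = emeasure Q (cylinder M (- int k) (int k) e)" if "e \<in> ?W" for e
  proof (rule eq, rule Pi_I)
    fix i assume "i \<in> {- int k..int k}"
    with that have "e i \<in> (if i \<in> J then A i else symbols M)"
      by (rule PiE_mem)
    then show "e i \<in> symbols M"
      using A'[of i] by (auto split: if_splits)
  qed
  then show "emeasure P ?S = emeasure Q ?S"
    unfolding sum[OF P(2)] sum[OF Q(2)] by (intro nn_integral_cong) auto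
qed (use P Q in \<open>simp_all add: sets_code_borel_eq_PiM\<close>)

text \<open>
  The point at infinity carries no mass once the edges exhaust the mass of every coordinate.
\<close>
lemma AE_all_edges:
  assumes "prob_space \<Lambda>" "sets \<Lambda> = sets (code_borel M)"
    and one: "\<And>i. (\<integral>\<^sup>+ e. emeasure \<Lambda> (word_cylinder M i [e]) \<partial>count_space (edges M)) = 1"
  shows "AE \<sigma> in \<Lambda>. \<forall>i. \<sigma> i \<in> Some ` edges M"
  unfolding AE_all_countable
proof
  fix i
  interpret prob_space \<Lambda> by fact
  have sp: "space \<Lambda> = code_space M"
    using sets_eq_imp_space_eq[OF assms(2)] by simp
  have "emeasure \<Lambda> (\<Union>e\<in>edges M. word_cylinder M i [e]) = 1"
    using one[of i]
    by (subst emeasure_UN_countable[where X = "\<lambda>e. word_cylinder M i [e]"])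
       (simp_all add: assms(2) countable_edges, auto simp: disjoint_family_on_def word_cylinder_def)
  moreover have "(\<Union>e\<in>edges M. word_cylinder M i [e]) = {\<sigma> \<in> space \<Lambda>. \<sigma> i \<in> Some ` edges M}"
    unfolding sp by (auto simp: word_cylinder_def)
  moreover have "(\<Union>e\<in>edges M. word_cylinder M i [e]) \<in> sets \<Lambda>"
    unfolding assms(2) by (intro sets.countable_UN'' countable_edges word_cylinder_sets)
  ultimately show "AE \<sigma> in \<Lambda>. \<sigma> i \<in> Some ` edges M"
    using AE_in_set_eq_1[of "{\<sigma> \<in> space \<Lambda>. \<sigma> i \<in> Some ` edges M}"]
    by (auto simp: emeasure_eq_measure elim: AE_mp)
qed

text \<open>
  Cylinders that prescribe the point at infinity somewhere are the only ones that are not given by a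
  word of edges, and they can be ignored.
\<close>
lemma cylinder_null:
  assumes "AE \<sigma> in \<Lambda>. \<forall>i. \<sigma> i \<in> Some ` edges M" "sets \<Lambda> = sets (code_borel M)" "m \<le> n"
    and "i \<in> {m..n}" "e i = None"
  shows "emeasure \<Lambda> (cylinder M m n e) = 0"
proof -
  have "AE \<sigma> in \<Lambda>. \<sigma> \<notin> cylinder M m n e"
    using assms(1)
  proof eventually_elim
    fix \<sigma> :: "int \<Rightarrow> 'e option" assume "\<forall>i. \<sigma> i \<in> Some ` edges M"
    then have "\<sigma> i \<noteq> None" by auto
    with assms(4,5) show "\<sigma> \<notin> cylinder M m n e"
      unfolding cylinder_def by (simp, metis)
  qed
  moreover have "cylinder M m n e \<in> sets \<Lambda>"
    unfolding assms(2) by (intro cylinder_in_code_borel assms)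
  ultimately show ?thesis
    using AE_iff_null_sets by fastforce
qed

lemma code_measure_eqI_words:
  assumes P: "prob_space P" "sets P = sets (code_borel M)" "AE \<sigma> in P. \<forall>i. \<sigma> i \<in> Some ` edges M"
    and Q: "prob_space Q" "sets Q = sets (code_borel M)" "AE \<sigma> in Q. \<forall>i. \<sigma> i \<in> Some ` edges M"
    and eq: "\<And>k w. set w \<subseteq> edges M \<Longrightarrow>
      emeasure P (word_cylinder M (- int k) w) = emeasure Q (word_cylinder M (- int k) w)"
  shows "P = Q"
proof (rule code_measure_eqI[OF P(1,2) Q(1,2)])
  fix k and e :: "int \<Rightarrow> 'e option" assume e: "e \<in> {- int k..int k} \<rightarrow> symbols M"
  show "emeasure P (cylinder M (- int k) (int k) e) = emeasure Q (cylinder M (- int k) (int k) e)"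
  proof (cases "\<exists>i\<in>{- int k..int k}. e i = None")
    case True
    then obtain i where "i \<in> {- int k..int k}" "e i = None"
      by blast
    then show ?thesis
      by (simp add: cylinder_null[OF P(3,2)] cylinder_null[OF Q(3,2)])
  next
    case False
    have "the (e (- int k + int i)) \<in> edges M" if "i < nat (int k - (- int k) + 1)" for i
    proof -
      have "- int k + int i \<in> {- int k..int k}"
        using that by auto
      with e False have "e (- int k + int i) \<in> symbols M" "e (- int k + int i) \<noteq> None"
        by (auto dest: Pi_mem)
      then show ?thesis
        by (auto simp: symbols_def)
    qed
    then have "set (code_word e (- int k) (nat (int k - (- int k) + 1))) \<subseteq> edges M"
      by (auto simp: code_word_def)
    moreover have "cylinder M (- int k) (int k) e =
        word_cylinder M (- int k) (code_word e (- int k) (nat (int k - (- int k) + 1)))"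
      using False by (intro cylinder_eq_word_cylinder) auto
    ultimately show ?thesis
      by (simp only: eq)
  qed
qed

end

context markov
begin

lemma code_shift_word_cylinder:
  "code_shift -` word_cylinder M m w \<inter> code_space M = word_cylinder M (m + 1) w"
proof -
  have shift: "m + 1 + int i = m + int i + 1" for i
    by simp
  show ?thesis
    unfolding word_cylinder_def code_shift_def code_space_eq shift by blast
qed

lemma pred_coordinate [measurable]: "Measurable.pred (code_borel M) (\<lambda>\<sigma>. \<sigma> i \<in> A)"
  by (rule measurable_compose[OF measurable_coordinate]) simp

subsection \<open>Stationary measures from word laws\<close>

lemma sum_words_left:
  fixes q :: "'e list \<Rightarrow> ennreal"
  assumes "\<And>w. set w \<subseteq> edges M \<Longrightarrow> (\<integral>\<^sup>+ e. q (e # w) \<partial>count_space (edges M)) = q w"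
  shows "set w \<subseteq> edges M \<Longrightarrow> (\<integral>\<^sup>+ v. q (v @ w) \<partial>count_space (words M n)) = q w"
proof (induction n arbitrary: w)
  case (Suc n)
  have "(\<integral>\<^sup>+ v. q (v @ w) \<partial>count_space (words M (Suc n))) =
    (\<integral>\<^sup>+ v. \<integral>\<^sup>+ e. q (v @ e # w) \<partial>count_space (edges M) \<partial>count_space (words M n))"
    by (simp add: nn_integral_words_snoc)
  also have "\<dots> = (\<integral>\<^sup>+ e. \<integral>\<^sup>+ v. q (v @ e # w) \<partial>count_space (words M n) \<partial>count_space (edges M))"
    by (rule nn_integral_count_space_nn_integral) (simp_all add: countable_edges)
  also have "\<dots> = (\<integral>\<^sup>+ e. q (e # w) \<partial>count_space (edges M))"
    using Suc by (intro nn_integral_cong) simp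
  also have "\<dots> = q w"
    by (rule assms) fact
  finally show ?case .
qed (simp add: nn_integral_count_space_finite)

lemma sum_words_right:
  fixes q :: "'e list \<Rightarrow> ennreal"
  assumes "\<And>w. set w \<subseteq> edges M \<Longrightarrow> (\<integral>\<^sup>+ e. q (w @ [e]) \<partial>count_space (edges M)) = q w"
  shows "set w \<subseteq> edges M \<Longrightarrow> (\<integral>\<^sup>+ v. q (w @ v) \<partial>count_space (words M n)) = q w"
proof (induction n arbitrary: w)
  case (Suc n)
  have "(\<integral>\<^sup>+ v. q (w @ v) \<partial>count_space (words M (Suc n))) =
    (\<integral>\<^sup>+ e. \<integral>\<^sup>+ v. q ((w @ [e]) @ v) \<partial>count_space (words M n) \<partial>count_space (edges M))"
    by (simp add: nn_integral_words_Cons)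
  also have "\<dots> = (\<integral>\<^sup>+ e. q (w @ [e]) \<partial>count_space (edges M))"
    using Suc.prems by (intro nn_integral_cong Suc.IH) simp
  also have "\<dots> = q w"
    by (rule assms) fact
  finally show ?case .
qed (simp add: nn_integral_count_space_finite)

end

text \<open>
  The consistency conditions of a stationary two-sided process: a word may be extended by a further
  edge at either end.  As the law does not refer to positions, the resulting measure is shift-invariant.
\<close>
locale word_law = markov M for M :: "('k::complete_space, 'e) markov_system" +
  fixes q :: "'e list \<Rightarrow> real"
  assumes q_nonneg: "\<And>w. set w \<subseteq> edges M \<Longrightarrow> 0 \<le> q w"
    and q_Nil: "q [] = 1"
    and q_left: "\<And>w. set w \<subseteq> edges M \<Longrightarrow> (\<integral>\<^sup>+ e. ennreal (q (e # w)) \<partial>count_space (edges M)) = ennreal (q w)"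
    and q_right: "\<And>w. set w \<subseteq> edges M \<Longrightarrow> (\<integral>\<^sup>+ e. ennreal (q (w @ [e])) \<partial>count_space (edges M)) = ennreal (q w)"
begin

definition word_pmf :: "nat \<Rightarrow> 'e list pmf" where
  "word_pmf n = embed_pmf (\<lambda>w. if w \<in> words M n then q w else 0)"

lemma pmf_word_pmf: "pmf (word_pmf n) w = (if w \<in> words M n then q w else 0)"
  unfolding word_pmf_def
proof (rule pmf_embed_pmf)
  have "(\<integral>\<^sup>+ w. ennreal (if w \<in> words M n then q w else 0) \<partial>count_space UNIV) =
        (\<integral>\<^sup>+ w. ennreal (q ([] @ w)) \<partial>count_space (words M n))"
    by (auto simp: nn_integral_count_space_indicator intro!: nn_integral_cong split: split_indicator)
  also have "\<dots> = 1"
    by (subst sum_words_right) (simp_all add: q_right q_Nil)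
  finally show "(\<integral>\<^sup>+ w. ennreal (if w \<in> words M n then q w else 0) \<partial>count_space UNIV) = 1" .
qed (auto simp: words_def intro: q_nonneg)

lemma set_word_pmf: "set_pmf (word_pmf n) \<subseteq> words M n"
  by (auto simp: set_pmf_iff pmf_word_pmf split: if_splits)

lemma emeasure_word_pmf:
  "emeasure (measure_pmf (word_pmf n)) A = (\<integral>\<^sup>+ w. ennreal (q w) * indicator A w \<partial>count_space (words M n))"
proof -
  have "emeasure (measure_pmf (word_pmf n)) A = (\<integral>\<^sup>+ w. ennreal (pmf (word_pmf n) w) * indicator A w \<partial>count_space UNIV)"
    by (cases "A = UNIV") (simp_all add: nn_integral_pmf[symmetric] nn_integral_count_space_indicator)
  also have "\<dots> = (\<integral>\<^sup>+ w. ennreal (q w) * indicator A w \<partial>count_space (words M n))"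
    by (auto simp: nn_integral_count_space_indicator pmf_word_pmf intro!: nn_integral_cong split: split_indicator)
  finally show ?thesis .
qed

text \<open>
  The law of the words of length \<open>n\<close> is the marginal of the law of longer words at any position.
\<close>
lemma map_word_pmf_infix:
  "map_pmf (\<lambda>u. take n (drop k u)) (word_pmf (k + (n + l))) = word_pmf n"
proof (rule pmf_eqI)
  fix w
  let ?f = "\<lambda>u. take n (drop k u)"
  have "ennreal (pmf (map_pmf ?f (word_pmf (k + (n + l)))) w) =
        emeasure (measure_pmf (word_pmf (k + (n + l)))) (?f -` {w})"
    by (simp add: pmf_map measure_pmf.emeasure_eq_measure)
  also have "\<dots> = (\<integral>\<^sup>+ u. \<integral>\<^sup>+ v. \<integral>\<^sup>+ t. ennreal (q (u @ v @ t)) * indicator (?f -` {w}) (u @ v @ t)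
      \<partial>count_space (words M l) \<partial>count_space (words M n) \<partial>count_space (words M k))"
    by (simp add: emeasure_word_pmf nn_integral_words_append)
  also have "\<dots> = (\<integral>\<^sup>+ u. \<integral>\<^sup>+ v. \<integral>\<^sup>+ t. ennreal (q ((u @ v) @ t)) * indicator {w} v
      \<partial>count_space (words M l) \<partial>count_space (words M n) \<partial>count_space (words M k))"
    by (intro nn_integral_cong) (auto simp: words_def split: split_indicator)
  also have "\<dots> = (\<integral>\<^sup>+ u. \<integral>\<^sup>+ v. ennreal (q (u @ v)) * indicator {w} v \<partial>count_space (words M n) \<partial>count_space (words M k))"
    by (intro nn_integral_cong, subst nn_integral_multc, simp, subst sum_words_right)
       (auto simp: words_def q_right)
  also have "\<dots> = (\<integral>\<^sup>+ v. \<integral>\<^sup>+ u. ennreal (q (u @ v)) * indicator {w} v \<partial>count_space (words M k) \<partial>count_space (words M n))"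
    by (rule nn_integral_count_space_nn_integral) (simp_all add: countable_words)
  also have "\<dots> = (\<integral>\<^sup>+ v. ennreal (q v) * indicator {w} v \<partial>count_space (words M n))"
    by (intro nn_integral_cong, subst nn_integral_multc, simp, subst sum_words_left)
       (auto simp: words_def q_left)
  also have "\<dots> = ennreal (pmf (word_pmf n) w)"
    unfolding emeasure_word_pmf[symmetric] by (simp add: emeasure_pmf_single)
  finally show "pmf (map_pmf ?f (word_pmf (k + (n + l)))) w = pmf (word_pmf n) w"
    by simp
qed

text \<open>
  Kolmogorov's theorem is applied to real-valued coordinates, since the reals are a Polish space; the
  edges are coded by natural numbers and recovered by \<open>decode\<close> below.
\<close>
definition edge_code :: "'e \<Rightarrow> real" where
  "edge_code e = real (to_nat_on (edges M) e)"

lemma edge_code_inj: "d \<in> edges M \<Longrightarrow> e \<in> edges M \<Longrightarrow> edge_code d = edge_code e \<longleftrightarrow> d = e"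
  by (simp add: edge_code_def countable_edges)

definition window :: "int set \<Rightarrow> nat" where
  "window J = nat (Max (insert 0 (abs ` J)))"

definition coords :: "nat \<Rightarrow> int set \<Rightarrow> 'e list \<Rightarrow> int \<Rightarrow> real" where
  "coords n J u = (\<lambda>i\<in>J. edge_code (u ! nat (i + int n)))"

lemma measurable_coords [measurable]:
  "coords n J \<in> measurable (measure_pmf p) (PiM J (\<lambda>_. borel))"
  by (auto simp: coords_def space_PiM)

definition finite_law :: "int set \<Rightarrow> (int \<Rightarrow> real) measure" where
  "finite_law J = distr (measure_pmf (word_pmf (2 * window J + 1))) (PiM J (\<lambda>_. borel)) (coords (window J) J)"

lemma window_le: "finite J \<Longrightarrow> J \<subseteq> {- int n..int n} \<Longrightarrow> window J \<le> n"
  unfolding window_def nat_le_iff by (subst Max_le_iff) (auto simp: abs_le_iff)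

lemma subset_window: "finite J \<Longrightarrow> J \<subseteq> {- int (window J)..int (window J)}"
proof
  fix j assume J: "finite J" "j \<in> J"
  then have "\<bar>j\<bar> \<le> Max (insert 0 (abs ` J))"
    by (intro Max_ge) auto
  then show "j \<in> {- int (window J)..int (window J)}"
    by (auto simp: window_def)
qed

text \<open>
  Any window that contains the coordinates gives the same law; this is the projectivity of the family.
\<close>
lemma finite_law_eq:
  assumes J: "finite J" "J \<subseteq> {- int n..int n}"
  shows "finite_law J = distr (measure_pmf (word_pmf (2 * n + 1))) (PiM J (\<lambda>_. borel)) (coords n J)"
proof -
  let ?N = "window J"
  define k where "k = n - ?N"
  have n: "n = k + ?N" and n': "k + ((2 * ?N + 1) + k) = 2 * n + 1"
    using window_le[OF J] by (simp_all add: k_def)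
  let ?f = "\<lambda>u. take (2 * ?N + 1) (drop k u)"
  have "finite_law J = distr (measure_pmf (map_pmf ?f (word_pmf (2 * n + 1)))) (PiM J (\<lambda>_. borel)) (coords ?N J)"
    unfolding finite_law_def n'[symmetric] map_word_pmf_infix ..
  also have "\<dots> = distr (measure_pmf (word_pmf (2 * n + 1))) (PiM J (\<lambda>_. borel)) (coords ?N J \<circ> ?f)"
    unfolding map_pmf_rep_eq by (rule distr_distr) (auto simp: coords_def space_PiM)
  also have "\<dots> = distr (measure_pmf (word_pmf (2 * n + 1))) (PiM J (\<lambda>_. borel)) (coords n J)"
  proof (rule distr_cong_AE)
    show "AE u in measure_pmf (word_pmf (2 * n + 1)). (coords ?N J \<circ> ?f) u = coords n J u"
    proof (rule AE_pmfI)
      fix u assume "u \<in> set_pmf (word_pmf (2 * n + 1))"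
      then have len: "length u = 2 * n + 1"
        using set_word_pmf by (auto simp: words_def)
      have "?f u ! nat (i + int ?N) = u ! nat (i + int n)" if "i \<in> J" for i
      proof -
        have "- int ?N \<le> i" "i \<le> int ?N"
          using subset_window[OF J(1)] that by auto
        then have "nat (i + int ?N) < 2 * ?N + 1" "nat (i + int n) = k + nat (i + int ?N)"
          using n by auto
        with len n show ?thesis by simp
      qed
      then show "(coords ?N J \<circ> ?f) u = coords n J u"
        by (auto simp: coords_def)
    qed
  qed (auto simp: coords_def space_PiM)
  finally show ?thesis .
qed

sublocale code: polish_projective UNIV finite_law
proof (rule polish_projective.intro, rule projective_family.intro, goal_cases)
  case (1 J H)
  have J: "finite J"
    using 1 finite_subset by blast
  have H: "H \<subseteq> {- int (window H)..int (window H)}"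
    using 1 by (intro subset_window)
  then have "finite_law J = distr (measure_pmf (word_pmf (2 * window H + 1))) (PiM J (\<lambda>_. borel)) (coords (window H) J)"
    using 1 J by (intro finite_law_eq) auto
  also have "coords (window H) J = (\<lambda>f. restrict f J) \<circ> coords (window H) H"
    using 1 by (auto simp: coords_def fun_eq_iff restrict_def)
  also have "distr (measure_pmf (word_pmf (2 * window H + 1))) (PiM J (\<lambda>_. borel)) \<dots> =
      distr (finite_law H) (PiM J (\<lambda>_. borel)) (\<lambda>f. restrict f J)"
    unfolding finite_law_def using 1
    by (intro distr_distr[symmetric] measurable_restrict_subset measurable_coords) auto
  finally show ?case .
next
  case (2 J)
  show ?case
    unfolding finite_law_def by (intro measure_pmf.prob_space_distr measurable_coords)
qed

definition decode :: "real \<Rightarrow> 'e option" where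
  "decode r = (if r \<in> edge_code ` edges M then Some (the_inv_into (edges M) edge_code r) else None)"

lemma decode_eq_Some: "e \<in> edges M \<Longrightarrow> decode r = Some e \<longleftrightarrow> r = edge_code e"
proof -
  assume e: "e \<in> edges M"
  have "inj_on edge_code (edges M)"
    by (auto simp: inj_on_def edge_code_inj)
  then have inv: "the_inv_into (edges M) edge_code (edge_code d) = d" if "d \<in> edges M" for d
    using that by (rule the_inv_into_f_f)
  show ?thesis
  proof
    assume "decode r = Some e"
    then obtain d where "d \<in> edges M" "r = edge_code d" "the_inv_into (edges M) edge_code r = e"
      unfolding decode_def by (metis imageE option.distinct(1) option.inject)
    then show "r = edge_code e"
      using inv by simp
  qed (simp add: decode_def inv e)
qed

lemma decode_in_symbols: "decode r \<in> symbols M"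
proof (cases "r \<in> edge_code ` edges M")
  case True
  then obtain d where "d \<in> edges M" "decode r = Some d"
    using decode_eq_Some by blast
  then show ?thesis
    by (simp add: symbols_def)
qed (simp add: decode_def symbols_def)

lemma measurable_decode [measurable]: "decode \<in> measurable borel (count_space (symbols M))"
  unfolding measurable_count_space_eq_countable[OF countable_symbols]
proof (intro conjI ballI)
  show "decode \<in> space borel \<rightarrow> symbols M"
    by (simp add: decode_in_symbols)
  fix s assume s: "s \<in> symbols M"
  show "decode -` {s} \<inter> space borel \<in> sets borel"
  proof (cases s)
    case None
    have "decode -` {s} \<inter> space borel = space borel - (edge_code ` edges M)"
      unfolding None decode_def by (simp add: set_eq_iff)
    moreover have "edge_code ` edges M \<in> sets borel"
      by (intro sets.countable[OF _ countable_image[OF countable_edges]]) simp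
    ultimately show ?thesis
      by (simp only:) (rule sets.compl_sets)
  next
    case (Some e)
    then have "e \<in> edges M"
      using s by (auto simp: symbols_def)
    then have "decode -` {s} \<inter> space borel = {edge_code e}"
      by (simp add: Some decode_eq_Some set_eq_iff)
    then show ?thesis by simp
  qed
qed

definition stationary_measure :: "(int \<Rightarrow> 'e option) measure" where
  "stationary_measure = distr code.lim (code_borel M) (\<lambda>\<omega> i. decode (\<omega> i))"

lemma measurable_decode_all:
  "(\<lambda>\<omega> i. decode (\<omega> i)) \<in> measurable code.lim (code_borel M)"
proof -
  have "(\<lambda>\<omega> (i :: int). decode (\<omega> i)) \<in> measurable (PiM UNIV (\<lambda>_. borel)) (PiM UNIV (\<lambda>_. count_space (symbols M)))"
  proof (rule measurable_PiM_single')
    fix i :: int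
    show "(\<lambda>\<omega>. decode (\<omega> i)) \<in> measurable (PiM UNIV (\<lambda>_. borel)) (count_space (symbols M))"
      by (rule measurable_compose[OF _ measurable_decode]) (rule measurable_component_singleton, simp)
  qed (simp add: decode_in_symbols Pi_iff PiE_iff)
  then show ?thesis
    by (subst measurable_cong_sets[OF code.sets_lim sets_code_borel_eq_PiM])
qed

lemma sets_stationary_measure: "sets stationary_measure = sets (code_borel M)"
  by (simp add: stationary_measure_def)

lemma prob_space_stationary_measure: "prob_space stationary_measure"
  unfolding stationary_measure_def
  by (intro code.P.prob_space_distr measurable_decode_all)

lemma emeasure_stationary_measure:
  assumes w: "set w \<subseteq> edges M"
  shows "emeasure stationary_measure (word_cylinder M m w) = ennreal (q w)"
proof -
  let ?J = "{m..<m + int (length w)}"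
  let ?X = "PiE ?J (\<lambda>j. {edge_code (w ! nat (j - m))})"
  define n where "n = nat (\<bar>m\<bar> + int (length w))"
  define k where "k = nat (m + int n)"
  have k: "int k = m + int n"
    by (simp add: k_def n_def)
  define l where "l = 2 * n + 1 - (k + length w)"
  have kl: "2 * n + 1 = k + (length w + l)"
    using k by (auto simp: l_def n_def)
  have "(\<lambda>\<omega> i. decode (\<omega> i)) -` word_cylinder M m w \<inter> space code.lim = prod_emb UNIV (\<lambda>_. borel) ?J ?X"
  proof -
    have "(\<lambda>i. decode (\<omega> i)) \<in> code_space M" for \<omega>
      by (simp add: decode_in_symbols code_space_eq)
    moreover have "(\<forall>i<length w. decode (\<omega> (m + int i)) = Some (w ! i)) \<longleftrightarrow>
        (\<forall>j\<in>?J. \<omega> j = edge_code (w ! nat (j - m)))" for \<omega>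
    proof safe
      fix j assume L: "\<forall>i<length w. decode (\<omega> (m + int i)) = Some (w ! i)" and j: "j \<in> ?J"
      then have i: "nat (j - m) < length w" "m + int (nat (j - m)) = j"
        by auto
      then have "decode (\<omega> j) = Some (w ! nat (j - m))"
        using L by metis
      moreover have "w ! nat (j - m) \<in> edges M"
        using w nth_mem[OF i(1)] by blast
      ultimately show "\<omega> j = edge_code (w ! nat (j - m))"
        by (simp add: decode_eq_Some)
    next
      fix i assume R: "\<forall>j\<in>?J. \<omega> j = edge_code (w ! nat (j - m))" and i: "i < length w"
      then have "\<omega> (m + int i) = edge_code (w ! i)"
        by simp
      moreover have "w ! i \<in> edges M"
        using w nth_mem[OF i] by blast
      ultimately show "decode (\<omega> (m + int i)) = Some (w ! i)"
        by (simp add: decode_eq_Some)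
    qed
    ultimately have "(\<lambda>i. decode (\<omega> i)) \<in> word_cylinder M m w \<longleftrightarrow>
        (\<forall>j\<in>?J. \<omega> j = edge_code (w ! nat (j - m)))" for \<omega>
      unfolding word_cylinder_def by simp
    moreover have "\<omega> \<in> prod_emb UNIV (\<lambda>_. borel) ?J ?X \<longleftrightarrow>
        (\<forall>j\<in>?J. \<omega> j = edge_code (w ! nat (j - m)))" for \<omega>
      by (simp add: prod_emb_def PiE_iff)
    ultimately show ?thesis
      by (intro set_eqI) (simp add: space_PiM)
  qed
  then have "emeasure stationary_measure (word_cylinder M m w) = emeasure code.lim (prod_emb UNIV (\<lambda>_. borel) ?J ?X)"
    unfolding stationary_measure_def by (simp add: emeasure_distr[OF measurable_decode_all] word_cylinder_sets)
  also have "\<dots> = emeasure (finite_law ?J) ?X"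
    by (intro code.emeasure_lim_emb sets_PiM_I_finite) auto
  also have "\<dots> = emeasure (measure_pmf (word_pmf (2 * n + 1))) (coords n ?J -` ?X)"
  proof -
    have "?J \<subseteq> {- int n..int n}"
      by (auto simp: n_def)
    moreover have "?X \<in> sets (PiM ?J (\<lambda>_. borel))"
      by (intro sets_PiM_I_finite) simp_all
    ultimately show ?thesis
      by (simp add: finite_law_eq[of _ n] emeasure_distr[OF measurable_coords])
  qed
  also have "\<dots> = emeasure (measure_pmf (word_pmf (2 * n + 1))) ((\<lambda>u. take (length w) (drop k u)) -` {w})"
  proof (rule emeasure_eq_AE)
    show "AE u in measure_pmf (word_pmf (2 * n + 1)).
      (u \<in> coords n ?J -` ?X) = (u \<in> (\<lambda>u. take (length w) (drop k u)) -` {w})"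
    proof (rule AE_pmfI)
      fix u assume "u \<in> set_pmf (word_pmf (2 * n + 1))"
      then have len: "length u = k + (length w + l)" and u: "set u \<subseteq> edges M"
        using set_word_pmf kl by (auto simp: words_def)
      have "u \<in> coords n ?J -` ?X \<longleftrightarrow> (\<forall>j\<in>?J. edge_code (u ! nat (j + int n)) = edge_code (w ! nat (j - m)))"
        by (simp add: coords_def PiE_iff)
      also have "\<dots> \<longleftrightarrow> (\<forall>i<length w. u ! (k + i) = w ! i)"
      proof safe
        fix i assume L: "\<forall>j\<in>?J. edge_code (u ! nat (j + int n)) = edge_code (w ! nat (j - m))" and i: "i < length w"
        have "nat (m + int i + int n) = k + i"
          using k by auto
        then have "edge_code (u ! (k + i)) = edge_code (w ! i)"
          using bspec[OF L, of "m + int i"] i by simp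
        moreover have "u ! (k + i) \<in> edges M" "w ! i \<in> edges M"
          using u w nth_mem[OF i] nth_mem[of "k + i" u] i len by auto
        ultimately show "u ! (k + i) = w ! i"
          by (simp add: edge_code_inj)
      next
        fix j assume R: "\<forall>i<length w. u ! (k + i) = w ! i" and j: "j \<in> ?J"
        then have "nat (j - m) < length w" "nat (j + int n) = k + nat (j - m)"
          using k by auto
        with R show "edge_code (u ! nat (j + int n)) = edge_code (w ! nat (j - m))"
          by simp
      qed
      also have "\<dots> \<longleftrightarrow> take (length w) (drop k u) = w"
        by (subst list_eq_iff_nth_eq) (simp add: len)
      finally show "(u \<in> coords n ?J -` ?X) = (u \<in> (\<lambda>u. take (length w) (drop k u)) -` {w})"
        by simp
    qed
  qed auto
  also have "\<dots> = emeasure (measure_pmf (map_pmf (\<lambda>u. take (length w) (drop k u)) (word_pmf (k + (length w + l))))) {w}"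
    unfolding kl by simp
  also have "\<dots> = ennreal (q w)"
    unfolding map_word_pmf_infix using w by (simp add: emeasure_pmf_single pmf_word_pmf words_def)
  finally show ?thesis .
qed

lemma AE_stationary_measure: "AE \<sigma> in stationary_measure. \<forall>i. \<sigma> i \<in> Some ` edges M"
proof (rule AE_all_edges[OF prob_space_stationary_measure sets_stationary_measure])
  fix i
  have "(\<integral>\<^sup>+ e. emeasure stationary_measure (word_cylinder M i [e]) \<partial>count_space (edges M)) =
        (\<integral>\<^sup>+ e. ennreal (q [e]) \<partial>count_space (edges M))"
    by (intro nn_integral_cong emeasure_stationary_measure) simp
  also have "\<dots> = 1"
    using q_left[of "[]"] by (simp add: q_Nil)
  finally show "(\<integral>\<^sup>+ e. emeasure stationary_measure (word_cylinder M i [e]) \<partial>count_space (edges M)) = 1" .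
qed

lemma stationary_measure_shift_invariant: "stationary_measure \<in> shift_invariant_measures M"
proof -
  note s = sets_stationary_measure
  have sp: "space stationary_measure = code_space M"
    using sets_eq_imp_space_eq[OF s] by simp
  have sh: "code_shift \<in> measurable stationary_measure (code_borel M)"
    using measurable_code_shift by (subst measurable_cong_sets[OF s refl])
  let ?D = "distr stationary_measure (code_borel M) code_shift"
  have "?D = stationary_measure"
  proof (rule code_measure_eqI_words)
    show "prob_space ?D"
      by (intro prob_space.prob_space_distr prob_space_stationary_measure sh)
    have "{\<sigma> \<in> space (code_borel M). \<forall>i. \<sigma> i \<in> Some ` edges M} \<in> sets (code_borel M)"
      by (intro sets.sets_Collect_countable_All predE pred_coordinate)
    moreover have "AE \<sigma> in stationary_measure. \<forall>i. code_shift \<sigma> i \<in> Some ` edges M"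
      using AE_stationary_measure by eventually_elim (simp add: code_shift_def)
    ultimately show "AE \<sigma> in ?D. \<forall>i. \<sigma> i \<in> Some ` edges M"
      by (simp only: AE_distr_iff[OF sh])
    fix k w assume "set w \<subseteq> edges M"
    then show "emeasure ?D (word_cylinder M (- int k) w) = emeasure stationary_measure (word_cylinder M (- int k) w)"
      by (simp add: emeasure_distr[OF sh] word_cylinder_sets sp code_shift_word_cylinder emeasure_stationary_measure)
  qed (simp_all add: s prob_space_stationary_measure AE_stationary_measure)
  then show ?thesis
    by (simp add: shift_invariant_measures_def s prob_space_stationary_measure)
qed

end

section \<open>Borel measures on metric spaces\<close>

text \<open>
  The indicator of a closed set is the decreasing limit of the Lipschitz functions
  \<open>max 0 (1 - k d(z, C))\<close>, and the closed sets form an intersection-stable generator.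
\<close>
lemma borel_measure_eqI_uniformly_continuous:
  fixes P Q :: "'a::metric_space measure"
  assumes P: "finite_measure P" "sets P = sets borel"
    and Q: "finite_measure Q" "sets Q = sets borel"
    and eq: "\<And>f :: 'a \<Rightarrow> real. uniformly_continuous_on UNIV f \<Longrightarrow> (\<And>z. 0 \<le> f z \<and> f z \<le> 1) \<Longrightarrow>
      (\<integral>\<^sup>+ z. ennreal (f z) \<partial>P) = (\<integral>\<^sup>+ z. ennreal (f z) \<partial>Q)"
  shows "P = Q"
proof (rule measure_eqI_generator_eq[where E = "Collect closed" and \<Omega> = UNIV and A = "\<lambda>_. UNIV"])
  show "Int_stable (Collect closed :: 'a set set)"
    by (auto simp: Int_stable_def)
  show "sets P = sigma_sets UNIV (Collect closed)" "sets Q = sigma_sets UNIV (Collect closed)"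
    using P(2) Q(2) by (simp_all add: borel_eq_closed)
  show "emeasure P UNIV \<noteq> \<infinity>"
    using finite_measure.emeasure_finite[OF P(1)] by simp
  fix C :: "'a set" assume "C \<in> Collect closed"
  then have C: "closed C" by simp
  show "emeasure P C = emeasure Q C"
  proof (cases "C = {}")
    case False
    define f where "f k z = max 0 (1 - real k * infdist z C)" for k :: nat and z
    have f_bounds: "0 \<le> f k z \<and> f k z \<le> 1" for k z
      by (simp add: f_def infdist_nonneg)
    have f_lipschitz: "\<bar>f k z - f k y\<bar> \<le> real k * dist z y" for k z y
    proof -
      have "\<bar>f k z - f k y\<bar> \<le> \<bar>real k * infdist z C - real k * infdist y C\<bar>"
        unfolding f_def max_def by auto
      also have "\<dots> = real k * \<bar>infdist z C - infdist y C\<bar>"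
        by (simp add: abs_mult right_diff_distrib[symmetric])
      also have "\<dots> \<le> real k * dist z y"
        by (intro mult_left_mono infdist_triangle_abs) simp
      finally show ?thesis .
    qed
    have uc: "uniformly_continuous_on UNIV (f k)" for k
      unfolding uniformly_continuous_on_def
    proof (intro allI impI)
      fix e :: real assume e: "0 < e"
      show "\<exists>d>0. \<forall>z\<in>UNIV. \<forall>y\<in>UNIV. dist y z < d \<longrightarrow> dist (f k y) (f k z) < e"
      proof (intro exI[of _ "e / (real k + 1)"] conjI ballI impI)
        fix z y :: 'a assume "dist y z < e / (real k + 1)"
        then have "(real k + 1) * dist y z < e"
          by (simp add: field_simps)
        then have "real k * dist y z < e"
          using zero_le_dist[of y z] unfolding distrib_right by linarith
        with f_lipschitz[of k y z] show "dist (f k y) (f k z) < e"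
          by (simp add: dist_real_def)
      qed (use e in simp)
    qed
    have lim: "(\<lambda>k. ennreal (f k z)) \<longlonglongrightarrow> indicator C z" for z
    proof (cases "z \<in> C")
      case True
      then show ?thesis by (simp add: f_def)
    next
      case False
      then have "0 < infdist z C"
        using C \<open>C \<noteq> {}\<close> by (simp add: infdist_pos_not_in_closed)
      then obtain k0 where k0: "1 < real k0 * infdist z C"
        using reals_Archimedean3 by blast
      have "ennreal (f k z) = 0" if "k0 \<le> k" for k
      proof -
        have "real k0 * infdist z C \<le> real k * infdist z C"
          using that by (intro mult_right_mono) (auto simp: infdist_nonneg)
        with k0 show ?thesis by (simp add: f_def)
      qed
      then have "\<forall>\<^sub>F k in sequentially. ennreal (f k z) = indicator C z"
        unfolding eventually_sequentially using False by (intro exI[of _ k0]) auto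
      then show ?thesis by (rule tendsto_eventually)
    qed
    have conv: "(\<lambda>k. \<integral>\<^sup>+ z. ennreal (f k z) \<partial>N) \<longlonglongrightarrow> emeasure N C"
      if N: "finite_measure N" "sets N = sets borel" for N
    proof -
      have [measurable]: "C \<in> sets N" "\<And>k. f k \<in> borel_measurable N"
        using C uc borel_measurable_continuous_onI[OF uniformly_continuous_imp_continuous[OF uc]]
        by (auto simp: N(2) cong: measurable_cong_sets)
      have "(\<lambda>k. \<integral>\<^sup>+ z. ennreal (f k z) \<partial>N) \<longlonglongrightarrow> (\<integral>\<^sup>+ z. indicator C z \<partial>N)"
      proof (rule nn_integral_dominated_convergence[where w = "\<lambda>_. 1"])
        show "(\<integral>\<^sup>+ z. 1 \<partial>N) < \<infinity>"
          using finite_measure.emeasure_finite[OF N(1)] by (simp add: less_top)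
      qed (use f_bounds lim in \<open>auto simp: ennreal_le_1\<close>)
      then show ?thesis by simp
    qed
    have "(\<lambda>k. \<integral>\<^sup>+ z. ennreal (f k z) \<partial>P) = (\<lambda>k. \<integral>\<^sup>+ z. ennreal (f k z) \<partial>Q)"
      using eq uc f_bounds by blast
    then show ?thesis
      using conv[OF P] conv[OF Q] LIMSEQ_unique by metis
  qed simp
qed auto

section \<open>The past of a code\<close>

context markov
begin

lemma space_past [simp]: "space (past_algebra M) = code_space M"
  by (simp add: past_algebra_def space_measure_of_conv)

lemma sets_past:
  "sets (past_algebra M) = sigma_sets (code_space M) {cylinder M m 0 e |m e. m \<le> 0 \<and> e \<in> {m..0} \<rightarrow> symbols M}"
  unfolding past_algebra_def by (rule sets_measure_of) (auto simp: cylinder_def)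

lemma cylinder_in_past:
  assumes "m \<le> 0" "e \<in> {m..0} \<rightarrow> symbols M"
  shows "cylinder M m 0 e \<in> sets (past_algebra M)"
  unfolding sets_past using assms by (intro sigma_sets.Basic) blast

lemma past_subset: "A \<in> sets (past_algebra M) \<Longrightarrow> A \<in> sets (code_borel M)"
  using subalgebra_past_algebra[OF refl] by (auto simp: subalgebra_def)

lemma measurable_past_code: "f \<in> measurable (past_algebra M) N \<Longrightarrow> f \<in> measurable (code_borel M) N"
  by (rule measurable_from_subalg[OF subalgebra_past_algebra[OF refl]])

text \<open>
  There are only countably many patterns of finitely many coordinates, so preimages of arbitrary sets
  are countable unions of cylinders.  In particular this applies to functions with values in a metric
  space without a countable base, for which distances of measurable functions need not be measurable.
\<close>
lemma measurable_past_finite: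
  assumes space: "\<And>\<sigma>. \<sigma> \<in> code_space M \<Longrightarrow> g \<sigma> \<in> space N"
    and dep: "\<And>\<sigma> \<tau>. \<sigma> \<in> code_space M \<Longrightarrow> \<tau> \<in> code_space M \<Longrightarrow> (\<And>i. - int n \<le> i \<Longrightarrow> i \<le> 0 \<Longrightarrow> \<sigma> i = \<tau> i) \<Longrightarrow> g \<sigma> = g \<tau>"
  shows "g \<in> measurable (past_algebra M) N"
proof (rule measurableI)
  fix B assume "B \<in> sets N"
  let ?W = "{e \<in> PiE {- int n..0} (\<lambda>_. symbols M). cylinder M (- int n) 0 e \<subseteq> g -` B}"
  have "g -` B \<inter> space (past_algebra M) = (\<Union>e\<in>?W. cylinder M (- int n) 0 e)"
  proof (intro set_eqI iffI)
    fix \<sigma> assume \<sigma>: "\<sigma> \<in> g -` B \<inter> space (past_algebra M)"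
    let ?e = "restrict \<sigma> {- int n..0}"
    have "?e \<in> PiE {- int n..0} (\<lambda>_. symbols M)" "\<sigma> \<in> cylinder M (- int n) 0 ?e"
      using \<sigma> by (auto simp: cylinder_def code_space_eq)
    moreover have "cylinder M (- int n) 0 ?e \<subseteq> g -` B"
    proof
      fix \<tau> assume "\<tau> \<in> cylinder M (- int n) 0 ?e"
      then have "g \<tau> = g \<sigma>"
        using \<sigma> by (intro dep) (auto simp: cylinder_def)
      with \<sigma> show "\<tau> \<in> g -` B" by simp
    qed
    ultimately show "\<sigma> \<in> (\<Union>e\<in>?W. cylinder M (- int n) 0 e)"
      by blast
  next
    fix \<sigma> assume "\<sigma> \<in> (\<Union>e\<in>?W. cylinder M (- int n) 0 e)"
    then show "\<sigma> \<in> g -` B \<inter> space (past_algebra M)"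
      by (auto simp: cylinder_def)
  qed
  also have "\<dots> \<in> sets (past_algebra M)"
  proof (rule sets.countable_UN'')
    have "countable (PiE {- int n..0} (\<lambda>_. symbols M))"
      by (intro countable_PiE countable_symbols) simp
    then show "countable ?W"
      by (rule countable_subset[rotated]) blast
  qed (auto intro!: cylinder_in_past simp: PiE_iff)
  finally show "g -` B \<inter> space (past_algebra M) \<in> sets (past_algebra M)" .
qed (use space in simp)

text \<open>
  Two cylinders that end at the coordinate 0 are either nested or disjoint, hence together with the
  empty set they are stable under intersection.
\<close>
lemma past_measure_eqI:
  assumes P: "finite_measure P" "sets P = sets (past_algebra M)"
    and Q: "sets Q = sets (past_algebra M)"
    and eq: "\<And>m e. m \<le> 0 \<Longrightarrow> e \<in> {m..0} \<rightarrow> symbols M \<Longrightarrow>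
      emeasure P (cylinder M m 0 e) = emeasure Q (cylinder M m 0 e)"
  shows "P = Q"
proof -
  let ?G = "{cylinder M m 0 e |m e. m \<le> 0 \<and> e \<in> {m..0} \<rightarrow> symbols M}"
  have G: "sigma_sets (code_space M) (insert {} ?G) = sigma_sets (code_space M) ?G"
  proof
    show "sigma_sets (code_space M) (insert {} ?G) \<subseteq> sigma_sets (code_space M) ?G"
      by (rule sigma_sets_mono) (auto intro: sigma_sets.Empty sigma_sets.Basic)
    show "sigma_sets (code_space M) ?G \<subseteq> sigma_sets (code_space M) (insert {} ?G)"
      by (rule sigma_sets_mono') blast
  qed
  show ?thesis
  proof (rule measure_eqI_generator_eq_countable[where E = "insert {} ?G" and \<Omega> = "code_space M"
        and A = "(\<lambda>s. cylinder M 0 0 (\<lambda>_. s)) ` symbols M"])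
    show "Int_stable (insert {} ?G)"
    proof (rule Int_stableI)
      have *: "cylinder M m 0 e \<inter> cylinder M n 0 f \<in> insert {} ?G"
        if "m \<le> n" "n \<le> 0" "e \<in> {m..0} \<rightarrow> symbols M" for m n e f
      proof (cases "\<forall>i\<in>{n..0}. e i = f i")
        case True
        then have "cylinder M m 0 e \<inter> cylinder M n 0 f = cylinder M m 0 e"
          using that(1) by (auto simp: cylinder_def)
        then show ?thesis using that by auto
      next
        case False
        then obtain i where i: "i \<in> {n..0}" "e i \<noteq> f i" by blast
        have "cylinder M m 0 e \<inter> cylinder M n 0 f = {}"
        proof (rule equals0I)
          fix \<sigma> assume "\<sigma> \<in> cylinder M m 0 e \<inter> cylinder M n 0 f"
          then have "\<sigma> i = e i" "\<sigma> i = f i"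
            using i(1) that(1) by (auto simp: cylinder_def)
          with i(2) show False by simp
        qed
        then show ?thesis by simp
      qed
      fix X Y assume XY: "X \<in> insert {} ?G" "Y \<in> insert {} ?G"
      show "X \<inter> Y \<in> insert {} ?G"
      proof (cases "X = {} \<or> Y = {}")
        case False
        then obtain m e n f where X: "X = cylinder M m 0 e" "m \<le> 0" "e \<in> {m..0} \<rightarrow> symbols M"
          and Y: "Y = cylinder M n 0 f" "n \<le> 0" "f \<in> {n..0} \<rightarrow> symbols M"
          using XY by blast
        show ?thesis
        proof (cases "m \<le> n")
          case True
          then show ?thesis unfolding X(1) Y(1) using X Y by (intro *)
        next
          case False
          then have "n \<le> m" by simp
          then show ?thesis unfolding X(1) Y(1) Int_commute[of "cylinder M m 0 e"] using X Y by (intro *)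
        qed
      qed auto
    qed
    show "insert {} ?G \<subseteq> Pow (code_space M)"
      by (auto simp: cylinder_def)
    show "sets P = sigma_sets (code_space M) (insert {} ?G)" "sets Q = sigma_sets (code_space M) (insert {} ?G)"
      unfolding G P(2) Q sets_past by simp_all
    show "emeasure P X = emeasure Q X" if "X \<in> insert {} ?G" for X
      using that eq by auto
    show "(\<lambda>s. cylinder M 0 0 (\<lambda>_. s)) ` symbols M \<subseteq> insert {} ?G"
      by fast
    show "\<Union> ((\<lambda>s. cylinder M 0 0 (\<lambda>_. s)) ` symbols M) = code_space M"
      by (auto simp: cylinder_def code_space_eq)
    show "emeasure P X \<noteq> \<infinity>" for X
      using finite_measure.emeasure_finite[OF P(1)] by simp
  qed (simp add: countable_symbols)
qed

subsection \<open>Conditional probabilities of the next edge\<close>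

lemma edge_cylinder: "cylinder M 1 1 (\<lambda>_. Some e) = word_cylinder M 1 [e]"
  by (auto simp: cylinder_def word_cylinder_def)

text \<open>
  The defining property of a conditional probability given the past, as an identity of measures on
  the past algebra.  In this form it extends at once to integrals of past functions;
  \<open>cond_prob_edge_iff\<close> translates it.
\<close>
definition past_kernel :: "(int \<Rightarrow> 'e option) measure \<Rightarrow> 'e \<Rightarrow> ((int \<Rightarrow> 'e option) \<Rightarrow> real) \<Rightarrow> bool" where
  "past_kernel \<Lambda> e \<theta> \<longleftrightarrow> (\<forall>A\<in>sets (past_algebra M).
     emeasure \<Lambda> (A \<inter> word_cylinder M 1 [e]) = (\<integral>\<^sup>+ \<sigma>. ennreal (\<theta> \<sigma>) * indicator A \<sigma> \<partial>\<Lambda>))"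

lemma past_kernel_measures:
  fixes e :: 'e
  assumes \<Lambda>: "prob_space \<Lambda>" "sets \<Lambda> = sets (code_borel M)"
    and \<theta> [measurable]: "\<theta> \<in> borel_measurable (past_algebra M)"
  defines "P \<equiv> restr_to_subalg (density \<Lambda> (indicator (word_cylinder M 1 [e]))) (past_algebra M)"
    and "Q \<equiv> restr_to_subalg (density \<Lambda> (\<lambda>\<sigma>. ennreal (\<theta> \<sigma>))) (past_algebra M)"
  shows "sets P = sets (past_algebra M)" "sets Q = sets (past_algebra M)" "finite_measure P"
    and "A \<in> sets (past_algebra M) \<Longrightarrow> emeasure P A = emeasure \<Lambda> (A \<inter> word_cylinder M 1 [e])"
    and "A \<in> sets (past_algebra M) \<Longrightarrow> emeasure Q A = (\<integral>\<^sup>+ \<sigma>. ennreal (\<theta> \<sigma>) * indicator A \<sigma> \<partial>\<Lambda>)"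
    and "f \<in> borel_measurable (past_algebra M) \<Longrightarrow>
      (\<integral>\<^sup>+ \<sigma>. f \<sigma> \<partial>P) = (\<integral>\<^sup>+ \<sigma>. f \<sigma> * indicator (word_cylinder M 1 [e]) \<sigma> \<partial>\<Lambda>)"
    and "f \<in> borel_measurable (past_algebra M) \<Longrightarrow>
      (\<integral>\<^sup>+ \<sigma>. f \<sigma> \<partial>Q) = (\<integral>\<^sup>+ \<sigma>. f \<sigma> * ennreal (\<theta> \<sigma>) \<partial>\<Lambda>)"
proof -
  interpret prob_space \<Lambda> by fact
  note sub = subalgebra_past_algebra
  have sp: "sets (density \<Lambda> g) = sets (code_borel M)" for g
    using \<Lambda>(2) by simp
  have c: "word_cylinder M 1 [e] \<in> sets \<Lambda>"
    unfolding \<Lambda>(2) by (rule word_cylinder_sets)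
  have ms: "f \<in> borel_measurable \<Lambda>" if "f \<in> borel_measurable (past_algebra M)" for f :: "_ \<Rightarrow> 'b::topological_space"
    using measurable_from_subalg[OF sub[OF \<Lambda>(2)] that] .
  have th: "(\<lambda>\<sigma>. ennreal (\<theta> \<sigma>)) \<in> borel_measurable \<Lambda>"
    using ms[OF \<theta>] by simp
  have in\<Lambda>: "A \<in> sets \<Lambda>" if "A \<in> sets (past_algebra M)" for A
    using past_subset[OF that] \<Lambda>(2) by simp
  show "sets P = sets (past_algebra M)" "sets Q = sets (past_algebra M)"
    unfolding P_def Q_def by (simp_all add: sets_restr_to_subalg[OF sub[OF sp]])
  show "emeasure P A = emeasure \<Lambda> (A \<inter> word_cylinder M 1 [e])" if A: "A \<in> sets (past_algebra M)" for A
    unfolding P_def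
    by (subst emeasure_restr_to_subalg[OF sub[OF sp] A], subst emeasure_density)
       (use in\<Lambda>[OF A] c in \<open>auto simp: indicator_inter_arith[symmetric] Int_commute\<close>)
  show "emeasure Q A = (\<integral>\<^sup>+ \<sigma>. ennreal (\<theta> \<sigma>) * indicator A \<sigma> \<partial>\<Lambda>)" if A: "A \<in> sets (past_algebra M)" for A
    unfolding Q_def
    by (subst emeasure_restr_to_subalg[OF sub[OF sp] A], subst emeasure_density)
       (use in\<Lambda>[OF A] th in auto)
  show "(\<integral>\<^sup>+ \<sigma>. f \<sigma> \<partial>P) = (\<integral>\<^sup>+ \<sigma>. f \<sigma> * indicator (word_cylinder M 1 [e]) \<sigma> \<partial>\<Lambda>)"
    if f: "f \<in> borel_measurable (past_algebra M)"
    unfolding P_def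
    by (subst nn_integral_subalgebra2[OF sub[OF sp] f], subst nn_integral_density)
       (use ms[OF f] c in \<open>auto simp: mult.commute\<close>)
  show "(\<integral>\<^sup>+ \<sigma>. f \<sigma> \<partial>Q) = (\<integral>\<^sup>+ \<sigma>. f \<sigma> * ennreal (\<theta> \<sigma>) \<partial>\<Lambda>)"
    if f: "f \<in> borel_measurable (past_algebra M)"
    unfolding Q_def
    by (subst nn_integral_subalgebra2[OF sub[OF sp] f], subst nn_integral_density)
       (use ms[OF f] th in \<open>auto simp: mult.commute\<close>)
  show "finite_measure P"
    unfolding P_def
  proof (rule finite_measure_restr_to_subalg[OF sub[OF sp]], rule finite_measureI)
    show "emeasure (density \<Lambda> (indicator (word_cylinder M 1 [e])))
        (space (density \<Lambda> (indicator (word_cylinder M 1 [e])))) \<noteq> \<infinity>"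
      by (subst emeasure_density) (use c in \<open>auto simp: emeasure_eq_measure\<close>)
  qed
qed

lemma past_kernelI:
  assumes \<Lambda>: "prob_space \<Lambda>" "sets \<Lambda> = sets (code_borel M)"
    and \<theta>: "\<theta> \<in> borel_measurable (past_algebra M)"
    and eq: "\<And>m f. m \<le> 0 \<Longrightarrow> f \<in> {m..0} \<rightarrow> symbols M \<Longrightarrow>
      emeasure \<Lambda> (cylinder M m 0 f \<inter> word_cylinder M 1 [e]) =
      (\<integral>\<^sup>+ \<sigma>. ennreal (\<theta> \<sigma>) * indicator (cylinder M m 0 f) \<sigma> \<partial>\<Lambda>)"
  shows "past_kernel \<Lambda> e \<theta>"
proof -
  note P = past_kernel_measures(1,3,4)[OF \<Lambda> \<theta>, where e = e]
  note Q = past_kernel_measures(2,5)[OF \<Lambda> \<theta>]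
  have "restr_to_subalg (density \<Lambda> (indicator (word_cylinder M 1 [e]))) (past_algebra M) =
        restr_to_subalg (density \<Lambda> (\<lambda>\<sigma>. ennreal (\<theta> \<sigma>))) (past_algebra M)"
    by (rule past_measure_eqI) (simp_all add: P Q eq cylinder_in_past)
  then show ?thesis
    unfolding past_kernel_def using P(3) Q(2) by metis
qed

lemma past_kernel_nn_integral:
  assumes \<Lambda>: "prob_space \<Lambda>" "sets \<Lambda> = sets (code_borel M)"
    and \<theta>: "\<theta> \<in> borel_measurable (past_algebra M)"
    and ker: "past_kernel \<Lambda> e \<theta>"
    and f: "f \<in> borel_measurable (past_algebra M)"
  shows "(\<integral>\<^sup>+ \<sigma>. f \<sigma> * indicator (word_cylinder M 1 [e]) \<sigma> \<partial>\<Lambda>) = (\<integral>\<^sup>+ \<sigma>. f \<sigma> * ennreal (\<theta> \<sigma>) \<partial>\<Lambda>)"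
proof -
  note P = past_kernel_measures(1,4,6)[OF \<Lambda> \<theta>, where e = e]
  note Q = past_kernel_measures(2,5,7)[OF \<Lambda> \<theta>]
  have "restr_to_subalg (density \<Lambda> (indicator (word_cylinder M 1 [e]))) (past_algebra M) =
        restr_to_subalg (density \<Lambda> (\<lambda>\<sigma>. ennreal (\<theta> \<sigma>))) (past_algebra M)"
    using ker by (intro measure_eqI) (simp_all add: P(1,2) Q(1,2) past_kernel_def)
  then show ?thesis
    using P(3)[OF f] Q(3)[OF f] by metis
qed

lemma cond_prob_edge_iff:
  assumes \<Lambda>: "prob_space \<Lambda>" "sets \<Lambda> = sets (code_borel M)"
    and \<theta>: "\<theta> \<in> borel_measurable (past_algebra M)" "\<And>\<sigma>. 0 \<le> \<theta> \<sigma>" "\<And>\<sigma>. \<theta> \<sigma> \<le> 1"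
  shows "(AE \<sigma> in \<Lambda>. cond_prob_edge M \<Lambda> e \<sigma> = \<theta> \<sigma>) \<longleftrightarrow> past_kernel \<Lambda> e \<theta>"
proof -
  interpret prob_space \<Lambda> by fact
  note sub = subalgebra_past_algebra[OF \<Lambda>(2)]
  interpret finite_measure_subalgebra \<Lambda> "past_algebra M"
    by unfold_locales (rule sub)
  let ?c = "word_cylinder M 1 [e]"
  have th: "\<theta> \<in> borel_measurable \<Lambda>"
    by (rule measurable_from_subalg[OF sub \<theta>(1)])
  have c: "?c \<in> sets \<Lambda>"
    unfolding \<Lambda>(2) by (rule word_cylinder_sets)
  have intc: "integrable \<Lambda> (indicator ?c :: _ \<Rightarrow> real)"
    using c by (simp add: emeasure_eq_measure)
  have int\<theta>: "integrable \<Lambda> \<theta>"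
    by (rule integrable_const_bound[of _ 1]) (use th \<theta> in auto)
  have in\<Lambda>: "A \<in> sets \<Lambda>" if "A \<in> sets (past_algebra M)" for A
    using past_subset[OF that] \<Lambda>(2) by simp
  have lhs: "ennreal (\<integral>\<sigma>\<in>A. indicator ?c \<sigma> \<partial>\<Lambda>) = emeasure \<Lambda> (A \<inter> ?c)"
    if "A \<in> sets (past_algebra M)" for A
    using in\<Lambda>[OF that] c
    by (simp add: set_lebesgue_integral_def emeasure_eq_measure indicator_inter_arith[symmetric])
  have rhs: "ennreal (\<integral>\<sigma>\<in>A. \<theta> \<sigma> \<partial>\<Lambda>) = (\<integral>\<^sup>+ \<sigma>. ennreal (\<theta> \<sigma>) * indicator A \<sigma> \<partial>\<Lambda>)"
    if A: "A \<in> sets (past_algebra M)" for A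
  proof -
    have "integrable \<Lambda> (\<lambda>\<sigma>. indicator A \<sigma> *\<^sub>R \<theta> \<sigma>)"
      by (rule integrable_mult_indicator[OF in\<Lambda>[OF A] int\<theta>])
    then have "ennreal (\<integral>\<sigma>\<in>A. \<theta> \<sigma> \<partial>\<Lambda>) = (\<integral>\<^sup>+ \<sigma>. ennreal (indicator A \<sigma> *\<^sub>R \<theta> \<sigma>) \<partial>\<Lambda>)"
      unfolding set_lebesgue_integral_def by (subst nn_integral_eq_integral) (auto simp: \<theta>)
    also have "\<dots> = (\<integral>\<^sup>+ \<sigma>. ennreal (\<theta> \<sigma>) * indicator A \<sigma> \<partial>\<Lambda>)"
      by (intro nn_integral_cong) (auto split: split_indicator)
    finally show ?thesis .
  qed
  have nn: "0 \<le> (\<integral>\<sigma>\<in>A. \<theta> \<sigma> \<partial>\<Lambda>)" "(0 :: real) \<le> (\<integral>\<sigma>\<in>A. indicator ?c \<sigma> \<partial>\<Lambda>)" for A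
    unfolding set_lebesgue_integral_def by (auto intro!: integral_nonneg_AE simp: \<theta>)
  show ?thesis
    unfolding cond_prob_edge_def edge_cylinder
  proof
    assume AE: "AE \<sigma> in \<Lambda>. real_cond_exp \<Lambda> (past_algebra M) (indicator ?c) \<sigma> = \<theta> \<sigma>"
    show "past_kernel \<Lambda> e \<theta>"
      unfolding past_kernel_def
    proof
      fix A assume A: "A \<in> sets (past_algebra M)"
      have "(\<integral>\<sigma>\<in>A. indicator ?c \<sigma> \<partial>\<Lambda>) = (\<integral>\<sigma>\<in>A. real_cond_exp \<Lambda> (past_algebra M) (indicator ?c) \<sigma> \<partial>\<Lambda>)"
        by (rule real_cond_exp_intA[OF intc A])
      also have "\<dots> = (\<integral>\<sigma>\<in>A. \<theta> \<sigma> \<partial>\<Lambda>)"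
        unfolding set_lebesgue_integral_def
      proof (rule integral_cong_AE)
        show "AE \<sigma> in \<Lambda>. indicator A \<sigma> *\<^sub>R real_cond_exp \<Lambda> (past_algebra M) (indicator ?c) \<sigma> = indicator A \<sigma> *\<^sub>R \<theta> \<sigma>"
          using AE by eventually_elim simp
      qed (use in\<Lambda>[OF A] th in auto)
      finally show "emeasure \<Lambda> (A \<inter> ?c) = (\<integral>\<^sup>+ \<sigma>. ennreal (\<theta> \<sigma>) * indicator A \<sigma> \<partial>\<Lambda>)"
        using lhs[OF A] rhs[OF A] by simp
    qed
  next
    assume ker: "past_kernel \<Lambda> e \<theta>"
    show "AE \<sigma> in \<Lambda>. real_cond_exp \<Lambda> (past_algebra M) (indicator ?c) \<sigma> = \<theta> \<sigma>"
    proof (rule real_cond_exp_charact[OF _ intc int\<theta> \<theta>(1)])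
      fix A assume A: "A \<in> sets (past_algebra M)"
      have "ennreal (\<integral>\<sigma>\<in>A. indicator ?c \<sigma> \<partial>\<Lambda>) = ennreal (\<integral>\<sigma>\<in>A. \<theta> \<sigma> \<partial>\<Lambda>)"
        using ker A lhs[OF A] rhs[OF A] by (simp add: past_kernel_def)
      then show "(\<integral>\<sigma>\<in>A. indicator ?c \<sigma> \<partial>\<Lambda>) = (\<integral>\<sigma>\<in>A. \<theta> \<sigma> \<partial>\<Lambda>)"
        using nn by (simp add: ennreal_inj)
    qed
  qed
qed

subsection \<open>Shift-invariant measures\<close>

lemma shift_invariantD:
  assumes "\<Lambda> \<in> shift_invariant_measures M"
  shows "prob_space \<Lambda>" "sets \<Lambda> = sets (code_borel M)" "space \<Lambda> = code_space M"
    "distr \<Lambda> (code_borel M) code_shift = \<Lambda>" "code_shift \<in> measurable \<Lambda> (code_borel M)"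
proof -
  show *: "prob_space \<Lambda>" "sets \<Lambda> = sets (code_borel M)" "distr \<Lambda> (code_borel M) code_shift = \<Lambda>"
    using assms by (simp_all add: shift_invariant_measures_def)
  show "space \<Lambda> = code_space M"
    using sets_eq_imp_space_eq[OF *(2)] by simp
  show "code_shift \<in> measurable \<Lambda> (code_borel M)"
    using measurable_code_shift by (subst measurable_cong_sets[OF *(2) refl])
qed

lemma shift_invariant_nn_integral:
  assumes "\<Lambda> \<in> shift_invariant_measures M" "f \<in> borel_measurable (code_borel M)"
  shows "(\<integral>\<^sup>+ \<sigma>. f (code_shift \<sigma>) \<partial>\<Lambda>) = (\<integral>\<^sup>+ \<sigma>. f \<sigma> \<partial>\<Lambda>)"
proof -
  have "(\<integral>\<^sup>+ \<sigma>. f \<sigma> \<partial>distr \<Lambda> (code_borel M) code_shift) = (\<integral>\<^sup>+ \<sigma>. f (code_shift \<sigma>) \<partial>\<Lambda>)"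
    by (rule nn_integral_distr[OF shift_invariantD(5)[OF assms(1)]]) (simp add: assms(2))
  then show ?thesis
    unfolding shift_invariantD(4)[OF assms(1)] by simp
qed

lemma shift_invariant_word_cylinder:
  assumes \<Lambda>: "\<Lambda> \<in> shift_invariant_measures M"
  shows "emeasure \<Lambda> (word_cylinder M m w) = emeasure \<Lambda> (word_cylinder M n w)"
proof -
  note * = shift_invariantD[OF \<Lambda>]
  have step: "emeasure \<Lambda> (word_cylinder M (m + 1) w) = emeasure \<Lambda> (word_cylinder M m w)" for m
  proof -
    have "emeasure (distr \<Lambda> (code_borel M) code_shift) (word_cylinder M m w) = emeasure \<Lambda> (word_cylinder M (m + 1) w)"
      by (simp add: emeasure_distr[OF *(5)] word_cylinder_sets *(3) code_shift_word_cylinder)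
    then show ?thesis
      unfolding *(4) by simp
  qed
  have "emeasure \<Lambda> (word_cylinder M m w) = emeasure \<Lambda> (word_cylinder M 0 w)" for m
  proof (induction m rule: int_induct[where k = 0])
    case (step1 i)
    then show ?case by (simp add: step)
  next
    case (step2 i)
    then show ?case using step[of "i - 1"] by simp
  qed simp
  then show ?thesis by metis
qed

end

section \<open>The coding map\<close>

lemma hd_code_word: "hd (code_word \<sigma> m (Suc k)) = the (\<sigma> m)"
proof -
  have "code_word \<sigma> m (Suc k) \<noteq> []"
    by (metis length_code_word length_0_conv nat.distinct(2))
  then show ?thesis
    by (simp add: hd_conv_nth)
qed

context markov
begin

lemma in_word_cylinder_iff:
  assumes "\<sigma> \<in> code_space M" "\<And>i. \<sigma> i \<in> Some ` edges M"
  shows "\<sigma> \<in> word_cylinder M m u \<longleftrightarrow> code_word \<sigma> m (length u) = u"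
proof -
  have "\<sigma> i = Some e \<longleftrightarrow> the (\<sigma> i) = e" for i e
    using assms(2)[of i] by auto
  then show ?thesis
    using assms(1) by (subst list_eq_iff_nth_eq) (simp add: word_cylinder_def)
qed

lemma code_word_in_words:
  assumes "\<And>i. \<sigma> i \<in> Some ` edges M"
  shows "code_word \<sigma> m k \<in> words M k"
proof -
  have "the (\<sigma> i) \<in> edges M" for i
    using assms[of i] by auto
  then show ?thesis
    by (auto simp: words_def code_word_def)
qed

lemma nn_integral_code_word:
  fixes g :: "'e list \<Rightarrow> ennreal"
  assumes \<Lambda>: "sets \<Lambda> = sets (code_borel M)" "AE \<sigma> in \<Lambda>. \<forall>i. \<sigma> i \<in> Some ` edges M"
  shows "(\<integral>\<^sup>+ \<sigma>. g (code_word \<sigma> m k) \<partial>\<Lambda>) =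
         (\<integral>\<^sup>+ u. g u * emeasure \<Lambda> (word_cylinder M m u) \<partial>count_space (words M k))"
proof -
  have sp: "space \<Lambda> = code_space M"
    using sets_eq_imp_space_eq[OF \<Lambda>(1)] by simp
  have [measurable]: "word_cylinder M m u \<in> sets \<Lambda>" for u
    using word_cylinder_sets by (simp add: \<Lambda>(1))
  have "(\<integral>\<^sup>+ \<sigma>. g (code_word \<sigma> m k) \<partial>\<Lambda>) =
    (\<integral>\<^sup>+ \<sigma>. \<integral>\<^sup>+ u. g u * indicator (word_cylinder M m u) \<sigma> \<partial>count_space (words M k) \<partial>\<Lambda>)"
  proof (rule nn_integral_cong_AE)
    have "AE \<sigma> in \<Lambda>. \<sigma> \<in> code_space M"
      unfolding sp[symmetric] by (rule AE_space)
    then show "AE \<sigma> in \<Lambda>. g (code_word \<sigma> m k) =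
        (\<integral>\<^sup>+ u. g u * indicator (word_cylinder M m u) \<sigma> \<partial>count_space (words M k))"
      using \<Lambda>(2)
    proof eventually_elim
      fix \<sigma> assume \<sigma>: "\<sigma> \<in> code_space M" "\<forall>i. \<sigma> i \<in> Some ` edges M"
      have "(\<integral>\<^sup>+ u. g u * indicator (word_cylinder M m u) \<sigma> \<partial>count_space (words M k)) =
            (\<integral>\<^sup>+ u. g u * indicator {code_word \<sigma> m k} u \<partial>count_space (words M k))"
        using \<sigma> by (intro nn_integral_cong)
          (auto simp: in_word_cylinder_iff words_def split: split_indicator)
      also have "\<dots> = g (code_word \<sigma> m k)"
        using code_word_in_words[of \<sigma> m k] \<sigma> by (subst nn_integral_indicator_singleton) auto
      finally show "g (code_word \<sigma> m k) =
          (\<integral>\<^sup>+ u. g u * indicator (word_cylinder M m u) \<sigma> \<partial>count_space (words M k))" ..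
    qed
  qed
  also have "\<dots> = (\<integral>\<^sup>+ u. \<integral>\<^sup>+ \<sigma>. g u * indicator (word_cylinder M m u) \<sigma> \<partial>\<Lambda> \<partial>count_space (words M k))"
    by (intro nn_integral_count_space_nn_integral countable_words) measurable
  also have "\<dots> = (\<integral>\<^sup>+ u. g u * emeasure \<Lambda> (word_cylinder M m u) \<partial>count_space (words M k))"
    by (intro nn_integral_cong) (simp add: nn_integral_cmult)
  finally show ?thesis .
qed

lemma pred_path_step [measurable]:
  "Measurable.pred (code_borel M) (\<lambda>\<sigma>. src' M (\<sigma> (n + 1)) = trg' M (\<sigma> n))"
proof -
  have [measurable]: "src' M \<in> measurable (count_space (symbols M)) (count_space UNIV)"
    "trg' M \<in> measurable (count_space (symbols M)) (count_space UNIV)"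
    by simp_all
  have [measurable]: "(\<lambda>\<sigma>. src' M (\<sigma> (n + 1))) \<in> measurable (code_borel M) (count_space UNIV)"
    "(\<lambda>\<sigma>. trg' M (\<sigma> n)) \<in> measurable (code_borel M) (count_space UNIV)"
    by (rule measurable_compose[OF measurable_coordinate], simp)+
  show ?thesis
    by measurable
qed

lemma path_space_sets [measurable]: "path_space M \<in> sets (code_borel M)"
proof -
  have "path_space M = {\<sigma> \<in> space (code_borel M). \<forall>n. \<sigma> n \<in> Some ` edges M \<and> src' M (\<sigma> (n + 1)) = trg' M (\<sigma> n)}"
    by (simp add: path_space_def)
  also have "\<dots> \<in> sets (code_borel M)"
    by (intro sets.sets_Collect_countable_All predE pred_intros_logic pred_path_step pred_coordinate)
  finally show ?thesis .
qed

end

context contractive_markov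
begin

definition word_point :: "'e list \<Rightarrow> 'k" where
  "word_point u = word_map M u (x (src M (hd u)))"

lemma backward_iterate_eq_word_point:
  assumes "\<And>i. \<sigma> i \<in> Some ` edges M"
  shows "backward_iterate M x \<sigma> n = word_point (code_word \<sigma> (- int n) (Suc n))"
proof -
  have "\<sigma> i \<noteq> None" for i
    using assms[of i] by auto
  moreover obtain e where "\<sigma> (- int n) = Some e"
    using assms[of "- int n"] by auto
  ultimately show ?thesis
    unfolding backward_iterate_def word_point_def hd_code_word by (simp add: wcomp_eq_word_map del: wcomp.simps)
qed

lemma wcomp_cong: "(\<And>i. i < k \<Longrightarrow> \<sigma> (m + int i) = \<tau> (m + int i)) \<Longrightarrow> wcomp M \<sigma> m k = wcomp M \<tau> m k"
  by (induction k) simp_all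

lemma backward_iterate_cong:
  assumes "\<And>i. - int n \<le> i \<Longrightarrow> i \<le> 0 \<Longrightarrow> \<sigma> i = \<tau> i"
  shows "backward_iterate M x \<sigma> n = backward_iterate M x \<tau> n"
proof -
  have "wcomp M \<sigma> (- int n) (Suc n) = wcomp M \<tau> (- int n) (Suc n)"
    using assms by (intro wcomp_cong) auto
  then show ?thesis
    using assms[of "- int n"] by (simp add: backward_iterate_def)
qed

lemma measurable_past_backward:
  "h \<in> UNIV \<rightarrow> space N \<Longrightarrow> (\<lambda>\<sigma>. h (backward_iterate M x \<sigma> n)) \<in> measurable (past_algebra M) N"
  by (rule measurable_past_finite[of _ _ n]) (auto intro!: arg_cong[of _ _ h] backward_iterate_cong)

lemma past_convergent_sets:
  "{\<sigma> \<in> code_space M. convergent (backward_iterate M x \<sigma>)} \<in> sets (past_algebra M)"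
proof -
  have d: "Measurable.pred (past_algebra M) (\<lambda>\<sigma>. dist (backward_iterate M x \<sigma> m) (backward_iterate M x \<sigma> n) < r)" for m n r
  proof (rule measurable_past_finite[of _ _ "max m n"])
    fix \<sigma> \<tau> :: "int \<Rightarrow> 'e option"
    assume "\<And>i. - int (max m n) \<le> i \<Longrightarrow> i \<le> 0 \<Longrightarrow> \<sigma> i = \<tau> i"
    then have "backward_iterate M x \<sigma> m = backward_iterate M x \<tau> m" "backward_iterate M x \<sigma> n = backward_iterate M x \<tau> n"
      by (auto intro!: backward_iterate_cong)
    then show "(dist (backward_iterate M x \<sigma> m) (backward_iterate M x \<sigma> n) < r) =
               (dist (backward_iterate M x \<tau> m) (backward_iterate M x \<tau> n) < r)"
      by simp
  qed simp
  have "{\<sigma> \<in> code_space M. convergent (backward_iterate M x \<sigma>)} =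
    {\<sigma> \<in> space (past_algebra M). \<forall>j. \<exists>k. \<forall>m. k \<le> m \<longrightarrow> (\<forall>n. k \<le> n \<longrightarrow>
        dist (backward_iterate M x \<sigma> m) (backward_iterate M x \<sigma> n) < inverse (real (Suc j)))}"
    by (simp only: Cauchy_convergent_iff[symmetric] metric_Cauchy_iff2 space_past)
  also have "\<dots> \<in> sets (past_algebra M)"
    by (intro predE pred_intros_countable pred_intros_imp' d)
  finally show ?thesis .
qed

text \<open>
  The coding map looks at all coordinates, because its domain consists of paths.  The following
  version is measurable with respect to the past and agrees with the coding map on its domain.
\<close>
definition past_limit :: "(int \<Rightarrow> 'e option) \<Rightarrow> 'k" where
  "past_limit \<sigma> = (if convergent (backward_iterate M x \<sigma>) then lim (backward_iterate M x \<sigma>) else x 1)"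

lemma measurable_past_limit [measurable]: "past_limit \<in> borel_measurable (past_algebra M)"
proof (rule borel_measurable_LIMSEQ_metric)
  let ?Y = "\<lambda>n \<sigma>. if convergent (backward_iterate M x \<sigma>) then backward_iterate M x \<sigma> n else x 1"
  show "?Y n \<in> borel_measurable (past_algebra M)" for n
    using past_convergent_sets
    by (intro measurable_If measurable_past_backward[of "\<lambda>y. y"]) auto
  show "(\<lambda>n. ?Y n \<sigma>) \<longlonglongrightarrow> past_limit \<sigma>" for \<sigma>
    by (simp add: past_limit_def convergent_LIMSEQ_iff)
qed

lemma coding_domain_sets [measurable]: "coding_domain M x \<in> sets (code_borel M)"
proof -
  have "coding_domain M x = path_space M \<inter> {\<sigma> \<in> code_space M. convergent (backward_iterate M x \<sigma>)}"
    by (auto simp: coding_domain_def path_space_def)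
  then show ?thesis
    using past_subset[OF past_convergent_sets] by simp
qed

lemma coding_map_eq_past_limit: "\<sigma> \<in> coding_domain M x \<Longrightarrow> coding_map M x \<sigma> = past_limit \<sigma>"
  by (simp add: coding_map_def past_limit_def coding_domain_def)

lemma measurable_coding_map [measurable]: "coding_map M x \<in> borel_measurable (code_borel M)"
proof -
  have "(\<lambda>\<sigma>. x (trg' M (\<sigma> 0))) \<in> borel_measurable (code_borel M)"
    by (rule measurable_compose[OF measurable_coordinate]) simp
  moreover have "{\<sigma> \<in> space (code_borel M). \<sigma> \<in> coding_domain M x} = coding_domain M x"
    using sets.sets_into_space[OF coding_domain_sets] by auto
  ultimately have "(\<lambda>\<sigma>. if \<sigma> \<in> coding_domain M x then past_limit \<sigma> else x (trg' M (\<sigma> 0))) \<in> borel_measurable (code_borel M)"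
    by (intro measurable_If[OF measurable_past_code[OF measurable_past_limit]]) simp_all
  also have "(\<lambda>\<sigma>. if \<sigma> \<in> coding_domain M x then past_limit \<sigma> else x (trg' M (\<sigma> 0))) = coding_map M x"
    using coding_map_eq_past_limit by (auto simp: coding_map_def fun_eq_iff)
  finally show ?thesis .
qed

lemma path_spaceD:
  assumes "\<sigma> \<in> path_space M"
  shows "\<And>i. \<sigma> i \<in> Some ` edges M" "\<sigma> \<in> code_space M"
    "\<And>i. src M (the (\<sigma> (i + 1))) = trg M (the (\<sigma> i))" "\<And>i. the (\<sigma> i) \<in> edges M"
proof -
  show *: "\<sigma> i \<in> Some ` edges M" for i
    using assms by (simp add: path_space_def)
  show "\<sigma> \<in> code_space M"
    using assms by (simp add: path_space_def)
  show "the (\<sigma> i) \<in> edges M" for i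
    using *[of i] by auto
  show "src M (the (\<sigma> (i + 1))) = trg M (the (\<sigma> i))" for i
  proof -
    obtain e f where "\<sigma> i = Some e" "\<sigma> (i + 1) = Some f"
      using *[of i] *[of "i + 1"] by auto
    moreover have "src' M (\<sigma> (i + 1)) = trg' M (\<sigma> i)"
      using assms by (simp add: path_space_def)
    ultimately show ?thesis by simp
  qed
qed

lemma path_word_map_in_cell:
  assumes \<sigma>: "\<sigma> \<in> path_space M" and z: "z \<in> cell M (src M (the (\<sigma> m)))"
  shows "word_map M (code_word \<sigma> m (Suc k)) z \<in> cell M (trg M (the (\<sigma> (m + int k))))"
proof (induction k)
  case 0
  then show ?case
    using wmap_cell[OF path_spaceD(4)[OF \<sigma>] z] by (simp add: code_word_def)
next
  case (Suc k)
  have "src M (the (\<sigma> (m + int (Suc k)))) = trg M (the (\<sigma> (m + int k)))"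
    using path_spaceD(3)[OF \<sigma>, of "m + int k"] by (simp add: add_ac)
  with Suc show ?case
    unfolding code_word_Suc[of \<sigma> m "Suc k"] word_map_append
    by (simp add: wmap_cell path_spaceD(4)[OF \<sigma>] del: of_nat_Suc)
qed

lemma backward_iterate_in_cell:
  assumes \<sigma>: "\<sigma> \<in> path_space M"
  shows "backward_iterate M x \<sigma> n \<in> cell M (trg M (the (\<sigma> 0)))"
proof -
  have "x (src M (the (\<sigma> (- int n)))) \<in> cell M (src M (the (\<sigma> (- int n))))"
    by (intro base_in_cell src_in path_spaceD(4)[OF \<sigma>])
  from path_word_map_in_cell[OF \<sigma> this, of n] show ?thesis
    by (simp add: backward_iterate_eq_word_point[OF path_spaceD(1)[OF \<sigma>]] word_point_def hd_code_word)
qed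

lemma coding_domainD:
  assumes "\<sigma> \<in> coding_domain M x"
  shows "\<sigma> \<in> path_space M" "backward_iterate M x \<sigma> \<longlonglongrightarrow> coding_map M x \<sigma>"
  using assms by (simp_all add: coding_domain_def coding_map_def convergent_LIMSEQ_iff)

lemma AE_coding_domain_iff:
  assumes "prob_space \<Lambda>" "sets \<Lambda> = sets (code_borel M)"
  shows "emeasure \<Lambda> (coding_domain M x) = 1 \<longleftrightarrow> (AE \<sigma> in \<Lambda>. \<sigma> \<in> coding_domain M x)"
proof -
  interpret prob_space \<Lambda> by fact
  have "coding_domain M x \<in> events"
    using coding_domain_sets assms(2) by simp
  from prob_eq_1[OF this] show ?thesis
    by (simp add: emeasure_eq_measure)
qed

text \<open>
  A shift appends the edge \<open>\<sigma> 1\<close> to the word that defines the backward iterate.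
\<close>
lemma code_shift_coding_domain:
  assumes "\<sigma> \<in> path_space M"
  shows "code_shift \<sigma> \<in> path_space M"
    and "backward_iterate M x (code_shift \<sigma>) (Suc n) = wmap M (the (\<sigma> 1)) (backward_iterate M x \<sigma> n)"
proof -
  show p: "code_shift \<sigma> \<in> path_space M"
    using assms unfolding path_space_def code_shift_def code_space_eq mem_Collect_eq by blast
  have "code_word (code_shift \<sigma>) (- int (Suc n)) (Suc (Suc n)) = code_word \<sigma> (- int n) (Suc n) @ [the (\<sigma> 1)]"
    unfolding code_word_Suc[of _ _ "Suc n"] by (simp add: code_shift_def code_word_def)
  moreover have "hd (code_word \<sigma> (- int n) (Suc n) @ [the (\<sigma> 1)]) = hd (code_word \<sigma> (- int n) (Suc n))"
    by (simp add: code_word_Suc hd_append)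
  ultimately show "backward_iterate M x (code_shift \<sigma>) (Suc n) = wmap M (the (\<sigma> 1)) (backward_iterate M x \<sigma> n)"
    by (simp only: backward_iterate_eq_word_point[OF path_spaceD(1)[OF p]]
        backward_iterate_eq_word_point[OF path_spaceD(1)[OF assms]] word_point_def word_map_append word_map.simps)
qed

end

section \<open>Path laws and their limits\<close>

context contractive_markov
begin

text \<open>
  The probability of a word under the path law that starts with \<open>\<nu>\<close>, weighted by \<open>f\<close> at the end
  point of the path.
\<close>
definition word_integral :: "'k measure \<Rightarrow> ('k \<Rightarrow> real) \<Rightarrow> 'e list \<Rightarrow> real" where
  "word_integral \<nu> f u = (\<integral>z. word_prb M u z * f (word_map M u z) \<partial>\<nu>)"

lemma word_integral_integrable:
  assumes "prob_space \<nu>" "sets \<nu> = sets borel" "f \<in> borel_measurable borel" "\<And>z. 0 \<le> f z \<and> f z \<le> 1"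
    and "set u \<subseteq> edges M"
  shows "integrable \<nu> (\<lambda>z. word_prb M u z * f (word_map M u z))"
proof -
  interpret prob_space \<nu> by fact
  have [measurable_cong]: "sets \<nu> = sets borel" by fact
  note [measurable] = assms(3) measurable_word_prb[OF assms(5)] measurable_word_map[OF assms(5)]
  show ?thesis
  proof (rule integrable_const_bound[of _ 1])
    show "AE z in \<nu>. norm (word_prb M u z * f (word_map M u z)) \<le> 1"
      using assms(4) word_prb_bounds[OF assms(5)]
      by (intro AE_I2) (simp add: abs_mult mult_le_one)
  qed measurable
qed

lemma ennreal_word_integral:
  assumes "prob_space \<nu>" "sets \<nu> = sets borel" "f \<in> borel_measurable borel" "\<And>z. 0 \<le> f z \<and> f z \<le> 1"
    and "set u \<subseteq> edges M"
  shows "ennreal (word_integral \<nu> f u) = (\<integral>\<^sup>+ z. ennreal (word_prb M u z) * ennreal (f (word_map M u z)) \<partial>\<nu>)"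
proof -
  have "(\<integral>\<^sup>+ z. ennreal (word_prb M u z * f (word_map M u z)) \<partial>\<nu>) = ennreal (word_integral \<nu> f u)"
    unfolding word_integral_def
    by (rule nn_integral_eq_integral[OF word_integral_integrable[OF assms]])
       (use assms(4,5) in \<open>auto intro!: AE_I2 mult_nonneg_nonneg\<close>)
  then show ?thesis
    using assms(4,5) by (simp add: ennreal_mult)
qed

lemma word_integral_bounds:
  assumes "prob_space \<nu>" "sets \<nu> = sets borel" "f \<in> borel_measurable borel" "\<And>z. 0 \<le> f z \<and> f z \<le> 1"
    and "set u \<subseteq> edges M"
  shows "0 \<le> word_integral \<nu> f u" "word_integral \<nu> f u \<le> 1"
proof -
  interpret prob_space \<nu> by fact
  show "0 \<le> word_integral \<nu> f u"
    unfolding word_integral_def using assms(4,5) by (intro integral_nonneg_AE AE_I2) simp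
  have "word_integral \<nu> f u \<le> (\<integral>z. 1 \<partial>\<nu>)"
    unfolding word_integral_def using assms(4) word_prb_bounds[OF assms(5)]
    by (intro integral_mono word_integral_integrable[OF assms]) (auto intro!: mult_le_one)
  then show "word_integral \<nu> f u \<le> 1"
    by (simp add: prob_space)
qed

text \<open>
  Consecutive backward iterates differ by one more edge \<open>e\<close> in the remote past: one of them starts
  the remaining word in the base point \<open>t\<close> of the target of \<open>e\<close>, the other one in the image \<open>s\<close> of the
  base point of its source.  Both are compared with the path of \<open>w\<^sub>e z\<close>, along which the weights contract.
\<close>
lemma sum_displacement_words:
  "(\<integral>\<^sup>+ u. ennreal (word_prb M u z) * ennreal (dist (word_point (tl u)) (word_point u))
      \<partial>count_space (words M (Suc (Suc k)))) \<le> ennreal (a ^ Suc k) * ennreal (2 * lyap z + b)"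
proof -
  let ?A = "\<lambda>e. ennreal (dist (wmap M e z) (wmap M e (x (src M e))))"
  let ?B = "\<lambda>e. ennreal (dist (wmap M e (x (src M e))) (x (trg M e)))"
  have inner: "ennreal (prb M e z) * (\<integral>\<^sup>+ w. ennreal (word_prb M w (wmap M e z)) *
        ennreal (dist (word_point w) (word_point (e # w))) \<partial>count_space (words M (Suc k)))
      \<le> ennreal (prb M e z) * (ennreal (a ^ Suc k) * (2 * ?A e + ?B e))" if e: "e \<in> edges M" for e
  proof (cases "prb M e z = 0")
    case False
    let ?z = "wmap M e z" and ?t = "x (trg M e)" and ?s = "wmap M e (x (src M e))"
    have z: "z \<in> cell M (src M e)"
      using False prb_outside[OF e] by blast
    have cells: "?z \<in> cell M (trg M e)" "?t \<in> cell M (trg M e)" "?s \<in> cell M (trg M e)"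
      using e z base_in_cell by (auto intro: wmap_cell)
    have "(\<integral>\<^sup>+ w. ennreal (word_prb M w ?z) * ennreal (dist (word_point w) (word_point (e # w)))
             \<partial>count_space (words M (Suc k))) \<le>
          (\<integral>\<^sup>+ w. ennreal (word_prb M w ?z) * ennreal (dist (word_map M w ?z) (word_map M w ?t)) +
                ennreal (word_prb M w ?z) * ennreal (dist (word_map M w ?z) (word_map M w ?s))
             \<partial>count_space (words M (Suc k)))"
    proof (rule nn_integral_mono)
      fix w assume "w \<in> space (count_space (words M (Suc k)))"
      then have w: "set w \<subseteq> edges M" "w \<noteq> []"
        by (auto simp: words_def)
      show "ennreal (word_prb M w ?z) * ennreal (dist (word_point w) (word_point (e # w))) \<le>
            ennreal (word_prb M w ?z) * ennreal (dist (word_map M w ?z) (word_map M w ?t)) +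
            ennreal (word_prb M w ?z) * ennreal (dist (word_map M w ?z) (word_map M w ?s))"
      proof (cases "word_prb M w ?z = 0")
        case False
        have "?z \<in> cell M (src M (hd w))"
          by (rule word_prb_pos_path(1)[OF w False])
        then have "src M (hd w) = trg M e"
          using cells(1) e w hd_in_set[OF w(2)] by (metis cell_index_eq src_in trg_in subsetD)
        then have "dist (word_point w) (word_point (e # w)) = dist (word_map M w ?t) (word_map M w ?s)"
          by (simp add: word_point_def)
        also have "\<dots> \<le> dist (word_map M w ?z) (word_map M w ?t) + dist (word_map M w ?z) (word_map M w ?s)"
          by (rule dist_triangle3)
        finally show ?thesis
          unfolding distrib_left[symmetric]
          by (intro mult_left_mono) (simp_all add: ennreal_plus[symmetric] del: ennreal_plus)
      qed simp
    qed
    also have "\<dots> \<le> ennreal (a ^ Suc k * dist ?z ?t) + ennreal (a ^ Suc k * dist ?z ?s)"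
      by (subst nn_integral_add)
         (auto intro!: add_mono contraction_words[of "trg M e"] simp: cells e simp del: power_Suc)
    also have "\<dots> = ennreal (a ^ Suc k) * ennreal (dist ?z ?t + dist ?z ?s)"
      by (simp add: ennreal_mult[symmetric] ennreal_plus[symmetric] distrib_left del: ennreal_plus power_Suc)
    also have "\<dots> \<le> ennreal (a ^ Suc k) * (2 * ?A e + ?B e)"
    proof (rule mult_left_mono)
      have "dist ?z ?t + dist ?z ?s \<le> 2 * dist ?z ?s + dist ?s ?t"
        using dist_triangle[of ?z ?t ?s] by simp
      then have "ennreal (dist ?z ?t + dist ?z ?s) \<le> ennreal (2 * dist ?z ?s + dist ?s ?t)"
        by (rule ennreal_leI)
      then show "ennreal (dist ?z ?t + dist ?z ?s) \<le> 2 * ?A e + ?B e"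
        by (simp add: ennreal_plus ennreal_mult del: ennreal_plus[symmetric])
    qed simp
    finally show ?thesis
      by (rule mult_left_mono) simp
  qed simp
  have "(\<integral>\<^sup>+ u. ennreal (word_prb M u z) * ennreal (dist (word_point (tl u)) (word_point u))
      \<partial>count_space (words M (Suc (Suc k)))) =
    (\<integral>\<^sup>+ e. ennreal (prb M e z) * (\<integral>\<^sup>+ w. ennreal (word_prb M w (wmap M e z)) *
        ennreal (dist (word_point w) (word_point (e # w))) \<partial>count_space (words M (Suc k)))
      \<partial>count_space (edges M))"
    by (subst nn_integral_prb_word_Cons) simp
  also have "\<dots> \<le> (\<integral>\<^sup>+ e. ennreal (prb M e z) * (ennreal (a ^ Suc k) * (2 * ?A e + ?B e)) \<partial>count_space (edges M))"
    using inner by (intro nn_integral_mono) simp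
  also have "\<dots> = (\<integral>\<^sup>+ e. ennreal (a ^ Suc k) * (2 * (ennreal (prb M e z) * ?A e) + ennreal (prb M e z) * ?B e) \<partial>count_space (edges M))"
    by (intro nn_integral_cong) (simp add: distrib_left mult_ac)
  also have "\<dots> = ennreal (a ^ Suc k) * (2 * (\<integral>\<^sup>+ e. ennreal (prb M e z) * ?A e \<partial>count_space (edges M)) +
      (\<integral>\<^sup>+ e. ennreal (prb M e z) * ?B e \<partial>count_space (edges M)))"
    by (simp add: nn_integral_cmult nn_integral_add)
  also have "\<dots> \<le> ennreal (a ^ Suc k) * (2 * ennreal (a * lyap z) + ennreal b)"
    by (intro mult_left_mono add_mono contraction_base displacement_step[OF cell_index_in in_cell_index]) auto
  also have "\<dots> \<le> ennreal (a ^ Suc k) * ennreal (2 * lyap z + b)"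
  proof (rule mult_left_mono)
    have "a * lyap z \<le> lyap z"
      using mult_right_mono[OF less_imp_le[OF a_less_1] lyap_nonneg[of z]] by simp
    then have "ennreal (2 * (a * lyap z) + b) \<le> ennreal (2 * lyap z + b)"
      by (intro ennreal_leI) simp
    then show "2 * ennreal (a * lyap z) + ennreal b \<le> ennreal (2 * lyap z + b)"
      by (simp add: ennreal_plus ennreal_mult)
  qed simp
  finally show ?thesis .
qed

text \<open>
  A path can be restarted in the base point of its cell at the cost of the contracted initial
  distance, which is \<open>lyap\<close>.
\<close>
lemma sum_base_words:
  "(\<integral>\<^sup>+ u. ennreal (word_prb M u z) * ennreal (dist (word_map M u z) (word_point u))
      \<partial>count_space (words M (Suc k))) \<le> ennreal (a ^ Suc k) * ennreal (lyap z)"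
proof -
  have "(\<integral>\<^sup>+ u. ennreal (word_prb M u z) * ennreal (dist (word_map M u z) (word_point u))
      \<partial>count_space (words M (Suc k))) =
    (\<integral>\<^sup>+ u. ennreal (word_prb M u z) * ennreal (dist (word_map M u z) (word_map M u (x (cell_index z))))
      \<partial>count_space (words M (Suc k)))"
  proof (rule nn_integral_cong)
    fix u assume "u \<in> space (count_space (words M (Suc k)))"
    then have u: "set u \<subseteq> edges M" "u \<noteq> []"
      by (auto simp: words_def)
    then have "word_prb M u z = 0 \<or> cell_index z = src M (hd u)"
      using word_prb_pos_path(1)[OF u, of z] hd_in_set[OF u(2)] by (metis cell_index_eq src_in subsetD)
    then show "ennreal (word_prb M u z) * ennreal (dist (word_map M u z) (word_point u)) =
      ennreal (word_prb M u z) * ennreal (dist (word_map M u z) (word_map M u (x (cell_index z))))"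
      by (auto simp: word_point_def)
  qed
  also have "\<dots> \<le> ennreal (a ^ Suc k * dist z (x (cell_index z)))"
    by (intro contraction_words[OF cell_index_in in_cell_index base_in_cell[OF cell_index_in]])
  finally show ?thesis
    by (simp add: lyap_def ennreal_mult)
qed

text \<open>
  The test functions.  Uniform continuity within the cells is what the estimates need, and it holds
  for the functions \<open>prb M e\<close>, which may jump at the boundary of a cell, as well as for uniformly
  continuous functions on the whole space.
\<close>
definition cellwise_uniform :: "('k \<Rightarrow> real) \<Rightarrow> bool" where
  "cellwise_uniform f \<longleftrightarrow> f \<in> borel_measurable borel \<and> (\<forall>z. 0 \<le> f z \<and> f z \<le> 1) \<and>
     (\<forall>\<epsilon>>0. \<exists>\<delta>>0. \<forall>j\<in>vertices M. \<forall>s\<in>cell M j. \<forall>t\<in>cell M j. dist s t < \<delta> \<longrightarrow> \<bar>f s - f t\<bar> < \<epsilon>)"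

lemma cellwise_uniformD:
  assumes "cellwise_uniform f"
  shows "f \<in> borel_measurable borel" "\<And>z. 0 \<le> f z \<and> f z \<le> 1"
  using assms by (simp_all add: cellwise_uniform_def)

text \<open>
  An affine bound in the distance can be integrated against the contraction estimate, unlike the
  modulus of continuity itself; for large distances it holds because \<open>f\<close> has values in \<open>[0, 1]\<close>.
\<close>
lemma cellwise_uniform_le:
  assumes "cellwise_uniform f" "0 < \<epsilon>"
  obtains \<delta> where "0 < \<delta>"
    "\<And>j s t. j \<in> vertices M \<Longrightarrow> s \<in> cell M j \<Longrightarrow> t \<in> cell M j \<Longrightarrow> \<bar>f s - f t\<bar> \<le> \<epsilon> + dist s t / \<delta>"
proof -
  obtain \<delta> where \<delta>: "0 < \<delta>" "\<And>j s t. j \<in> vertices M \<Longrightarrow> s \<in> cell M j \<Longrightarrow> t \<in> cell M j \<Longrightarrow> dist s t < \<delta> \<Longrightarrow> \<bar>f s - f t\<bar> < \<epsilon>"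
    using assms unfolding cellwise_uniform_def by metis
  show thesis
  proof (rule that[OF \<delta>(1)])
    fix j s t assume *: "j \<in> vertices M" "s \<in> cell M j" "t \<in> cell M j"
    show "\<bar>f s - f t\<bar> \<le> \<epsilon> + dist s t / \<delta>"
    proof (cases "dist s t < \<delta>")
      case True
      have "0 \<le> dist s t / \<delta>"
        using \<delta>(1) by simp
      then show ?thesis using \<delta>(2)[OF * True] by linarith
    next
      case False
      then have "1 \<le> dist s t / \<delta>"
        using \<delta>(1) by simp
      moreover have "\<bar>f s - f t\<bar> \<le> 1"
        using cellwise_uniformD(2)[OF assms(1), of s] cellwise_uniformD(2)[OF assms(1), of t] by linarith
      ultimately show ?thesis using assms(2) by linarith
    qed
  qed
qed

lemma word_integral_diff:
  assumes \<nu>: "prob_space \<nu>" "sets \<nu> = sets borel" and f: "cellwise_uniform f"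
    and u: "set u \<subseteq> edges M" "u \<noteq> []" and \<epsilon>: "0 \<le> \<epsilon>" and \<delta>: "0 < \<delta>"
    and le: "\<And>j s t. j \<in> vertices M \<Longrightarrow> s \<in> cell M j \<Longrightarrow> t \<in> cell M j \<Longrightarrow> \<bar>f s - f t\<bar> \<le> \<epsilon> + dist s t / \<delta>"
  shows "ennreal \<bar>word_integral \<nu> f u - word_integral \<nu> (\<lambda>_. 1) u * f (word_point u)\<bar> \<le>
    (\<integral>\<^sup>+ z. ennreal \<epsilon> * ennreal (word_prb M u z) +
       ennreal (1 / \<delta>) * (ennreal (word_prb M u z) * ennreal (dist (word_map M u z) (word_point u))) \<partial>\<nu>)"
proof -
  have i1: "integrable \<nu> (\<lambda>z. word_prb M u z * f (word_map M u z))"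
    by (intro word_integral_integrable \<nu> cellwise_uniformD[OF f] u(1))
  have i2: "integrable \<nu> (\<lambda>z. word_prb M u z)"
    using word_integral_integrable[OF \<nu>, of "\<lambda>_. 1" u] u(1) by simp
  have "word_integral \<nu> f u - word_integral \<nu> (\<lambda>_. 1) u * f (word_point u) =
        (\<integral>z. word_prb M u z * f (word_map M u z) - word_prb M u z * f (word_point u) \<partial>\<nu>)"
    unfolding word_integral_def using i1 i2 by simp
  then have "ennreal \<bar>word_integral \<nu> f u - word_integral \<nu> (\<lambda>_. 1) u * f (word_point u)\<bar> \<le>
        (\<integral>\<^sup>+ z. ennreal \<bar>word_prb M u z * f (word_map M u z) - word_prb M u z * f (word_point u)\<bar> \<partial>\<nu>)"
    using integral_norm_bound_ennreal[of \<nu> "\<lambda>z. word_prb M u z * f (word_map M u z) - word_prb M u z * f (word_point u)"]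
      i1 i2 by simp
  also have "\<dots> \<le> (\<integral>\<^sup>+ z. ennreal \<epsilon> * ennreal (word_prb M u z) +
       ennreal (1 / \<delta>) * (ennreal (word_prb M u z) * ennreal (dist (word_map M u z) (word_point u))) \<partial>\<nu>)"
  proof (rule nn_integral_mono)
    fix z
    have p: "0 \<le> word_prb M u z"
      using u(1) by simp
    have "\<bar>word_prb M u z * f (word_map M u z) - word_prb M u z * f (word_point u)\<bar> \<le>
      word_prb M u z * (\<epsilon> + dist (word_map M u z) (word_point u) / \<delta>)"
    proof (cases "word_prb M u z = 0")
      case False
      have z: "z \<in> cell M (src M (hd u))"
        by (rule word_prb_pos_path(1)[OF u False])
      have "hd u \<in> edges M" "last u \<in> edges M"
        using u by auto
      then have "\<bar>f (word_map M u z) - f (word_point u)\<bar> \<le> \<epsilon> + dist (word_map M u z) (word_point u) / \<delta>"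
        unfolding word_point_def
        by (intro le[of "trg M (last u)"] word_prb_pos_path(2)[OF u False] z base_in_cell) simp_all
      then have "word_prb M u z * \<bar>f (word_map M u z) - f (word_point u)\<bar> \<le>
        word_prb M u z * (\<epsilon> + dist (word_map M u z) (word_point u) / \<delta>)"
        by (rule mult_left_mono[OF _ p])
      then show ?thesis
        using p by (simp add: right_diff_distrib[symmetric] abs_mult)
    qed simp
    then have "ennreal \<bar>word_prb M u z * f (word_map M u z) - word_prb M u z * f (word_point u)\<bar> \<le>
      ennreal (\<epsilon> * word_prb M u z + (1 / \<delta>) * (word_prb M u z * dist (word_map M u z) (word_point u)))"
      by (intro ennreal_leI) (simp add: algebra_simps)
    also have "\<dots> = ennreal \<epsilon> * ennreal (word_prb M u z) +
       ennreal (1 / \<delta>) * (ennreal (word_prb M u z) * ennreal (dist (word_map M u z) (word_point u)))"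
    proof -
      have "ennreal ((1 / \<delta>) * (word_prb M u z * dist (word_map M u z) (word_point u))) =
        ennreal (1 / \<delta>) * (ennreal (word_prb M u z) * ennreal (dist (word_map M u z) (word_point u)))"
        using p by (subst ennreal_mult'', simp, subst ennreal_mult'', simp_all)
      moreover have "ennreal (\<epsilon> * word_prb M u z) = ennreal \<epsilon> * ennreal (word_prb M u z)"
        using p by (rule ennreal_mult'')
      ultimately show ?thesis
        using p \<epsilon> \<delta> by (subst ennreal_plus) simp_all
    qed
    finally show "ennreal \<bar>word_prb M u z * f (word_map M u z) - word_prb M u z * f (word_point u)\<bar> \<le>
      ennreal \<epsilon> * ennreal (word_prb M u z) +
       ennreal (1 / \<delta>) * (ennreal (word_prb M u z) * ennreal (dist (word_map M u z) (word_point u)))" .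
  qed
  finally show ?thesis .
qed

text \<open>
  For long words, the end point of the path may be replaced in \<open>f\<close> by the backward iterate
  \<open>word_point u\<close>, which depends on the word only.
\<close>
lemma sum_word_integral_diff:
  assumes \<nu>: "prob_space \<nu>" "sets \<nu> = sets borel" "(\<integral>\<^sup>+ z. ennreal (lyap z) \<partial>\<nu>) \<le> ennreal C"
    and f: "cellwise_uniform f" and \<epsilon>: "0 \<le> \<epsilon>" and \<delta>: "0 < \<delta>" and C: "0 \<le> C"
    and le: "\<And>j s t. j \<in> vertices M \<Longrightarrow> s \<in> cell M j \<Longrightarrow> t \<in> cell M j \<Longrightarrow> \<bar>f s - f t\<bar> \<le> \<epsilon> + dist s t / \<delta>"
  shows "(\<integral>\<^sup>+ u. ennreal \<bar>word_integral \<nu> f u - word_integral \<nu> (\<lambda>_. 1) u * f (word_point u)\<bar> \<partial>count_space (words M (Suc k)))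
    \<le> ennreal (\<epsilon> + a ^ Suc k * C / \<delta>)"
proof -
  interpret prob_space \<nu> by fact
  have [measurable_cong]: "sets \<nu> = sets borel" by fact
  let ?g = "\<lambda>u z. ennreal \<epsilon> * ennreal (word_prb M u z) +
       ennreal (1 / \<delta>) * (ennreal (word_prb M u z) * ennreal (dist (word_map M u z) (word_point u)))"
  have meas: "?g u \<in> borel_measurable \<nu>" if "u \<in> words M (Suc k)" for u
  proof -
    have "set u \<subseteq> edges M"
      using that by (simp add: words_def)
    note [measurable] = measurable_word_prb[OF this] measurable_word_map[OF this]
    show ?thesis by measurable
  qed
  have "(\<integral>\<^sup>+ u. ennreal \<bar>word_integral \<nu> f u - word_integral \<nu> (\<lambda>_. 1) u * f (word_point u)\<bar> \<partial>count_space (words M (Suc k)))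
    \<le> (\<integral>\<^sup>+ u. (\<integral>\<^sup>+ z. ?g u z \<partial>\<nu>) \<partial>count_space (words M (Suc k)))"
    by (intro nn_integral_mono word_integral_diff \<nu> f \<epsilon> \<delta> le) (auto simp: words_def)
  also have "\<dots> = (\<integral>\<^sup>+ z. \<integral>\<^sup>+ u. ?g u z \<partial>count_space (words M (Suc k)) \<partial>\<nu>)"
    by (intro nn_integral_count_space_nn_integral[symmetric] countable_words meas)
  also have "\<dots> \<le> (\<integral>\<^sup>+ z. ennreal \<epsilon> + ennreal (1 / \<delta>) * (ennreal (a ^ Suc k) * ennreal (lyap z)) \<partial>\<nu>)"
    by (intro nn_integral_mono)
       (simp add: nn_integral_add nn_integral_cmult sum_word_prb sum_base_words mult_left_mono add_left_mono del: power_Suc)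
  also have "\<dots> = ennreal \<epsilon> + ennreal (1 / \<delta>) * (ennreal (a ^ Suc k) * (\<integral>\<^sup>+ z. ennreal (lyap z) \<partial>\<nu>))"
    by (subst nn_integral_add) (simp_all add: nn_integral_cmult emeasure_space_1 del: power_Suc)
  also have "\<dots> \<le> ennreal \<epsilon> + ennreal (1 / \<delta>) * (ennreal (a ^ Suc k) * ennreal C)"
    by (intro add_left_mono mult_left_mono \<nu>(3)) auto
  also have "\<dots> = ennreal (\<epsilon> + a ^ Suc k * C / \<delta>)"
  proof -
    have "ennreal (\<epsilon> + a ^ Suc k * C / \<delta>) = ennreal \<epsilon> + ennreal ((1 / \<delta>) * (a ^ Suc k * C))"
      using \<epsilon> \<delta> C by (subst ennreal_plus[symmetric]) (auto simp del: power_Suc)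
    also have "ennreal ((1 / \<delta>) * (a ^ Suc k * C)) = ennreal (1 / \<delta>) * (ennreal (a ^ Suc k) * ennreal C)"
      using C by (subst ennreal_mult'', simp, subst ennreal_mult'', simp_all)
    finally show ?thesis ..
  qed
  finally show ?thesis .
qed

end

text \<open>
  Fatou's lemma for convergent sequences with a uniform bound.
\<close>
lemma nn_integral_limit_le:
  fixes B :: ennreal
  assumes "\<And>n. f n \<in> borel_measurable N" "\<And>z. z \<in> space N \<Longrightarrow> (\<lambda>n. f n z) \<longlonglongrightarrow> g z"
    and "\<And>n. (\<integral>\<^sup>+ z. f n z \<partial>N) \<le> B"
  shows "(\<integral>\<^sup>+ z. g z \<partial>N) \<le> B"
proof -
  have "(\<integral>\<^sup>+ z. g z \<partial>N) = (\<integral>\<^sup>+ z. liminf (\<lambda>n. f n z) \<partial>N)"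
    by (intro nn_integral_cong lim_imp_Liminf[symmetric] assms(2)) simp_all
  also have "\<dots> \<le> liminf (\<lambda>n. \<integral>\<^sup>+ z. f n z \<partial>N)"
    by (rule nn_integral_liminf) fact
  also have "\<dots> \<le> liminf (\<lambda>n. B)"
    by (intro Liminf_mono always_eventually allI assms(3))
  finally show ?thesis
    by (simp add: Liminf_const)
qed

lemma convergent_if_summable_dist:
  fixes Y :: "nat \<Rightarrow> 'a::complete_space"
  assumes "summable (\<lambda>n. dist (Y n) (Y (Suc n)))"
  shows "convergent Y"
proof -
  define S where "S n = (\<Sum>i<n. dist (Y i) (Y (Suc i)))" for n
  have le: "dist (Y m) (Y (m + k)) \<le> S (m + k) - S m" for m k
  proof (induction k)
    case (Suc k)
    then show ?case
      using dist_triangle[of "Y m" "Y (m + Suc k)" "Y (m + k)"] by (simp add: S_def)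
  qed simp
  have "convergent S"
    using assms unfolding S_def summable_iff_convergent .
  then have "Cauchy S"
    by (rule convergent_Cauchy)
  then have "Cauchy Y"
    unfolding Cauchy_altdef
  proof (intro allI impI)
    fix e :: real assume "\<forall>e>0. \<exists>M. \<forall>m\<ge>M. \<forall>n>m. dist (S m) (S n) < e" "0 < e"
    then obtain K where K: "\<And>m n. K \<le> m \<Longrightarrow> m < n \<Longrightarrow> dist (S m) (S n) < e"
      by blast
    have "dist (Y m) (Y n) < e" if "K \<le> m" "m < n" for m n
      using le[of m "n - m"] K[OF that] that by (simp add: dist_real_def)
    then show "\<exists>M. \<forall>m\<ge>M. \<forall>n>m. dist (Y m) (Y n) < e"
      by blast
  qed
  then show ?thesis
    by (simp add: Cauchy_convergent_iff)
qed

text \<open>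
  A shift-invariant measure whose word probabilities are limits of path laws with a common moment
  bound.  Two instances are used: the constant sequence of an invariant measure, and Cesaro averages along
  an orbit.
\<close>
locale limit_law = contractive_markov M x a b
  for M :: "('k::complete_space, 'e) markov_system" and x a b +
  fixes \<Lambda> :: "(int \<Rightarrow> 'e option) measure" and \<nu> :: "nat \<Rightarrow> 'k measure" and C :: real
  assumes shift_invariant: "\<Lambda> \<in> shift_invariant_measures M"
    and AE_edges: "AE \<sigma> in \<Lambda>. \<forall>i. \<sigma> i \<in> Some ` edges M"
    and prob_\<nu>: "\<And>n. prob_space (\<nu> n)"
    and sets_\<nu>: "\<And>n. sets (\<nu> n) = sets borel"
    and C_nonneg: "0 \<le> C"
    and lyap_\<nu>: "\<And>n. (\<integral>\<^sup>+ z. ennreal (lyap z) \<partial>\<nu> n) \<le> ennreal C"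
    and law_limit: "\<And>u. set u \<subseteq> edges M \<Longrightarrow>
      (\<lambda>n. word_integral (\<nu> n) (\<lambda>_. 1) u) \<longlonglongrightarrow> measure \<Lambda> (word_cylinder M 0 u)"
begin

sublocale prob_space \<Lambda>
  by (rule shift_invariantD(1)[OF shift_invariant])

lemmas sets_\<Lambda> = shift_invariantD(2)[OF shift_invariant]
lemmas space_\<Lambda> = shift_invariantD(3)[OF shift_invariant]

definition law :: "'e list \<Rightarrow> real" where
  "law u = measure \<Lambda> (word_cylinder M 0 u)"

lemma emeasure_word_cylinder: "emeasure \<Lambda> (word_cylinder M m u) = ennreal (law u)"
  using shift_invariant_word_cylinder[OF shift_invariant, of m u 0]
  by (simp add: law_def emeasure_eq_measure)

lemma law_nonneg [simp]: "0 \<le> law u"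
  by (simp add: law_def)

text \<open>
  A word that is not a path has probability zero for every starting point, hence also in the limit.
\<close>
lemma AE_path_space: "AE \<sigma> in \<Lambda>. \<sigma> \<in> path_space M"
proof -
  have inadmissible: "law [e, f] = 0" if ef: "e \<in> edges M" "f \<in> edges M" "src M f \<noteq> trg M e" for e f
  proof -
    have "prb M e z * prb M f (wmap M e z) = 0" for z
    proof (cases "z \<in> cell M (src M e)")
      case True
      then have "wmap M e z \<notin> cell M (src M f)"
        using wmap_cell[OF ef(1) True] ef by (simp add: in_cell_iff)
      then show ?thesis using ef by (simp add: prb_outside)
    qed (use ef in \<open>simp add: prb_outside\<close>)
    then have "(\<lambda>z. word_prb M [e, f] z * 1) = (\<lambda>_. 0)"
      by (simp add: fun_eq_iff)
    then have "word_integral (\<nu> n) (\<lambda>_. 1) [e, f] = 0" for n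
      unfolding word_integral_def by (simp only: lebesgue_integral_const scaleR_zero_right)
    then show ?thesis
      using law_limit[of "[e, f]"] ef by (simp add: law_def LIMSEQ_const_iff)
  qed
  let ?B = "{(e, f). e \<in> edges M \<and> f \<in> edges M \<and> src M f \<noteq> trg M e}"
  have "?B \<subseteq> edges M \<times> edges M"
    by auto
  then have "countable ?B"
    by (rule countable_subset) (simp add: countable_edges)
  moreover have "AE \<sigma> in \<Lambda>. \<sigma> \<notin> word_cylinder M i [fst p, snd p]" if "p \<in> ?B" for i p
  proof -
    have "word_cylinder M i [fst p, snd p] \<in> sets \<Lambda>"
      by (simp add: sets_\<Lambda> word_cylinder_sets)
    then have "word_cylinder M i [fst p, snd p] \<in> null_sets \<Lambda>"
      using that by (auto simp: null_sets_def emeasure_word_cylinder inadmissible)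
    then show ?thesis by (rule AE_not_in)
  qed
  ultimately have "AE \<sigma> in \<Lambda>. \<forall>p\<in>?B. \<forall>i. \<sigma> \<notin> word_cylinder M i [fst p, snd p]"
    by (simp only: AE_ball_countable AE_all_countable) blast
  moreover have "AE \<sigma> in \<Lambda>. \<sigma> \<in> code_space M"
    unfolding space_\<Lambda>[symmetric] by (rule AE_space)
  ultimately show ?thesis
    using AE_edges
  proof eventually_elim
    fix \<sigma> assume 1: "\<forall>p\<in>?B. \<forall>i. \<sigma> \<notin> word_cylinder M i [fst p, snd p]"
      and 2: "\<sigma> \<in> code_space M" and 3: "\<forall>i. \<sigma> i \<in> Some ` edges M"
    have "src' M (\<sigma> (i + 1)) = trg' M (\<sigma> i)" for i
    proof (rule ccontr)
      assume neq: "src' M (\<sigma> (i + 1)) \<noteq> trg' M (\<sigma> i)"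
      obtain e f where ef: "\<sigma> i = Some e" "\<sigma> (i + 1) = Some f" "e \<in> edges M" "f \<in> edges M"
        using 3 by (metis imageE)
      then have "(e, f) \<in> ?B"
        using neq by simp
      moreover have "\<sigma> \<in> word_cylinder M i [e, f]"
        using 2 ef by (auto simp: word_cylinder_def less_Suc_eq)
      ultimately show False
        using 1 by force
    qed
    then show "\<sigma> \<in> path_space M"
      using 2 3 by (simp add: path_space_def)
  qed
qed

lemma nn_integral_dist_backward:
  "(\<integral>\<^sup>+ \<sigma>. ennreal (dist (backward_iterate M x \<sigma> k) (backward_iterate M x \<sigma> (Suc k))) \<partial>\<Lambda>)
    \<le> ennreal (a ^ Suc k * (2 * C + b))"
proof -
  let ?g = "\<lambda>u. ennreal (dist (word_point (tl u)) (word_point u))"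
  have "(\<integral>\<^sup>+ \<sigma>. ennreal (dist (backward_iterate M x \<sigma> k) (backward_iterate M x \<sigma> (Suc k))) \<partial>\<Lambda>) =
        (\<integral>\<^sup>+ \<sigma>. ?g (code_word \<sigma> (- int (Suc k)) (Suc (Suc k))) \<partial>\<Lambda>)"
  proof (rule nn_integral_cong_AE)
    show "AE \<sigma> in \<Lambda>. ennreal (dist (backward_iterate M x \<sigma> k) (backward_iterate M x \<sigma> (Suc k))) =
      ?g (code_word \<sigma> (- int (Suc k)) (Suc (Suc k)))"
      using AE_edges
    proof eventually_elim
      fix \<sigma> :: "int \<Rightarrow> 'e option" assume "\<forall>i. \<sigma> i \<in> Some ` edges M"
      moreover have "tl (code_word \<sigma> (- int (Suc k)) (Suc (Suc k))) = code_word \<sigma> (- int k) (Suc k)"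
        by (rule nth_equalityI) (simp_all add: nth_tl)
      ultimately show "ennreal (dist (backward_iterate M x \<sigma> k) (backward_iterate M x \<sigma> (Suc k))) =
        ?g (code_word \<sigma> (- int (Suc k)) (Suc (Suc k)))"
        by (simp only: backward_iterate_eq_word_point)
    qed
  qed
  also have "\<dots> = (\<integral>\<^sup>+ u. ?g u * ennreal (law u) \<partial>count_space (words M (Suc (Suc k))))"
    by (subst nn_integral_code_word[OF sets_\<Lambda> AE_edges, where g = ?g]) (simp only: emeasure_word_cylinder)
  also have "\<dots> \<le> ennreal (a ^ Suc k * (2 * C + b))"
  proof (rule nn_integral_limit_le[where f = "\<lambda>n u. ?g u * ennreal (word_integral (\<nu> n) (\<lambda>_. 1) u)"])
    fix u assume "u \<in> space (count_space (words M (Suc (Suc k))))"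
    then have "set u \<subseteq> edges M"
      by (simp add: words_def)
    then show "(\<lambda>n. ?g u * ennreal (word_integral (\<nu> n) (\<lambda>_. 1) u)) \<longlonglongrightarrow> ?g u * ennreal (law u)"
      unfolding law_def by (intro ennreal_tendsto_cmult tendsto_ennrealI law_limit) auto
  next
    fix n
    interpret N: prob_space "\<nu> n" by (rule prob_\<nu>)
    note [measurable_cong] = sets_\<nu>[of n]
    have "(\<integral>\<^sup>+ u. ?g u * ennreal (word_integral (\<nu> n) (\<lambda>_. 1) u) \<partial>count_space (words M (Suc (Suc k)))) =
      (\<integral>\<^sup>+ u. \<integral>\<^sup>+ z. ennreal (word_prb M u z) * ?g u \<partial>\<nu> n \<partial>count_space (words M (Suc (Suc k))))"
    proof (rule nn_integral_cong)
      fix u assume "u \<in> space (count_space (words M (Suc (Suc k))))"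
      then have u: "set u \<subseteq> edges M"
        by (simp add: words_def)
      note [measurable] = measurable_word_prb[OF u]
      show "?g u * ennreal (word_integral (\<nu> n) (\<lambda>_. 1) u) = (\<integral>\<^sup>+ z. ennreal (word_prb M u z) * ?g u \<partial>\<nu> n)"
        by (subst ennreal_word_integral[OF prob_\<nu> sets_\<nu> _ _ u])
           (simp_all add: nn_integral_multc mult.commute)
    qed
    also have "\<dots> = (\<integral>\<^sup>+ z. \<integral>\<^sup>+ u. ennreal (word_prb M u z) * ?g u \<partial>count_space (words M (Suc (Suc k))) \<partial>\<nu> n)"
    proof (rule nn_integral_count_space_nn_integral[symmetric, OF countable_words])
      fix u assume "u \<in> words M (Suc (Suc k))"
      then have u: "set u \<subseteq> edges M"
        by (simp add: words_def)
      note [measurable] = measurable_word_prb[OF u]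
      show "(\<lambda>z. ennreal (word_prb M u z) * ?g u) \<in> borel_measurable (\<nu> n)"
        by measurable
    qed
    also have "\<dots> \<le> (\<integral>\<^sup>+ z. ennreal (a ^ Suc k) * ennreal (2 * lyap z + b) \<partial>\<nu> n)"
      by (intro nn_integral_mono sum_displacement_words)
    also have "\<dots> = ennreal (a ^ Suc k) * (2 * (\<integral>\<^sup>+ z. ennreal (lyap z) \<partial>\<nu> n) + ennreal b)"
      by (simp add: nn_integral_cmult ennreal_plus ennreal_mult nn_integral_add N.emeasure_space_1 del: power_Suc)
    also have "\<dots> \<le> ennreal (a ^ Suc k) * (2 * ennreal C + ennreal b)"
      by (intro mult_left_mono add_mono lyap_\<nu>) auto
    also have "\<dots> = ennreal (a ^ Suc k * (2 * C + b))"
      using C_nonneg by (simp add: ennreal_plus ennreal_mult del: power_Suc)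
    finally show "(\<integral>\<^sup>+ u. ?g u * ennreal (word_integral (\<nu> n) (\<lambda>_. 1) u) \<partial>count_space (words M (Suc (Suc k))))
      \<le> ennreal (a ^ Suc k * (2 * C + b))" .
  qed simp
  finally show ?thesis .
qed

text \<open>
  The mean distances of consecutive backward iterates form a convergent geometric series, so almost
  surely the distances are summable and the space is complete.
\<close>
lemma AE_coding_domain: "AE \<sigma> in \<Lambda>. \<sigma> \<in> coding_domain M x"
proof -
  let ?d = "\<lambda>k \<sigma>. dist (backward_iterate M x \<sigma> k) (backward_iterate M x \<sigma> (Suc k))"
  have meas [measurable]: "?d k \<in> borel_measurable \<Lambda>" for k
  proof -
    have "?d k \<in> borel_measurable (past_algebra M)"
    proof (rule measurable_past_finite[of _ _ "Suc k"])
      fix \<sigma> \<tau> :: "int \<Rightarrow> 'e option"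
      assume "\<And>i. - int (Suc k) \<le> i \<Longrightarrow> i \<le> 0 \<Longrightarrow> \<sigma> i = \<tau> i"
      then have "backward_iterate M x \<sigma> k = backward_iterate M x \<tau> k"
        "backward_iterate M x \<sigma> (Suc k) = backward_iterate M x \<tau> (Suc k)"
        by (auto intro!: backward_iterate_cong)
      then show "?d k \<sigma> = ?d k \<tau>" by simp
    qed simp
    then show ?thesis
      using measurable_past_code by (subst measurable_cong_sets[OF sets_\<Lambda> refl])
  qed
  have "(\<integral>\<^sup>+ \<sigma>. (\<Sum>k. ennreal (?d k \<sigma>)) \<partial>\<Lambda>) = (\<Sum>k. \<integral>\<^sup>+ \<sigma>. ennreal (?d k \<sigma>) \<partial>\<Lambda>)"
    by (rule nn_integral_suminf) measurable
  also have "\<dots> \<le> (\<Sum>k. ennreal (a ^ Suc k * (2 * C + b)))"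
    by (intro suminf_le nn_integral_dist_backward) auto
  also have "\<dots> < \<infinity>"
  proof -
    have "summable (\<lambda>k. a ^ Suc k * (2 * C + b))"
      by (intro summable_mult2 summable_Suc_iff[THEN iffD2] summable_geometric) simp
    then show ?thesis
      using C_nonneg by (subst suminf_ennreal2) (auto simp: ennreal_less_top)
  qed
  finally have "AE \<sigma> in \<Lambda>. (\<Sum>k. ennreal (?d k \<sigma>)) \<noteq> \<infinity>"
    by (intro nn_integral_noteq_infinite) auto
  with AE_path_space show ?thesis
  proof eventually_elim
    fix \<sigma> assume "\<sigma> \<in> path_space M" "(\<Sum>k. ennreal (?d k \<sigma>)) \<noteq> \<infinity>"
    moreover from this(2) have "summable (\<lambda>k. ?d k \<sigma>)"
      by (intro summable_suminf_not_top) auto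
    ultimately show "\<sigma> \<in> coding_domain M x"
      by (simp add: coding_domain_def convergent_if_summable_dist)
  qed
qed

text \<open>
  Here \<open>l w\<close> is the limit of the weighted word probabilities of \<open>w\<close>.  Extend \<open>w\<close> into the past by
  words \<open>v\<close> of length \<open>k\<close>: by consistency \<open>l w\<close> is the sum of the \<open>l (v @ w)\<close>, and each of them is
  close to the probability of \<open>v @ w\<close> times \<open>f (word_point (v @ w))\<close>.  These products sum up to the
  integral of \<open>f\<close> at the backward iterate over the cylinder of \<open>w\<close>.  The total error survives Fatou's lemma
  and vanishes as \<open>k \<rightarrow> \<infinity>\<close>.
\<close>
lemma limit_integral:
  assumes f: "cellwise_uniform f"
    and l_limit: "\<And>u. set u \<subseteq> edges M \<Longrightarrow> (\<lambda>n. word_integral (\<nu> n) f u) \<longlonglongrightarrow> l u"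
    and l_left: "\<And>w. set w \<subseteq> edges M \<Longrightarrow> (\<integral>\<^sup>+ e. ennreal (l (e # w)) \<partial>count_space (edges M)) = ennreal (l w)"
    and g: "g \<in> borel_measurable (code_borel M)" "AE \<sigma> in \<Lambda>. (\<lambda>n. f (backward_iterate M x \<sigma> n)) \<longlonglongrightarrow> g \<sigma>"
    and w: "set w \<subseteq> edges M"
  shows "(\<integral>\<^sup>+ \<sigma>. ennreal (g \<sigma>) * indicator (word_cylinder M (1 - int (length w)) w) \<sigma> \<partial>\<Lambda>) = ennreal (l w)"
proof -
  note fm = cellwise_uniformD[OF f]
  let ?A = "word_cylinder M (1 - int (length w)) w"
  define I where "I k = (\<integral>\<^sup>+ \<sigma>. ennreal (f (backward_iterate M x \<sigma> (k + length w))) * indicator ?A \<sigma> \<partial>\<Lambda>)" for k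
  define J where "J = (\<integral>\<^sup>+ \<sigma>. ennreal (g \<sigma>) * indicator ?A \<sigma> \<partial>\<Lambda>)"
  define D where "D u = ennreal \<bar>l u - law u * f (word_point u)\<bar>" for u
  have A [measurable]: "?A \<in> sets \<Lambda>"
    by (simp add: sets_\<Lambda> word_cylinder_sets)
  have [measurable]: "g \<in> borel_measurable \<Lambda>"
    using g(1) by (subst measurable_cong_sets[OF sets_\<Lambda> refl])
  have [measurable]: "(\<lambda>\<sigma>. f (backward_iterate M x \<sigma> n)) \<in> borel_measurable \<Lambda>" for n
    using measurable_past_code[OF measurable_past_backward[of f borel n]]
    by (subst measurable_cong_sets[OF sets_\<Lambda> refl]) simp
  have "I \<longlonglongrightarrow> J"
    unfolding I_def J_def
  proof (rule nn_integral_dominated_convergence[where w = "\<lambda>_. 1"])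
    show "AE \<sigma> in \<Lambda>. (\<lambda>k. ennreal (f (backward_iterate M x \<sigma> (k + length w))) * indicator ?A \<sigma>) \<longlonglongrightarrow> ennreal (g \<sigma>) * indicator ?A \<sigma>"
      using g(2)
    proof eventually_elim
      fix \<sigma> assume "(\<lambda>n. f (backward_iterate M x \<sigma> n)) \<longlonglongrightarrow> g \<sigma>"
      then have "(\<lambda>k. f (backward_iterate M x \<sigma> (k + length w))) \<longlonglongrightarrow> g \<sigma>"
        by (rule LIMSEQ_ignore_initial_segment)
      then show "(\<lambda>k. ennreal (f (backward_iterate M x \<sigma> (k + length w))) * indicator ?A \<sigma>) \<longlonglongrightarrow> ennreal (g \<sigma>) * indicator ?A \<sigma>"
        by (auto simp: indicator_def intro!: tendsto_ennrealI)
    qed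
  qed (use fm(2) in \<open>auto simp: emeasure_space_1 ennreal_le_1 split: split_indicator\<close>)
  have I_eq: "I k = (\<integral>\<^sup>+ v. ennreal (law (v @ w) * f (word_point (v @ w))) \<partial>count_space (words M (Suc k)))" for k
  proof -
    let ?G = "\<lambda>u. ennreal (f (word_point u)) * indicator {w} (drop (Suc k) u)"
    have "I k = (\<integral>\<^sup>+ \<sigma>. ?G (code_word \<sigma> (- int (k + length w)) (Suc k + length w)) \<partial>\<Lambda>)"
      unfolding I_def
    proof (rule nn_integral_cong_AE)
      have "AE \<sigma> in \<Lambda>. \<sigma> \<in> code_space M"
        unfolding space_\<Lambda>[symmetric] by (rule AE_space)
      then show "AE \<sigma> in \<Lambda>. ennreal (f (backward_iterate M x \<sigma> (k + length w))) * indicator ?A \<sigma> =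
          ?G (code_word \<sigma> (- int (k + length w)) (Suc k + length w))"
        using AE_edges
      proof eventually_elim
        fix \<sigma> assume \<sigma>: "\<sigma> \<in> code_space M" "\<forall>i. \<sigma> i \<in> Some ` edges M"
        have "drop (Suc k) (code_word \<sigma> (- int (k + length w)) (Suc k + length w)) =
              code_word \<sigma> (1 - int (length w)) (length w)"
          by (rule nth_equalityI) (simp_all add: algebra_simps)
        then have "indicator ?A \<sigma> = (indicator {w} (drop (Suc k) (code_word \<sigma> (- int (k + length w)) (Suc k + length w))) :: ennreal)"
          using \<sigma> by (simp add: indicator_def in_word_cylinder_iff)
        then show "ennreal (f (backward_iterate M x \<sigma> (k + length w))) * indicator ?A \<sigma> =
          ?G (code_word \<sigma> (- int (k + length w)) (Suc k + length w))"
          using \<sigma> by (simp only: backward_iterate_eq_word_point add_Suc)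
      qed
    qed
    also have "\<dots> = (\<integral>\<^sup>+ v. \<integral>\<^sup>+ u. ?G (v @ u) * ennreal (law (v @ u)) \<partial>count_space (words M (length w)) \<partial>count_space (words M (Suc k)))"
      by (subst nn_integral_code_word[OF sets_\<Lambda> AE_edges, where g = ?G])
         (simp only: emeasure_word_cylinder nn_integral_words_append)
    also have "\<dots> = (\<integral>\<^sup>+ v. \<integral>\<^sup>+ u. ennreal (law (v @ u) * f (word_point (v @ u))) * indicator {w} u \<partial>count_space (words M (length w)) \<partial>count_space (words M (Suc k)))"
      by (intro nn_integral_cong) (auto simp: words_def ennreal_mult fm(2) mult_ac split: split_indicator)
    also have "\<dots> = (\<integral>\<^sup>+ v. ennreal (law (v @ w) * f (word_point (v @ w))) \<partial>count_space (words M (Suc k)))"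
      using w by (intro nn_integral_cong) (simp add: words_def)
    finally show ?thesis .
  qed
  have sum_l: "(\<integral>\<^sup>+ v. ennreal (l (v @ w)) \<partial>count_space (words M (Suc k))) = ennreal (l w)" for k
    by (rule sum_words_left[where q = "\<lambda>u. ennreal (l u)", OF l_left w])
  have l_nonneg: "0 \<le> l u" if "set u \<subseteq> edges M" for u
    by (rule LIMSEQ_le_const[OF l_limit[OF that]]) (use word_integral_bounds(1)[OF prob_\<nu> sets_\<nu> fm that] in blast)
  have close: "ennreal (l w) \<le> I k + ennreal R" "I k \<le> ennreal (l w) + ennreal R"
    if R: "(\<integral>\<^sup>+ u. D u \<partial>count_space (words M (Suc k + length w))) \<le> ennreal R" for k R
  proof -
    have DR: "(\<integral>\<^sup>+ v. D (v @ w) \<partial>count_space (words M (Suc k))) \<le> ennreal R"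
    proof -
      have "(\<integral>\<^sup>+ v. D (v @ w) \<partial>count_space (words M (Suc k))) \<le>
        (\<integral>\<^sup>+ v. \<integral>\<^sup>+ u. D (v @ u) \<partial>count_space (words M (length w)) \<partial>count_space (words M (Suc k)))"
        using w by (intro nn_integral_mono nn_integral_ge_point) (simp add: words_def)
      also have "\<dots> \<le> ennreal R"
        using R unfolding nn_integral_words_append .
      finally show ?thesis .
    qed
    have le1: "ennreal (l u) \<le> ennreal (law u * f (word_point u)) + D u" for u
    proof -
      have "ennreal (l u) \<le> ennreal (law u * f (word_point u) + \<bar>l u - law u * f (word_point u)\<bar>)"
        by (intro ennreal_leI) linarith
      then show ?thesis
        unfolding D_def by (simp add: fm(2))
    qed
    have le2: "ennreal (law u * f (word_point u)) \<le> ennreal (l u) + D u" if "set u \<subseteq> edges M" for u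
    proof -
      have "ennreal (law u * f (word_point u)) \<le> ennreal (l u + \<bar>l u - law u * f (word_point u)\<bar>)"
        by (intro ennreal_leI) linarith
      then show ?thesis
        unfolding D_def by (simp add: l_nonneg[OF that])
    qed
    have "ennreal (l w) \<le> (\<integral>\<^sup>+ v. ennreal (law (v @ w) * f (word_point (v @ w))) + D (v @ w) \<partial>count_space (words M (Suc k)))"
      unfolding sum_l[of k, symmetric] by (intro nn_integral_mono le1)
    also have "\<dots> = I k + (\<integral>\<^sup>+ v. D (v @ w) \<partial>count_space (words M (Suc k)))"
      by (simp add: nn_integral_add I_eq)
    finally show "ennreal (l w) \<le> I k + ennreal R"
      using DR by (meson add_left_mono order_trans)
    have "I k \<le> (\<integral>\<^sup>+ v. ennreal (l (v @ w)) + D (v @ w) \<partial>count_space (words M (Suc k)))"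
      unfolding I_eq using w by (intro nn_integral_mono le2) (auto simp: words_def)
    also have "\<dots> = ennreal (l w) + (\<integral>\<^sup>+ v. D (v @ w) \<partial>count_space (words M (Suc k)))"
      by (simp add: nn_integral_add sum_l)
    finally show "I k \<le> ennreal (l w) + ennreal R"
      using DR by (meson add_left_mono order_trans)
  qed
  have limits: "ennreal (l w) \<le> J + ennreal \<epsilon>" "J \<le> ennreal (l w) + ennreal \<epsilon>" if \<epsilon>: "0 < \<epsilon>" for \<epsilon> :: real
  proof -
    \<comment> \<open>the error tends to \<open>\<epsilon>\<close> as the past word gets longer, for each \<open>\<epsilon>\<close>\<close>
    obtain \<delta> where \<delta>: "0 < \<delta>"
      "\<And>j s t. j \<in> vertices M \<Longrightarrow> s \<in> cell M j \<Longrightarrow> t \<in> cell M j \<Longrightarrow> \<bar>f s - f t\<bar> \<le> \<epsilon> + dist s t / \<delta>"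
      using cellwise_uniform_le[OF f \<epsilon>] by blast
    define R where "R k = \<epsilon> + a ^ Suc (k + length w) * C / \<delta>" for k
    have "(\<integral>\<^sup>+ u. D u \<partial>count_space (words M (Suc k + length w))) \<le> ennreal (R k)" for k
    proof (rule nn_integral_limit_le[where
        f = "\<lambda>n u. ennreal \<bar>word_integral (\<nu> n) f u - word_integral (\<nu> n) (\<lambda>_. 1) u * f (word_point u)\<bar>"])
      fix u assume "u \<in> space (count_space (words M (Suc k + length w)))"
      then have "set u \<subseteq> edges M"
        by (simp add: words_def)
      then show "(\<lambda>n. ennreal \<bar>word_integral (\<nu> n) f u - word_integral (\<nu> n) (\<lambda>_. 1) u * f (word_point u)\<bar>) \<longlonglongrightarrow> D u"
        unfolding D_def law_def
        by (intro tendsto_ennrealI tendsto_rabs tendsto_diff tendsto_mult tendsto_const l_limit law_limit)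
    next
      fix n
      show "(\<integral>\<^sup>+ u. ennreal \<bar>word_integral (\<nu> n) f u - word_integral (\<nu> n) (\<lambda>_. 1) u * f (word_point u)\<bar>
          \<partial>count_space (words M (Suc k + length w))) \<le> ennreal (R k)"
        unfolding R_def add_Suc
        by (intro sum_word_integral_diff prob_\<nu> sets_\<nu> lyap_\<nu> f less_imp_le[OF \<epsilon>] \<delta> C_nonneg)
    qed simp
    note c = close[OF this]
    have "(\<lambda>k. a ^ Suc (k + length w)) \<longlonglongrightarrow> 0"
      using LIMSEQ_ignore_initial_segment[OF LIMSEQ_realpow_zero[of a], of "Suc (length w)"] by simp
    then have "R \<longlonglongrightarrow> \<epsilon> + 0 * C / \<delta>"
      unfolding R_def using \<delta>(1) by (intro tendsto_intros) auto
    then have R: "(\<lambda>k. ennreal (R k)) \<longlonglongrightarrow> ennreal \<epsilon>"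
      by (intro tendsto_ennrealI) simp
    show "ennreal (l w) \<le> J + ennreal \<epsilon>"
      by (rule LIMSEQ_le_const[OF tendsto_add[OF \<open>I \<longlonglongrightarrow> J\<close> R]]) (use c(1) in blast)
    show "J \<le> ennreal (l w) + ennreal \<epsilon>"
      by (rule LIMSEQ_le[OF \<open>I \<longlonglongrightarrow> J\<close> tendsto_add[OF tendsto_const R]]) (use c(2) in blast)
  qed
  show ?thesis
    unfolding J_def[symmetric]
  proof (rule antisym)
    show "J \<le> ennreal (l w)"
      by (rule ennreal_le_epsilon) (rule limits(2))
    show "ennreal (l w) \<le> J"
      by (rule ennreal_le_epsilon) (rule limits(1))
  qed
qed

end

section \<open>From invariant measures to equilibrium states\<close>

context contractive_markov
begin

lemma sum_word_integral_Cons: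
  assumes \<nu>: "prob_space \<nu>" "sets \<nu> = sets borel" and f: "f \<in> borel_measurable borel" "\<And>z. 0 \<le> f z \<and> f z \<le> 1"
    and w: "set w \<subseteq> edges M"
  shows "(\<integral>\<^sup>+ e. ennreal (word_integral \<nu> f (e # w)) \<partial>count_space (edges M)) =
    (\<integral>\<^sup>+ z. markov_op M (\<lambda>z. ennreal (word_prb M w z) * ennreal (f (word_map M w z))) z \<partial>\<nu>)"
proof -
  have [measurable_cong]: "sets \<nu> = sets borel" by fact
  note [measurable] = f(1) measurable_word_prb[OF w] measurable_word_map[OF w]
  have "(\<integral>\<^sup>+ e. ennreal (word_integral \<nu> f (e # w)) \<partial>count_space (edges M)) =
    (\<integral>\<^sup>+ e. \<integral>\<^sup>+ z. ennreal (prb M e z) * (ennreal (word_prb M w (wmap M e z)) *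
       ennreal (f (word_map M w (wmap M e z)))) \<partial>\<nu> \<partial>count_space (edges M))"
  proof (rule nn_integral_cong)
    fix e assume "e \<in> space (count_space (edges M))"
    then show "ennreal (word_integral \<nu> f (e # w)) =
      (\<integral>\<^sup>+ z. ennreal (prb M e z) * (ennreal (word_prb M w (wmap M e z)) *
       ennreal (f (word_map M w (wmap M e z)))) \<partial>\<nu>)"
      using w by (subst ennreal_word_integral[OF \<nu> f]) (simp_all add: ennreal_mult mult.assoc)
  qed
  also have "\<dots> = (\<integral>\<^sup>+ z. \<integral>\<^sup>+ e. ennreal (prb M e z) * (ennreal (word_prb M w (wmap M e z)) *
       ennreal (f (word_map M w (wmap M e z)))) \<partial>count_space (edges M) \<partial>\<nu>)"
  proof (rule nn_integral_count_space_nn_integral[symmetric, OF countable_edges])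
    fix e assume [measurable]: "e \<in> edges M"
    show "(\<lambda>z. ennreal (prb M e z) * (ennreal (word_prb M w (wmap M e z)) *
       ennreal (f (word_map M w (wmap M e z))))) \<in> borel_measurable \<nu>"
      by measurable
  qed
  finally show ?thesis
    by (simp add: markov_op_def)
qed

lemma sum_word_integral_snoc:
  assumes \<nu>: "prob_space \<nu>" "sets \<nu> = sets borel" and w: "set w \<subseteq> edges M"
  shows "(\<integral>\<^sup>+ e. ennreal (word_integral \<nu> (\<lambda>_. 1) (w @ [e])) \<partial>count_space (edges M)) =
    ennreal (word_integral \<nu> (\<lambda>_. 1) w)"
proof -
  have [measurable_cong]: "sets \<nu> = sets borel" by fact
  note [measurable] = measurable_word_prb[OF w] measurable_word_map[OF w]
  have "(\<integral>\<^sup>+ e. ennreal (word_integral \<nu> (\<lambda>_. 1) (w @ [e])) \<partial>count_space (edges M)) =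
    (\<integral>\<^sup>+ e. \<integral>\<^sup>+ z. ennreal (word_prb M w z) * ennreal (prb M e (word_map M w z)) \<partial>\<nu> \<partial>count_space (edges M))"
  proof (rule nn_integral_cong)
    fix e assume "e \<in> space (count_space (edges M))"
    then show "ennreal (word_integral \<nu> (\<lambda>_. 1) (w @ [e])) =
      (\<integral>\<^sup>+ z. ennreal (word_prb M w z) * ennreal (prb M e (word_map M w z)) \<partial>\<nu>)"
      using w by (subst ennreal_word_integral[OF \<nu>]) (simp_all add: word_prb_append ennreal_mult)
  qed
  also have "\<dots> = (\<integral>\<^sup>+ z. \<integral>\<^sup>+ e. ennreal (word_prb M w z) * ennreal (prb M e (word_map M w z)) \<partial>count_space (edges M) \<partial>\<nu>)"
  proof (rule nn_integral_count_space_nn_integral[symmetric, OF countable_edges])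
    fix e assume [measurable]: "e \<in> edges M"
    show "(\<lambda>z. ennreal (word_prb M w z) * ennreal (prb M e (word_map M w z))) \<in> borel_measurable \<nu>"
      by measurable
  qed
  also have "\<dots> = ennreal (word_integral \<nu> (\<lambda>_. 1) w)"
    using w by (subst ennreal_word_integral[OF \<nu>]) (simp_all add: nn_integral_cmult sum_prb)
  finally show ?thesis .
qed

lemma invariantD:
  assumes "\<mu> \<in> invariant_measures M"
  shows "prob_space \<mu>" "sets \<mu> = sets borel" "space \<mu> = UNIV"
  using assms sets_eq_imp_space_eq[of \<mu> borel] by (simp_all add: invariant_measures_def)

lemma invariant_word_integral_Cons:
  assumes \<mu>: "\<mu> \<in> invariant_measures M" and f: "f \<in> borel_measurable borel" "\<And>z. 0 \<le> f z \<and> f z \<le> 1"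
    and w: "set w \<subseteq> edges M"
  shows "(\<integral>\<^sup>+ e. ennreal (word_integral \<mu> f (e # w)) \<partial>count_space (edges M)) = ennreal (word_integral \<mu> f w)"
proof -
  note [measurable] = f(1) measurable_word_prb[OF w] measurable_word_map[OF w]
  show ?thesis
    unfolding sum_word_integral_Cons[OF invariantD(1,2)[OF \<mu>] f w]
      ennreal_word_integral[OF invariantD(1,2)[OF \<mu>] f w]
    by (rule invariant_nn_integral[OF \<mu>]) measurable
qed

text \<open>
  Consistency on the left is the invariance of the measure; on the right it holds for every starting
  law.
\<close>
lemma exists_path_measure:
  assumes \<mu>: "\<mu> \<in> invariant_measures M"
  obtains \<Lambda> where "\<Lambda> \<in> shift_invariant_measures M" "AE \<sigma> in \<Lambda>. \<forall>i. \<sigma> i \<in> Some ` edges M"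
    "\<And>m u. set u \<subseteq> edges M \<Longrightarrow> emeasure \<Lambda> (word_cylinder M m u) = ennreal (word_integral \<mu> (\<lambda>_. 1) u)"
proof -
  note \<mu>' = invariantD(1,2)[OF \<mu>]
  interpret prob_space \<mu> by fact
  interpret word_law M "word_integral \<mu> (\<lambda>_. 1)"
  proof
    show "word_integral \<mu> (\<lambda>_. 1) [] = 1"
      by (simp add: word_integral_def prob_space)
    show "0 \<le> word_integral \<mu> (\<lambda>_. 1) w" if "set w \<subseteq> edges M" for w
      by (rule word_integral_bounds(1)[OF \<mu>' _ _ that]) simp_all
  qed (simp_all add: invariant_word_integral_Cons[OF \<mu>] sum_word_integral_snoc[OF \<mu>'])
  show thesis
    using that stationary_measure_shift_invariant AE_stationary_measure emeasure_stationary_measure by blast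
qed

lemma markov_path_measure_eq:
  assumes \<mu>: "prob_space \<mu>" "sets \<mu> = sets borel"
    and \<Lambda>: "prob_space \<Lambda>" "sets \<Lambda> = sets (code_borel M)" "AE \<sigma> in \<Lambda>. \<forall>i. \<sigma> i \<in> Some ` edges M"
    and law: "\<And>m u. set u \<subseteq> edges M \<Longrightarrow> emeasure \<Lambda> (word_cylinder M m u) = ennreal (word_integral \<mu> (\<lambda>_. 1) u)"
  shows "markov_path_measure M \<mu> = \<Lambda>"
  unfolding markov_path_measure_def
proof (rule the_equality)
  have "emeasure \<Lambda> (cylinder M m n e) =
      (\<integral>\<^sup>+ z. ennreal (\<Prod>i\<in>{m..n}. prb' M (e i) (wcomp M e m (nat (i - m)) z)) \<partial>\<mu>)"
    if mn: "m \<le> n" and e: "e \<in> {m..n} \<rightarrow> symbols M" for m n and e :: "int \<Rightarrow> 'e option"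
  proof (cases "\<exists>i\<in>{m..n}. e i = None")
    case True
    then obtain i where i: "i \<in> {m..n}" "e i = None" by blast
    then have "(\<Prod>i\<in>{m..n}. prb' M (e i) (wcomp M e m (nat (i - m)) z)) = 0" for z
      by (intro prod_zero bexI[of _ i]) simp_all
    then show ?thesis
      unfolding cylinder_null[where i = i and e = e, OF \<Lambda>(3,2) mn i] by (simp only:) simp
  next
    case False
    let ?k = "nat (n - m + 1)"
    have *: "e (m + int i) \<noteq> None" "the (e (m + int i)) \<in> edges M" if "i < ?k" for i
    proof -
      have i: "m + int i \<in> {m..n}"
        using that by auto
      with False show ne: "e (m + int i) \<noteq> None" by (metis option.distinct(1))
      have "e (m + int i) \<in> symbols M"
        by (rule Pi_mem[OF e i])
      with ne show "the (e (m + int i)) \<in> edges M"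
        by (auto simp: symbols_def)
    qed
    have u: "set (code_word e m ?k) \<subseteq> edges M"
      using *(2) by (auto simp: code_word_def)
    have "(\<Prod>i\<in>{m..n}. prb' M (e i) (wcomp M e m (nat (i - m)) z)) = word_prb M (code_word e m ?k) z" for z
      unfolding prod_int_interval[OF mn] using prod_prb'_eq_word_prb[of ?k e m M z] *(1) by simp
    moreover have "cylinder M m n e = word_cylinder M m (code_word e m ?k)"
      by (rule cylinder_eq_word_cylinder[OF mn]) (use False in auto)
    ultimately show ?thesis
      by (simp only: law[OF u]) (subst ennreal_word_integral[OF \<mu> _ _ u], simp_all)
  qed
  then show spec: "prob_space \<Lambda> \<and> sets \<Lambda> = sets (code_borel M) \<and>
    (\<forall>m n e. m \<le> 0 \<and> m \<le> n \<and> e \<in> {m..n} \<rightarrow> symbols M \<longrightarrow>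
      emeasure \<Lambda> (cylinder M m n e) =
      (\<integral>\<^sup>+ z. ennreal (\<Prod>i\<in>{m..n}. prb' M (e i) (wcomp M e m (nat (i - m)) z)) \<partial>\<mu>))"
    using \<Lambda> by simp
  fix Q assume Q: "prob_space Q \<and> sets Q = sets (code_borel M) \<and>
    (\<forall>m n e. m \<le> 0 \<and> m \<le> n \<and> e \<in> {m..n} \<rightarrow> symbols M \<longrightarrow>
      emeasure Q (cylinder M m n e) =
      (\<integral>\<^sup>+ z. ennreal (\<Prod>i\<in>{m..n}. prb' M (e i) (wcomp M e m (nat (i - m)) z)) \<partial>\<mu>))"
  show "Q = \<Lambda>"
  proof (rule code_measure_eqI)
    fix k and e :: "int \<Rightarrow> 'e option" assume "e \<in> {- int k..int k} \<rightarrow> symbols M"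
    then show "emeasure Q (cylinder M (- int k) (int k) e) = emeasure \<Lambda> (cylinder M (- int k) (int k) e)"
      using Q spec by simp
  qed (use Q \<Lambda> in simp_all)
qed

lemma equilibrium_statesI:
  assumes \<Lambda>: "\<Lambda> \<in> shift_invariant_measures M" and D: "AE \<sigma> in \<Lambda>. \<sigma> \<in> coding_domain M x"
    and ker: "\<And>e. e \<in> edges M \<Longrightarrow> past_kernel \<Lambda> e (\<lambda>\<sigma>. prb M e (past_limit \<sigma>))"
  shows "\<Lambda> \<in> equilibrium_states M x"
proof -
  note * = shift_invariantD(1,2)[OF \<Lambda>]
  have "AE \<sigma> in \<Lambda>. cond_prob_edge M \<Lambda> e \<sigma> = prb M e (coding_map M x \<sigma>)" if e: "e \<in> edges M" for e
  proof -
    have "(\<lambda>\<sigma>. prb M e (past_limit \<sigma>)) \<in> borel_measurable (past_algebra M)"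
      by (rule measurable_compose[OF measurable_past_limit measurable_prb[OF e]])
    then have "AE \<sigma> in \<Lambda>. cond_prob_edge M \<Lambda> e \<sigma> = prb M e (past_limit \<sigma>)"
      using e ker by (subst cond_prob_edge_iff[OF *]) auto
    with D show ?thesis
      by eventually_elim (simp add: coding_map_eq_past_limit)
  qed
  then show ?thesis
    using \<Lambda> D AE_coding_domain_iff[OF *] by (simp add: equilibrium_states_def)
qed

lemma equilibrium_statesD:
  assumes "\<Lambda> \<in> equilibrium_states M x"
  shows "\<Lambda> \<in> shift_invariant_measures M" "AE \<sigma> in \<Lambda>. \<sigma> \<in> coding_domain M x"
    and "e \<in> edges M \<Longrightarrow> past_kernel \<Lambda> e (\<lambda>\<sigma>. prb M e (past_limit \<sigma>))"
proof -
  show \<Lambda>: "\<Lambda> \<in> shift_invariant_measures M"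
    using assms by (simp add: equilibrium_states_def)
  note * = shift_invariantD(1,2)[OF \<Lambda>]
  show D: "AE \<sigma> in \<Lambda>. \<sigma> \<in> coding_domain M x"
    using assms AE_coding_domain_iff[OF *] by (simp add: equilibrium_states_def)
  assume e: "e \<in> edges M"
  have "AE \<sigma> in \<Lambda>. cond_prob_edge M \<Lambda> e \<sigma> = prb M e (coding_map M x \<sigma>)"
    using assms e by (simp add: equilibrium_states_def)
  with D have "AE \<sigma> in \<Lambda>. cond_prob_edge M \<Lambda> e \<sigma> = prb M e (past_limit \<sigma>)"
    by eventually_elim (simp add: coding_map_eq_past_limit)
  moreover have "(\<lambda>\<sigma>. prb M e (past_limit \<sigma>)) \<in> borel_measurable (past_algebra M)"
    by (rule measurable_compose[OF measurable_past_limit measurable_prb[OF e]])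
  ultimately show "past_kernel \<Lambda> e (\<lambda>\<sigma>. prb M e (past_limit \<sigma>))"
    using e by (subst (asm) cond_prob_edge_iff[OF *]) auto
qed

text \<open>
  Cylinders that prescribe the point at infinity are null, all others are cylinders of words.
\<close>
lemma past_kernel_from_words:
  assumes \<Lambda>: "\<Lambda> \<in> shift_invariant_measures M" "AE \<sigma> in \<Lambda>. \<forall>i. \<sigma> i \<in> Some ` edges M"
    and e: "e \<in> edges M" and \<theta>: "\<theta> \<in> borel_measurable (past_algebra M)"
    and eq: "\<And>u. set u \<subseteq> edges M \<Longrightarrow>
      (\<integral>\<^sup>+ \<sigma>. ennreal (\<theta> \<sigma>) * indicator (word_cylinder M (1 - int (length u)) u) \<sigma> \<partial>\<Lambda>) =
      emeasure \<Lambda> (word_cylinder M (1 - int (length u)) (u @ [e]))"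
  shows "past_kernel \<Lambda> e \<theta>"
proof (rule past_kernelI[OF shift_invariantD(1,2)[OF \<Lambda>(1)] \<theta>])
  fix m and f :: "int \<Rightarrow> 'e option" assume m: "m \<le> 0" and f: "f \<in> {m..0} \<rightarrow> symbols M"
  have C: "cylinder M m 0 f \<in> sets \<Lambda>"
    using cylinder_in_code_borel[OF m] by (simp add: shift_invariantD(2)[OF \<Lambda>(1)])
  show "emeasure \<Lambda> (cylinder M m 0 f \<inter> word_cylinder M 1 [e]) =
    (\<integral>\<^sup>+ \<sigma>. ennreal (\<theta> \<sigma>) * indicator (cylinder M m 0 f) \<sigma> \<partial>\<Lambda>)"
  proof (cases "\<exists>i\<in>{m..0}. f i = None")
    case True
    then obtain i where "i \<in> {m..0}" "f i = None" by blast
    then have null: "emeasure \<Lambda> (cylinder M m 0 f) = 0"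
      using cylinder_null[OF \<Lambda>(2) shift_invariantD(2)[OF \<Lambda>(1)] m] by blast
    have "emeasure \<Lambda> (cylinder M m 0 f \<inter> word_cylinder M 1 [e]) \<le> emeasure \<Lambda> (cylinder M m 0 f)"
      by (intro emeasure_mono C) auto
    moreover have "AE \<sigma> in \<Lambda>. \<sigma> \<notin> cylinder M m 0 f"
      using null C by (intro AE_not_in) (auto simp: null_sets_def)
    then have "(\<integral>\<^sup>+ \<sigma>. ennreal (\<theta> \<sigma>) * indicator (cylinder M m 0 f) \<sigma> \<partial>\<Lambda>) = (\<integral>\<^sup>+ \<sigma>. 0 \<partial>\<Lambda>)"
      by (intro nn_integral_cong_AE) (auto elim!: eventually_mono)
    ultimately show ?thesis
      using null by simp
  next
    case False
    define u where "u = code_word f m (nat (0 - m + 1))"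
    have len: "int (length u) = 1 - m"
      using m by (simp add: u_def)
    have "the (f (m + int i)) \<in> edges M" if "i < nat (0 - m + 1)" for i
    proof -
      have "m + int i \<in> {m..0}"
        using that by auto
      with False f have "f (m + int i) \<in> symbols M" "f (m + int i) \<noteq> None"
        by (auto dest: Pi_mem)
      then show ?thesis by (auto simp: symbols_def)
    qed
    then have u: "set u \<subseteq> edges M"
      by (auto simp: u_def code_word_def)
    have "cylinder M m 0 f = word_cylinder M m u"
      unfolding u_def by (rule cylinder_eq_word_cylinder[OF m]) (use False in auto)
    then have cyl: "cylinder M m 0 f = word_cylinder M (1 - int (length u)) u"
      by (simp add: len)
    have "word_cylinder M (1 - int (length u)) u \<inter> word_cylinder M 1 [e] =
          word_cylinder M (1 - int (length u)) (u @ [e])"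
      by (auto simp: word_cylinder_def nth_append less_Suc_eq)
    then show ?thesis
      unfolding cyl using eq[OF u] by simp
  qed
qed

text \<open>
  With \<open>\<nu>\<^sub>n = \<mu>\<close>, \<open>limit_integral\<close> gives the joint law of the past word and the coding map, first for
  uniformly continuous test functions and then for all Borel functions.
\<close>
lemma invariant_coding:
  assumes \<mu>: "\<mu> \<in> invariant_measures M"
  shows "markov_path_measure M \<mu> \<in> equilibrium_states M x"
    and "coding_image M x (markov_path_measure M \<mu>) = \<mu>"
proof -
  note \<mu>' = invariantD[OF \<mu>]
  obtain \<Lambda> where \<Lambda>: "\<Lambda> \<in> shift_invariant_measures M" "AE \<sigma> in \<Lambda>. \<forall>i. \<sigma> i \<in> Some ` edges M"
    and law: "\<And>m u. set u \<subseteq> edges M \<Longrightarrow> emeasure \<Lambda> (word_cylinder M m u) = ennreal (word_integral \<mu> (\<lambda>_. 1) u)"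
    using exists_path_measure[OF \<mu>] by blast
  note \<Lambda>' = shift_invariantD[OF \<Lambda>(1)]
  have path: "markov_path_measure M \<mu> = \<Lambda>"
    by (rule markov_path_measure_eq[OF \<mu>'(1,2) \<Lambda>'(1,2) \<Lambda>(2) law])
  interpret prob_space \<mu> by fact
  interpret L: limit_law M x a b \<Lambda> "\<lambda>_. \<mu>" "b / (1 - a)"
  proof
    show "0 \<le> b / (1 - a)"
      using b_nonneg a_less_1 by (intro divide_nonneg_pos) linarith+
    fix u assume u: "set u \<subseteq> edges M"
    interpret P: prob_space \<Lambda> by (rule \<Lambda>'(1))
    have "measure \<Lambda> (word_cylinder M 0 u) = word_integral \<mu> (\<lambda>_. 1) u"
      using law[OF u, of 0] word_integral_bounds(1)[OF \<mu>'(1,2) _ _ u, of "\<lambda>_. 1"]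
      by (simp add: P.emeasure_eq_measure)
    then show "(\<lambda>n. word_integral \<mu> (\<lambda>_. 1) u) \<longlonglongrightarrow> measure \<Lambda> (word_cylinder M 0 u)"
      by simp
  qed (use \<Lambda> \<mu>' invariant_lyap[OF \<mu>] in auto)
  note [measurable_cong] = L.sets_\<Lambda> \<mu>'(2)
  have A [measurable]: "word_cylinder M m u \<in> sets \<Lambda>" for m u
    by (simp add: L.sets_\<Lambda> word_cylinder_sets)
  have Fm [measurable]: "coding_map M x \<in> borel_measurable \<Lambda>"
    by (subst measurable_cong_sets[OF L.sets_\<Lambda> refl]) (rule measurable_coding_map)
  have uc: "(\<integral>\<^sup>+ \<sigma>. ennreal (f (coding_map M x \<sigma>)) * indicator (word_cylinder M (1 - int (length u)) u) \<sigma> \<partial>\<Lambda>) =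
      (\<integral>\<^sup>+ z. ennreal (word_prb M u z) * ennreal (f (word_map M u z)) \<partial>\<mu>)"
    if f: "uniformly_continuous_on UNIV f" "\<And>z. 0 \<le> f z \<and> f z \<le> 1" and u: "set u \<subseteq> edges M" for f u
  proof -
    have cont: "continuous_on UNIV f"
      using f(1) by (rule uniformly_continuous_imp_continuous)
    have fm: "f \<in> borel_measurable borel"
      using cont by (rule borel_measurable_continuous_onI)
    have "cellwise_uniform f"
      unfolding cellwise_uniform_def
    proof (intro conjI allI impI fm)
      fix \<epsilon> :: real assume "0 < \<epsilon>"
      then obtain \<delta> where "0 < \<delta>" "\<And>s t. dist s t < \<delta> \<Longrightarrow> dist (f s) (f t) < \<epsilon>"
        using f(1) unfolding uniformly_continuous_on_def by (metis UNIV_I dist_commute)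
      then show "\<exists>\<delta>>0. \<forall>j\<in>vertices M. \<forall>s\<in>cell M j. \<forall>t\<in>cell M j. dist s t < \<delta> \<longrightarrow> \<bar>f s - f t\<bar> < \<epsilon>"
        unfolding dist_real_def by blast
    qed (use f(2) in auto)
    then have "(\<integral>\<^sup>+ \<sigma>. ennreal ((f \<circ> coding_map M x) \<sigma>) * indicator (word_cylinder M (1 - int (length u)) u) \<sigma> \<partial>\<Lambda>) =
      ennreal (word_integral \<mu> f u)"
    proof (rule L.limit_integral)
      show "(\<lambda>n. word_integral \<mu> f u) \<longlonglongrightarrow> word_integral \<mu> f u" for u
        by simp
      show "f \<circ> coding_map M x \<in> borel_measurable (code_borel M)"
        using measurable_coding_map fm by (rule measurable_comp)
      show "AE \<sigma> in \<Lambda>. (\<lambda>n. f (backward_iterate M x \<sigma> n)) \<longlonglongrightarrow> (f \<circ> coding_map M x) \<sigma>"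
        using L.AE_coding_domain
      proof eventually_elim
        fix \<sigma> assume "\<sigma> \<in> coding_domain M x"
        then have "backward_iterate M x \<sigma> \<longlonglongrightarrow> coding_map M x \<sigma>"
          by (rule coding_domainD(2))
        then show "(\<lambda>n. f (backward_iterate M x \<sigma> n)) \<longlonglongrightarrow> (f \<circ> coding_map M x) \<sigma>"
          using continuous_on_tendsto_compose[OF cont] by simp
      qed
    qed (use u f(2) in \<open>auto intro: invariant_word_integral_Cons[OF \<mu> fm]\<close>)
    then show ?thesis
      using ennreal_word_integral[OF \<mu>'(1,2) fm f(2) u] by simp
  qed
  have joint: "(\<integral>\<^sup>+ \<sigma>. h (coding_map M x \<sigma>) * indicator (word_cylinder M (1 - int (length u)) u) \<sigma> \<partial>\<Lambda>) =
      (\<integral>\<^sup>+ z. ennreal (word_prb M u z) * h (word_map M u z) \<partial>\<mu>)"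
    if h [measurable]: "h \<in> borel_measurable borel" and u: "set u \<subseteq> edges M" for h :: "'k \<Rightarrow> ennreal" and u
  proof -
    let ?A = "word_cylinder M (1 - int (length u)) u"
    note [measurable] = measurable_word_prb[OF u] measurable_word_map[OF u]
    define P where "P = distr (density \<Lambda> (indicator ?A)) borel (coding_map M x)"
    define Q where "Q = distr (density \<mu> (\<lambda>z. ennreal (word_prb M u z))) borel (word_map M u)"
    have P: "(\<integral>\<^sup>+ z. h z \<partial>P) = (\<integral>\<^sup>+ \<sigma>. h (coding_map M x \<sigma>) * indicator ?A \<sigma> \<partial>\<Lambda>)"
      if [measurable]: "h \<in> borel_measurable borel" for h
      unfolding P_def by (subst nn_integral_distr, measurable, subst nn_integral_density, measurable)
        (simp add: mult.commute)
    have Q: "(\<integral>\<^sup>+ z. h z \<partial>Q) = (\<integral>\<^sup>+ z. ennreal (word_prb M u z) * h (word_map M u z) \<partial>\<mu>)"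
      if [measurable]: "h \<in> borel_measurable borel" for h
      unfolding Q_def by (subst nn_integral_distr, measurable, subst nn_integral_density, measurable)
    have "P = Q"
    proof (rule borel_measure_eqI_uniformly_continuous)
      show "finite_measure P"
      proof (rule finite_measureI)
        have "emeasure P (space P) = (\<integral>\<^sup>+ z. 1 \<partial>P)"
          by simp
        also have "\<dots> = emeasure \<Lambda> ?A"
          by (subst P) simp_all
        finally show "emeasure P (space P) \<noteq> \<infinity>"
          by (simp add: L.emeasure_eq_measure)
      qed
      show "finite_measure Q"
      proof (rule finite_measureI)
        have "emeasure Q (space Q) = (\<integral>\<^sup>+ z. 1 \<partial>Q)"
          by simp
        also have "\<dots> = (\<integral>\<^sup>+ z. ennreal (word_prb M u z) \<partial>\<mu>)"
          by (subst Q) simp_all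
        also have "\<dots> \<le> (\<integral>\<^sup>+ z. 1 \<partial>\<mu>)"
          by (rule nn_integral_mono) (use u in \<open>simp add: ennreal_le_1\<close>)
        finally show "emeasure Q (space Q) \<noteq> \<infinity>"
          by (auto simp: emeasure_space_1 top_unique)
      qed
      fix f :: "'k \<Rightarrow> real" assume f: "uniformly_continuous_on UNIV f" "\<And>z. 0 \<le> f z \<and> f z \<le> 1"
      have [measurable]: "f \<in> borel_measurable borel"
        by (intro borel_measurable_continuous_onI uniformly_continuous_imp_continuous f(1))
      show "(\<integral>\<^sup>+ z. ennreal (f z) \<partial>P) = (\<integral>\<^sup>+ z. ennreal (f z) \<partial>Q)"
        by (subst P, measurable, subst Q, measurable, rule uc[OF f u])
    qed (simp_all add: P_def Q_def)
    then show ?thesis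
      using P[OF h] Q[OF h] by simp
  qed
  have "\<Lambda> \<in> equilibrium_states M x"
  proof (rule equilibrium_statesI[OF \<Lambda>(1) L.AE_coding_domain])
    fix e assume e [measurable]: "e \<in> edges M"
    show "past_kernel \<Lambda> e (\<lambda>\<sigma>. prb M e (past_limit \<sigma>))"
    proof (rule past_kernel_from_words[OF \<Lambda> e])
      show "(\<lambda>\<sigma>. prb M e (past_limit \<sigma>)) \<in> borel_measurable (past_algebra M)"
        by (rule measurable_compose[OF measurable_past_limit measurable_prb[OF e]])
      fix u assume u: "set u \<subseteq> edges M"
      let ?A = "word_cylinder M (1 - int (length u)) u"
      have "(\<integral>\<^sup>+ \<sigma>. ennreal (prb M e (past_limit \<sigma>)) * indicator ?A \<sigma> \<partial>\<Lambda>) =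
            (\<integral>\<^sup>+ \<sigma>. ennreal (prb M e (coding_map M x \<sigma>)) * indicator ?A \<sigma> \<partial>\<Lambda>)"
        using L.AE_coding_domain
        by (intro nn_integral_cong_AE) (auto elim!: eventually_mono simp: coding_map_eq_past_limit)
      also have "\<dots> = (\<integral>\<^sup>+ z. ennreal (word_prb M u z) * ennreal (prb M e (word_map M u z)) \<partial>\<mu>)"
        by (rule joint[OF _ u]) measurable
      also have "\<dots> = ennreal (word_integral \<mu> (\<lambda>_. 1) (u @ [e]))"
        using u e by (subst ennreal_word_integral[OF \<mu>'(1,2)]) (simp_all add: word_prb_append ennreal_mult)
      also have "\<dots> = emeasure \<Lambda> (word_cylinder M (1 - int (length u)) (u @ [e]))"
        using u e by (simp add: law)
      finally show "(\<integral>\<^sup>+ \<sigma>. ennreal (prb M e (past_limit \<sigma>)) * indicator ?A \<sigma> \<partial>\<Lambda>) =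
        emeasure \<Lambda> (word_cylinder M (1 - int (length u)) (u @ [e]))" .
    qed
  qed
  then show "markov_path_measure M \<mu> \<in> equilibrium_states M x"
    by (simp add: path)
  have "distr \<Lambda> borel (coding_map M x) = \<mu>"
  proof (rule measure_eqI)
    fix B assume "B \<in> sets (distr \<Lambda> borel (coding_map M x))"
    then have [measurable]: "B \<in> sets borel" by simp
    have "emeasure (distr \<Lambda> borel (coding_map M x)) B = (\<integral>\<^sup>+ \<sigma>. indicator B (coding_map M x \<sigma>) \<partial>\<Lambda>)"
      by (subst nn_integral_indicator[symmetric], simp, subst nn_integral_distr) simp_all
    also have "\<dots> = (\<integral>\<^sup>+ \<sigma>. indicator B (coding_map M x \<sigma>) * indicator (word_cylinder M (1 - int (length ([] :: 'e list))) []) \<sigma> \<partial>\<Lambda>)"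
      by (intro nn_integral_cong) (simp add: word_cylinder_def L.space_\<Lambda>)
    also have "\<dots> = (\<integral>\<^sup>+ z. indicator B z \<partial>\<mu>)"
      by (subst joint) simp_all
    finally show "emeasure (distr \<Lambda> borel (coding_map M x)) B = emeasure \<mu> B"
      by (simp add: \<mu>'(2))
  qed (simp add: \<mu>'(2))
  then show "coding_image M x (markov_path_measure M \<mu>) = \<mu>"
    by (simp add: path coding_image_def)
qed

end

section \<open>From equilibrium states to invariant measures\<close>

locale uniform_markov = contractive_markov M x a b
  for M :: "('k::complete_space, 'e) markov_system" and x a b +
  assumes uniform: "uniformly_continuous_system M"
begin

text \<open>
  The coded point lies in the cell from which the next edge departs, not only in its closure.
\<close>
definition good_codes :: "(int \<Rightarrow> 'e option) set" where
  "good_codes = {\<sigma> \<in> code_space M. cell_index (past_limit \<sigma>) = trg' M (\<sigma> 0)}"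

lemma good_codes_past: "good_codes \<in> sets (past_algebra M)"
proof -
  have [measurable]: "(\<lambda>\<sigma>. trg' M (\<sigma> 0)) \<in> measurable (past_algebra M) (count_space UNIV)"
    by (rule measurable_past_finite[of _ _ 0]) auto
  have "cell_index \<in> measurable borel (count_space UNIV)"
    using measurable_compose[OF measurable_cell_index, of "\<lambda>j. j" "count_space UNIV"] by simp
  then have [measurable]: "(\<lambda>\<sigma>. cell_index (past_limit \<sigma>)) \<in> measurable (past_algebra M) (count_space UNIV)"
    by (rule measurable_compose[OF measurable_past_limit])
  have "{\<sigma> \<in> space (past_algebra M). cell_index (past_limit \<sigma>) = trg' M (\<sigma> 0)} \<in> sets (past_algebra M)"
    by measurable
  then show ?thesis
    by (simp add: good_codes_def)
qed

lemma good_codes_iff: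
  assumes "\<sigma> \<in> coding_domain M x"
  shows "\<sigma> \<in> good_codes \<longleftrightarrow> coding_map M x \<sigma> \<in> cell M (trg M (the (\<sigma> 0)))"
proof -
  note \<sigma> = coding_domainD(1)[OF assms]
  obtain e where "\<sigma> 0 = Some e" "e \<in> edges M"
    using path_spaceD(1)[OF \<sigma>, of 0] by auto
  then show ?thesis
    using path_spaceD(2)[OF \<sigma>] by (simp add: good_codes_def coding_map_eq_past_limit[OF assms] in_cell_iff)
qed

text \<open>
  All backward iterates of \<open>\<sigma>\<close> lie in the cell of the source of \<open>\<sigma> 1\<close>, and for a good code so does
  their limit.  Hence the map of \<open>\<sigma> 1\<close>, which is continuous on that cell, can be interchanged with the
  limit.
\<close>
lemma coding_map_shift:
  assumes \<sigma>: "\<sigma> \<in> coding_domain M x" "\<sigma> \<in> good_codes"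
  shows "code_shift \<sigma> \<in> coding_domain M x" "code_shift \<sigma> \<in> good_codes"
    and "coding_map M x (code_shift \<sigma>) = wmap M (the (\<sigma> 1)) (coding_map M x \<sigma>)"
proof -
  note p = coding_domainD(1)[OF \<sigma>(1)]
  let ?e = "the (\<sigma> 1)"
  have e: "?e \<in> edges M"
    by (rule path_spaceD(4)[OF p])
  have cell_e: "src M ?e = trg M (the (\<sigma> 0))"
    using path_spaceD(3)[OF p, of 0] by simp
  have F: "coding_map M x \<sigma> \<in> cell M (src M ?e)"
    using \<sigma>(2) unfolding good_codes_iff[OF \<sigma>(1)] cell_e .
  have Y: "backward_iterate M x \<sigma> n \<in> cell M (src M ?e)" for n
    using backward_iterate_in_cell[OF p] cell_e by simp
  have "continuous_on (cell M (src M ?e)) (wmap M ?e)"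
    using uniform e unfolding uniformly_continuous_system_def
    by (intro uniformly_continuous_imp_continuous) blast
  from continuous_on_tendsto_compose[OF this coding_domainD(2)[OF \<sigma>(1)] F always_eventually]
  have "(\<lambda>n. wmap M ?e (backward_iterate M x \<sigma> n)) \<longlonglongrightarrow> wmap M ?e (coding_map M x \<sigma>)"
    using Y by blast
  then have "(\<lambda>n. backward_iterate M x (code_shift \<sigma>) (Suc n)) \<longlonglongrightarrow> wmap M ?e (coding_map M x \<sigma>)"
    by (simp add: code_shift_coding_domain(2)[OF p])
  then have lim: "backward_iterate M x (code_shift \<sigma>) \<longlonglongrightarrow> wmap M ?e (coding_map M x \<sigma>)"
    by (simp add: filterlim_sequentially_Suc)
  then show D: "code_shift \<sigma> \<in> coding_domain M x"
    using code_shift_coding_domain(1)[OF p] by (auto simp: coding_domain_def convergent_def)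
  show F': "coding_map M x (code_shift \<sigma>) = wmap M ?e (coding_map M x \<sigma>)"
    using coding_domainD(2)[OF D] lim by (rule LIMSEQ_unique)
  show "code_shift \<sigma> \<in> good_codes"
    using wmap_cell[OF e F] by (simp add: good_codes_iff[OF D] F') (simp add: code_shift_def)
qed

end

text \<open>
  On good codes the conditional probability of the next edge is the probability function at the coded
  point.  For equilibrium states this holds for all codes; for limits of Cesaro averages the
  conditional probabilities are the extensions to the closures, which agree with the original functions on
  the cells only.
\<close>
locale coded_kernel = uniform_markov M x a b
  for M :: "('k::complete_space, 'e) markov_system" and x a b +
  fixes \<Lambda> :: "(int \<Rightarrow> 'e option) measure" and \<theta> :: "'e \<Rightarrow> (int \<Rightarrow> 'e option) \<Rightarrow> real"
  assumes shift_invariant: "\<Lambda> \<in> shift_invariant_measures M"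
    and AE_coding_domain: "AE \<sigma> in \<Lambda>. \<sigma> \<in> coding_domain M x"
    and kernel_measurable: "\<And>e. e \<in> edges M \<Longrightarrow> \<theta> e \<in> borel_measurable (past_algebra M)"
    and kernel: "\<And>e. e \<in> edges M \<Longrightarrow> past_kernel \<Lambda> e (\<theta> e)"
    and kernel_good: "\<And>e. e \<in> edges M \<Longrightarrow> AE \<sigma> in \<Lambda>. \<sigma> \<in> good_codes \<longrightarrow> \<theta> e \<sigma> = prb M e (past_limit \<sigma>)"
begin

sublocale prob_space \<Lambda>
  by (rule shift_invariantD(1)[OF shift_invariant])

lemmas sets_\<Lambda> [measurable_cong] = shift_invariantD(2)[OF shift_invariant]
lemmas space_\<Lambda> = shift_invariantD(3)[OF shift_invariant]

lemma past_sets_\<Lambda>: "A \<in> sets (past_algebra M) \<Longrightarrow> A \<in> sets \<Lambda>"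
  using past_subset by (simp add: sets_\<Lambda>)

lemma coding_measurable [measurable]: "coding_map M x \<in> borel_measurable \<Lambda>"
  by (subst measurable_cong_sets[OF sets_\<Lambda> refl]) (rule measurable_coding_map)

lemma shift_measurable [measurable]: "code_shift \<in> measurable \<Lambda> \<Lambda>"
  by (subst measurable_cong_sets[OF sets_\<Lambda> sets_\<Lambda>]) (rule measurable_code_shift)

lemma shift_nn_integral:
  assumes "f \<in> borel_measurable \<Lambda>"
  shows "(\<integral>\<^sup>+ \<sigma>. f (code_shift \<sigma>) \<partial>\<Lambda>) = (\<integral>\<^sup>+ \<sigma>. f \<sigma> \<partial>\<Lambda>)"
  using assms by (intro shift_invariant_nn_integral[OF shift_invariant]) (simp cong: measurable_cong_sets add: sets_\<Lambda>)

lemma good_codes_\<Lambda> [measurable]: "good_codes \<in> sets \<Lambda>"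
  by (rule past_sets_\<Lambda>[OF good_codes_past])

lemma word_cylinder_\<Lambda> [measurable]: "word_cylinder M m u \<in> sets \<Lambda>"
  by (simp add: sets_\<Lambda> word_cylinder_sets)

text \<open>
  One step of the process seen through the coding map is a step of the Markov system.
\<close>
lemma kernel_step:
  assumes A: "A \<in> sets (past_algebra M)" "A \<subseteq> good_codes" and e: "e \<in> edges M"
    and h: "h \<in> borel_measurable borel"
  shows "(\<integral>\<^sup>+ \<sigma>. h (coding_map M x (code_shift \<sigma>)) * indicator A \<sigma> * indicator (word_cylinder M 1 [e]) \<sigma> \<partial>\<Lambda>) =
    (\<integral>\<^sup>+ \<sigma>. ennreal (prb M e (coding_map M x \<sigma>)) * h (wmap M e (coding_map M x \<sigma>)) * indicator A \<sigma> \<partial>\<Lambda>)"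
proof -
  let ?f = "\<lambda>\<sigma>. h (wmap M e (past_limit \<sigma>)) * indicator A \<sigma> :: ennreal"
  have f: "?f \<in> borel_measurable (past_algebra M)"
  proof -
    have "(\<lambda>\<sigma>. h (wmap M e (past_limit \<sigma>))) \<in> borel_measurable (past_algebra M)"
      by (rule measurable_compose[OF measurable_past_limit measurable_compose[OF measurable_wmap[OF e] h]])
    with A(1) show ?thesis
      by measurable
  qed
  have "(\<integral>\<^sup>+ \<sigma>. h (coding_map M x (code_shift \<sigma>)) * indicator A \<sigma> * indicator (word_cylinder M 1 [e]) \<sigma> \<partial>\<Lambda>) =
        (\<integral>\<^sup>+ \<sigma>. ?f \<sigma> * indicator (word_cylinder M 1 [e]) \<sigma> \<partial>\<Lambda>)"
  proof (rule nn_integral_cong_AE)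
    show "AE \<sigma> in \<Lambda>. h (coding_map M x (code_shift \<sigma>)) * indicator A \<sigma> * indicator (word_cylinder M 1 [e]) \<sigma> =
        ?f \<sigma> * indicator (word_cylinder M 1 [e]) \<sigma>"
      using AE_coding_domain
    proof eventually_elim
      fix \<sigma> assume D: "\<sigma> \<in> coding_domain M x"
      show "h (coding_map M x (code_shift \<sigma>)) * indicator A \<sigma> * indicator (word_cylinder M 1 [e]) \<sigma> =
        ?f \<sigma> * indicator (word_cylinder M 1 [e]) \<sigma>"
      proof (cases "\<sigma> \<in> A \<and> \<sigma> \<in> word_cylinder M 1 [e]")
        case True
        then have "\<sigma> \<in> good_codes" "\<sigma> 1 = Some e"
          using A(2) by (auto simp: word_cylinder_def)
        then show ?thesis
          using coding_map_shift(3)[OF D] by (simp add: coding_map_eq_past_limit[OF D])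
      qed auto
    qed
  qed
  also have "\<dots> = (\<integral>\<^sup>+ \<sigma>. ?f \<sigma> * ennreal (\<theta> e \<sigma>) \<partial>\<Lambda>)"
    by (rule past_kernel_nn_integral[OF prob_space_axioms sets_\<Lambda> kernel_measurable[OF e] kernel[OF e] f])
  also have "\<dots> = (\<integral>\<^sup>+ \<sigma>. ennreal (prb M e (coding_map M x \<sigma>)) * h (wmap M e (coding_map M x \<sigma>)) * indicator A \<sigma> \<partial>\<Lambda>)"
  proof (rule nn_integral_cong_AE)
    show "AE \<sigma> in \<Lambda>. ?f \<sigma> * ennreal (\<theta> e \<sigma>) =
        ennreal (prb M e (coding_map M x \<sigma>)) * h (wmap M e (coding_map M x \<sigma>)) * indicator A \<sigma>"
      using AE_coding_domain kernel_good[OF e]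
    proof eventually_elim
      fix \<sigma> assume D: "\<sigma> \<in> coding_domain M x" and "\<sigma> \<in> good_codes \<longrightarrow> \<theta> e \<sigma> = prb M e (past_limit \<sigma>)"
      then have "\<sigma> \<in> A \<Longrightarrow> \<theta> e \<sigma> = prb M e (coding_map M x \<sigma>)"
        using A(2) by (auto simp: coding_map_eq_past_limit[OF D])
      then show "?f \<sigma> * ennreal (\<theta> e \<sigma>) =
        ennreal (prb M e (coding_map M x \<sigma>)) * h (wmap M e (coding_map M x \<sigma>)) * indicator A \<sigma>"
        by (cases "\<sigma> \<in> A") (simp_all add: coding_map_eq_past_limit[OF D] mult_ac)
    qed
  qed
  finally show ?thesis .
qed

text \<open>
  Good codes are mapped to good codes, and a set that is contained in its preimage under a measure
  preserving map differs from it by a null set only.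
\<close>
lemma AE_good_codes_shift: "AE \<sigma> in \<Lambda>. code_shift \<sigma> \<in> good_codes \<longleftrightarrow> \<sigma> \<in> good_codes"
proof -
  let ?f = "\<lambda>\<sigma>. indicator good_codes \<sigma> :: ennreal"
  let ?g = "\<lambda>\<sigma>. indicator good_codes (code_shift \<sigma>) :: ennreal"
  have g: "?g \<in> borel_measurable \<Lambda>"
    by (rule measurable_compose[OF shift_measurable]) simp
  have le: "AE \<sigma> in \<Lambda>. ?f \<sigma> \<le> ?g \<sigma>"
    using AE_coding_domain by eventually_elim (auto simp: indicator_def coding_map_shift(2))
  have int: "(\<integral>\<^sup>+ \<sigma>. ?g \<sigma> \<partial>\<Lambda>) = (\<integral>\<^sup>+ \<sigma>. ?f \<sigma> \<partial>\<Lambda>)"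
    by (rule shift_nn_integral) simp
  have fin: "(\<integral>\<^sup>+ \<sigma>. ?f \<sigma> \<partial>\<Lambda>) \<noteq> \<infinity>"
    by (simp add: emeasure_eq_measure)
  have "(\<integral>\<^sup>+ \<sigma>. ?g \<sigma> - ?f \<sigma> \<partial>\<Lambda>) = (\<integral>\<^sup>+ \<sigma>. ?g \<sigma> \<partial>\<Lambda>) - (\<integral>\<^sup>+ \<sigma>. ?f \<sigma> \<partial>\<Lambda>)"
    by (rule nn_integral_diff[OF g _ fin le]) simp
  also have "\<dots> = 0"
    unfolding int by simp
  finally have "AE \<sigma> in \<Lambda>. ?g \<sigma> - ?f \<sigma> = 0"
    using g by (subst (asm) nn_integral_0_iff_AE) auto
  with le show ?thesis
  proof eventually_elim
    fix \<sigma> assume "?f \<sigma> \<le> ?g \<sigma>" "?g \<sigma> - ?f \<sigma> = 0"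
    then show "code_shift \<sigma> \<in> good_codes \<longleftrightarrow> \<sigma> \<in> good_codes"
      by (cases "\<sigma> \<in> good_codes"; cases "code_shift \<sigma> \<in> good_codes") simp_all
  qed
qed

text \<open>
  Summing \<open>kernel_step\<close> over the edges turns the Markov operator into the shift, which preserves the
  measure and the set of good codes.
\<close>
lemma nn_integral_good_codes:
  assumes h [measurable]: "h \<in> borel_measurable borel"
  shows "(\<integral>\<^sup>+ \<sigma>. markov_op M h (coding_map M x \<sigma>) * indicator good_codes \<sigma> \<partial>\<Lambda>) =
    (\<integral>\<^sup>+ \<sigma>. h (coding_map M x \<sigma>) * indicator good_codes \<sigma> \<partial>\<Lambda>)"
proof -
  let ?F = "coding_map M x"
  have "(\<integral>\<^sup>+ \<sigma>. markov_op M h (?F \<sigma>) * indicator good_codes \<sigma> \<partial>\<Lambda>) =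
    (\<integral>\<^sup>+ \<sigma>. \<integral>\<^sup>+ e. ennreal (prb M e (?F \<sigma>)) * h (wmap M e (?F \<sigma>)) * indicator good_codes \<sigma> \<partial>count_space (edges M) \<partial>\<Lambda>)"
    unfolding markov_op_def by (intro nn_integral_cong) (simp add: nn_integral_multc)
  also have "\<dots> = (\<integral>\<^sup>+ e. \<integral>\<^sup>+ \<sigma>. ennreal (prb M e (?F \<sigma>)) * h (wmap M e (?F \<sigma>)) * indicator good_codes \<sigma> \<partial>\<Lambda> \<partial>count_space (edges M))"
  proof (rule nn_integral_count_space_nn_integral[OF countable_edges])
    fix e assume [measurable]: "e \<in> edges M"
    show "(\<lambda>\<sigma>. ennreal (prb M e (?F \<sigma>)) * h (wmap M e (?F \<sigma>)) * indicator good_codes \<sigma>) \<in> borel_measurable \<Lambda>"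
      by measurable
  qed
  also have "\<dots> = (\<integral>\<^sup>+ e. \<integral>\<^sup>+ \<sigma>. h (?F (code_shift \<sigma>)) * indicator good_codes \<sigma> * indicator (word_cylinder M 1 [e]) \<sigma> \<partial>\<Lambda> \<partial>count_space (edges M))"
    by (intro nn_integral_cong kernel_step[symmetric] good_codes_past h) auto
  also have "\<dots> = (\<integral>\<^sup>+ \<sigma>. \<integral>\<^sup>+ e. h (?F (code_shift \<sigma>)) * indicator good_codes \<sigma> * indicator (word_cylinder M 1 [e]) \<sigma> \<partial>count_space (edges M) \<partial>\<Lambda>)"
    by (rule nn_integral_count_space_nn_integral[symmetric, OF countable_edges]) measurable
  also have "\<dots> = (\<integral>\<^sup>+ \<sigma>. h (?F (code_shift \<sigma>)) * indicator good_codes (code_shift \<sigma>) \<partial>\<Lambda>)"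
  proof (rule nn_integral_cong_AE)
    show "AE \<sigma> in \<Lambda>. (\<integral>\<^sup>+ e. h (?F (code_shift \<sigma>)) * indicator good_codes \<sigma> * indicator (word_cylinder M 1 [e]) \<sigma> \<partial>count_space (edges M)) =
        h (?F (code_shift \<sigma>)) * indicator good_codes (code_shift \<sigma>)"
      using AE_coding_domain AE_good_codes_shift
    proof eventually_elim
      fix \<sigma> assume D: "\<sigma> \<in> coding_domain M x" and g: "code_shift \<sigma> \<in> good_codes \<longleftrightarrow> \<sigma> \<in> good_codes"
      note p = coding_domainD(1)[OF D]
      obtain d where d: "\<sigma> 1 = Some d" "d \<in> edges M"
        using path_spaceD(1)[OF p, of 1] by auto
      have "(\<integral>\<^sup>+ e. h (?F (code_shift \<sigma>)) * indicator good_codes \<sigma> * indicator (word_cylinder M 1 [e]) \<sigma> \<partial>count_space (edges M)) =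
        (\<integral>\<^sup>+ e. h (?F (code_shift \<sigma>)) * indicator good_codes \<sigma> * indicator {d} e \<partial>count_space (edges M))"
        using d path_spaceD(2)[OF p] by (intro nn_integral_cong) (auto simp: word_cylinder_def indicator_def)
      also have "\<dots> = h (?F (code_shift \<sigma>)) * indicator good_codes (code_shift \<sigma>)"
        using d g by (subst nn_integral_indicator_singleton) (simp_all add: indicator_def)
      finally show "(\<integral>\<^sup>+ e. h (?F (code_shift \<sigma>)) * indicator good_codes \<sigma> * indicator (word_cylinder M 1 [e]) \<sigma> \<partial>count_space (edges M)) =
        h (?F (code_shift \<sigma>)) * indicator good_codes (code_shift \<sigma>)" .
    qed
  qed
  also have "\<dots> = (\<integral>\<^sup>+ \<sigma>. h (?F \<sigma>) * indicator good_codes \<sigma> \<partial>\<Lambda>)"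
    by (rule shift_nn_integral[where f = "\<lambda>\<sigma>. h (?F \<sigma>) * indicator good_codes \<sigma>"]) measurable
  finally show ?thesis .
qed

lemma good_codes_invariant_measure:
  assumes pos: "emeasure \<Lambda> good_codes \<noteq> 0"
  shows "distr (uniform_measure \<Lambda> good_codes) borel (coding_map M x) \<in> invariant_measures M"
proof -
  let ?U = "uniform_measure \<Lambda> good_codes"
  let ?\<mu> = "distr ?U borel (coding_map M x)"
  have m: "coding_map M x \<in> borel_measurable ?U"
    by simp
  have prob: "prob_space ?\<mu>"
    using pos by (intro prob_space.prob_space_distr[OF prob_space_uniform_measure m]) (auto simp: emeasure_eq_measure)
  have int: "(\<integral>\<^sup>+ z. h z \<partial>?\<mu>) = (\<integral>\<^sup>+ \<sigma>. h (coding_map M x \<sigma>) * indicator good_codes \<sigma> \<partial>\<Lambda>) / emeasure \<Lambda> good_codes"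
    if [measurable]: "h \<in> borel_measurable borel" for h
    by (subst nn_integral_distr[OF m], simp, subst nn_integral_uniform_measure) simp_all
  have "adjoint_op M ?\<mu> = ?\<mu>"
  proof (rule measure_eqI)
    fix B assume "B \<in> sets (adjoint_op M ?\<mu>)"
    then have B [measurable]: "B \<in> sets borel" by simp
    have "emeasure (adjoint_op M ?\<mu>) B = (\<integral>\<^sup>+ z. markov_op M (indicator B) z \<partial>?\<mu>)"
      by (rule emeasure_adjoint_op[OF countable_markov_system _ B]) simp
    also have "\<dots> = (\<integral>\<^sup>+ z. indicator B z \<partial>?\<mu>)"
      by (simp only: int[OF measurable_markov_op[OF countable_markov_system borel_measurable_indicator[OF B]]]
          int[OF borel_measurable_indicator[OF B]] nn_integral_good_codes[OF borel_measurable_indicator[OF B]])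
    finally show "emeasure (adjoint_op M ?\<mu>) B = emeasure ?\<mu> B"
      by simp
  qed simp
  with prob show ?thesis
    by (simp add: invariant_measures_def)
qed

end

context uniform_markov
begin

text \<open>
  An equilibrium state gives the edge \<open>e\<close> probability zero when the coded point is outside of the cell
  of its source; hence almost every code is good.  The word probabilities follow by adding edges at the end
  of a word and shifting back.
\<close>
lemma equilibrium_coding:
  assumes \<Lambda>: "\<Lambda> \<in> equilibrium_states M x"
  shows "coding_image M x \<Lambda> \<in> invariant_measures M"
    and "markov_path_measure M (coding_image M x \<Lambda>) = \<Lambda>"
proof -
  note eq = equilibrium_statesD[OF \<Lambda>]
  interpret K: coded_kernel M x a b \<Lambda> "\<lambda>e \<sigma>. prb M e (past_limit \<sigma>)"
  proof
    show "(\<lambda>\<sigma>. prb M e (past_limit \<sigma>)) \<in> borel_measurable (past_algebra M)" if "e \<in> edges M" for e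
      by (rule measurable_compose[OF measurable_past_limit measurable_prb[OF that]])
  qed (use eq in auto)
  have edges: "AE \<sigma> in \<Lambda>. \<forall>i. \<sigma> i \<in> Some ` edges M"
    using eq(2) by eventually_elim (use coding_domainD(1) path_spaceD(1) in blast)
  let ?F = "coding_map M x"
  \<comment> \<open>the event that \<open>e\<close> follows while the coded point is outside of the cell of its source has probability zero\<close>
  have good: "AE \<sigma> in \<Lambda>. \<sigma> \<in> good_codes"
  proof -
    have "AE \<sigma> in \<Lambda>. \<sigma> 1 = Some e \<longrightarrow> past_limit \<sigma> \<in> cell M (src M e)" if e: "e \<in> edges M" for e
    proof -
      let ?f = "\<lambda>\<sigma>. indicator (- cell M (src M e)) (past_limit \<sigma>) :: ennreal"
      have c: "indicator (- cell M (src M e)) \<in> borel_measurable (borel :: 'k measure)"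
        using cell_borel[OF src_in[OF e]] by measurable
      have f: "?f \<in> borel_measurable (past_algebra M)"
        by (rule measurable_compose[OF measurable_past_limit c])
      have f\<Lambda>: "?f \<in> borel_measurable \<Lambda>"
        using measurable_past_code[OF f] by (subst measurable_cong_sets[OF K.sets_\<Lambda> refl])
      have "(\<integral>\<^sup>+ \<sigma>. ?f \<sigma> * indicator (word_cylinder M 1 [e]) \<sigma> \<partial>\<Lambda>) = (\<integral>\<^sup>+ \<sigma>. ?f \<sigma> * ennreal (prb M e (past_limit \<sigma>)) \<partial>\<Lambda>)"
        by (rule past_kernel_nn_integral[OF K.prob_space_axioms K.sets_\<Lambda> K.kernel_measurable[OF e] K.kernel[OF e] f])
      also have "\<dots> = (\<integral>\<^sup>+ \<sigma>. 0 \<partial>\<Lambda>)"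
      proof (rule nn_integral_cong)
        fix \<sigma>
        show "?f \<sigma> * ennreal (prb M e (past_limit \<sigma>)) = 0"
          using prb_outside[OF e] by (cases "past_limit \<sigma> \<in> cell M (src M e)") simp_all
      qed
      finally have "(\<integral>\<^sup>+ \<sigma>. ?f \<sigma> * indicator (word_cylinder M 1 [e]) \<sigma> \<partial>\<Lambda>) = 0"
        by simp
      then have "AE \<sigma> in \<Lambda>. ?f \<sigma> * indicator (word_cylinder M 1 [e]) \<sigma> = 0"
        using f\<Lambda> by (subst (asm) nn_integral_0_iff_AE) auto
      moreover have "AE \<sigma> in \<Lambda>. \<sigma> \<in> code_space M"
        unfolding K.space_\<Lambda>[symmetric] by (rule AE_space)
      ultimately show ?thesis
        by eventually_elim (auto simp: word_cylinder_def indicator_def split: if_splits)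
    qed
    then have "AE \<sigma> in \<Lambda>. \<forall>e\<in>edges M. \<sigma> 1 = Some e \<longrightarrow> past_limit \<sigma> \<in> cell M (src M e)"
      by (simp add: AE_ball_countable countable_edges)
    with eq(2) show ?thesis
    proof eventually_elim
      fix \<sigma> assume D: "\<sigma> \<in> coding_domain M x"
        and c: "\<forall>e\<in>edges M. \<sigma> 1 = Some e \<longrightarrow> past_limit \<sigma> \<in> cell M (src M e)"
      note p = coding_domainD(1)[OF D]
      obtain d where d: "\<sigma> 1 = Some d" "d \<in> edges M"
        using path_spaceD(1)[OF p, of 1] by auto
      then show "\<sigma> \<in> good_codes"
        using c path_spaceD(3)[OF p, of 0] by (simp add: good_codes_iff[OF D] coding_map_eq_past_limit[OF D])
    qed
  qed
  have one: "emeasure \<Lambda> good_codes = 1"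
    using good K.good_codes_\<Lambda> by (simp add: K.emeasure_eq_measure K.prob_eq_1)
  have image: "distr (uniform_measure \<Lambda> good_codes) borel ?F = coding_image M x \<Lambda>"
  proof (rule measure_eqI)
    fix B assume "B \<in> sets (distr (uniform_measure \<Lambda> good_codes) borel ?F)"
    then have B [measurable]: "B \<in> sets borel" by simp
    have "emeasure (distr (uniform_measure \<Lambda> good_codes) borel ?F) B =
        emeasure \<Lambda> (good_codes \<inter> (?F -` B \<inter> space \<Lambda>)) / emeasure \<Lambda> good_codes"
      by (subst emeasure_distr) (simp_all add: emeasure_uniform_measure)
    also have "emeasure \<Lambda> (good_codes \<inter> (?F -` B \<inter> space \<Lambda>)) = emeasure \<Lambda> (?F -` B \<inter> space \<Lambda>)"
    proof (rule emeasure_eq_AE)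
      show "AE \<sigma> in \<Lambda>. \<sigma> \<in> good_codes \<inter> (?F -` B \<inter> space \<Lambda>) \<longleftrightarrow> \<sigma> \<in> ?F -` B \<inter> space \<Lambda>"
        using good by eventually_elim simp
    qed measurable
    also have "\<dots> / emeasure \<Lambda> good_codes = \<dots>"
      by (simp add: one divide_ennreal_def)
    finally show "emeasure (distr (uniform_measure \<Lambda> good_codes) borel ?F) B = emeasure (coding_image M x \<Lambda>) B"
      unfolding coding_image_def by (simp add: emeasure_distr)
  qed (simp add: coding_image_def)
  show inv: "coding_image M x \<Lambda> \<in> invariant_measures M"
    using K.good_codes_invariant_measure one by (simp add: image)
  note \<mu> = invariantD(1,2)[OF inv]
  have joint: "(\<integral>\<^sup>+ \<sigma>. h (?F \<sigma>) * indicator (word_cylinder M (1 - int (length u)) u) \<sigma> \<partial>\<Lambda>) =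
      (\<integral>\<^sup>+ z. ennreal (word_prb M u z) * h (word_map M u z) \<partial>coding_image M x \<Lambda>)"
    if "h \<in> borel_measurable borel" "set u \<subseteq> edges M" for h u
    using that
  proof (induction u arbitrary: h rule: rev_induct)
    case Nil
    then show ?case
      unfolding coding_image_def
      by (subst nn_integral_distr) (auto simp: word_cylinder_def K.space_\<Lambda> intro!: nn_integral_cong)
  next
    case (snoc e u)
    then have e [measurable]: "e \<in> edges M" and u: "set u \<subseteq> edges M" and h [measurable]: "h \<in> borel_measurable borel"
      by auto
    let ?A = "word_cylinder M (1 - int (length u)) u"
    let ?B = "word_cylinder M (- int (length u)) (u @ [e])"
    \<comment> \<open>the cylinder is written so that it ends at the coordinate 0 and belongs to the past\<close>
    have A_past: "?A \<in> sets (past_algebra M)"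
    proof -
      have "Measurable.pred (past_algebra M) (\<lambda>\<sigma>. \<forall>i<length u. \<sigma> (1 - int (length u) + int i) = Some (u ! i))"
      proof (rule measurable_past_finite[of _ _ "length u"])
        fix \<sigma> \<tau> :: "int \<Rightarrow> 'e option"
        assume *: "\<And>i. - int (length u) \<le> i \<Longrightarrow> i \<le> 0 \<Longrightarrow> \<sigma> i = \<tau> i"
        have "\<sigma> (1 - int (length u) + int i) = \<tau> (1 - int (length u) + int i)" if "i < length u" for i
          using that by (intro *) linarith+
        then show "(\<forall>i<length u. \<sigma> (1 - int (length u) + int i) = Some (u ! i)) =
          (\<forall>i<length u. \<tau> (1 - int (length u) + int i) = Some (u ! i))"
          by simp
      qed simp
      from predE[OF this] show ?thesis
        unfolding word_cylinder_def space_past .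
    qed
    have shift_B: "indicator ?B (code_shift \<sigma>) = (indicator ?A \<sigma> * indicator (word_cylinder M 1 [e]) \<sigma> :: ennreal)"
      if "\<sigma> \<in> code_space M" for \<sigma>
    proof -
      have "code_shift \<sigma> \<in> ?B \<longleftrightarrow> \<sigma> \<in> word_cylinder M (- int (length u) + 1) (u @ [e])"
        using code_shift_word_cylinder[of "- int (length u)" "u @ [e]"] that by blast
      also have "\<dots> \<longleftrightarrow> \<sigma> \<in> ?A \<and> \<sigma> \<in> word_cylinder M 1 [e]"
        by (auto simp: word_cylinder_def nth_append less_Suc_eq)
      finally show ?thesis
        by (simp add: indicator_def)
    qed
    have "(\<integral>\<^sup>+ \<sigma>. h (?F \<sigma>) * indicator ?B \<sigma> \<partial>\<Lambda>) = (\<integral>\<^sup>+ \<sigma>. h (?F (code_shift \<sigma>)) * indicator ?B (code_shift \<sigma>) \<partial>\<Lambda>)"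
      by (rule K.shift_nn_integral[where f = "\<lambda>\<sigma>. h (?F \<sigma>) * indicator ?B \<sigma>", symmetric]) measurable
    also have "\<dots> = (\<integral>\<^sup>+ \<sigma>. h (?F (code_shift \<sigma>)) * indicator (?A \<inter> good_codes) \<sigma> * indicator (word_cylinder M 1 [e]) \<sigma> \<partial>\<Lambda>)"
    proof (rule nn_integral_cong_AE)
      show "AE \<sigma> in \<Lambda>. h (?F (code_shift \<sigma>)) * indicator ?B (code_shift \<sigma>) =
        h (?F (code_shift \<sigma>)) * indicator (?A \<inter> good_codes) \<sigma> * indicator (word_cylinder M 1 [e]) \<sigma>"
        using good
      proof eventually_elim
        fix \<sigma> assume \<sigma>: "\<sigma> \<in> good_codes"
        then have "\<sigma> \<in> code_space M" by (simp add: good_codes_def)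
        with \<sigma> show "h (?F (code_shift \<sigma>)) * indicator ?B (code_shift \<sigma>) =
          h (?F (code_shift \<sigma>)) * indicator (?A \<inter> good_codes) \<sigma> * indicator (word_cylinder M 1 [e]) \<sigma>"
          by (simp add: shift_B indicator_inter_arith mult.assoc)
      qed
    qed
    also have "\<dots> = (\<integral>\<^sup>+ \<sigma>. ennreal (prb M e (?F \<sigma>)) * h (wmap M e (?F \<sigma>)) * indicator (?A \<inter> good_codes) \<sigma> \<partial>\<Lambda>)"
      by (rule K.kernel_step[OF sets.Int[OF A_past good_codes_past] _ e h]) blast
    also have "\<dots> = (\<integral>\<^sup>+ \<sigma>. ennreal (prb M e (?F \<sigma>)) * h (wmap M e (?F \<sigma>)) * indicator ?A \<sigma> \<partial>\<Lambda>)"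
      using good by (intro nn_integral_cong_AE) (auto elim!: eventually_mono simp: indicator_def)
    also have "\<dots> = (\<integral>\<^sup>+ z. ennreal (word_prb M u z) * (ennreal (prb M e (word_map M u z)) * h (wmap M e (word_map M u z))) \<partial>coding_image M x \<Lambda>)"
      by (rule snoc.IH[OF _ u, of "\<lambda>z. ennreal (prb M e z) * h (wmap M e z)"]) measurable
    also have "\<dots> = (\<integral>\<^sup>+ z. ennreal (word_prb M (u @ [e]) z) * h (word_map M (u @ [e]) z) \<partial>coding_image M x \<Lambda>)"
      using u e by (simp add: word_prb_append word_map_append ennreal_mult mult.assoc)
    finally show ?case
      by simp
  qed
  show "markov_path_measure M (coding_image M x \<Lambda>) = \<Lambda>"
  proof (rule markov_path_measure_eq[OF \<mu> K.prob_space_axioms K.sets_\<Lambda> edges])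
    fix m u assume u: "set u \<subseteq> edges M"
    have "emeasure \<Lambda> (word_cylinder M m u) = emeasure \<Lambda> (word_cylinder M (1 - int (length u)) u)"
      by (rule shift_invariant_word_cylinder[OF eq(1)])
    also have "\<dots> = (\<integral>\<^sup>+ z. ennreal (word_prb M u z) \<partial>coding_image M x \<Lambda>)"
      using joint[of "\<lambda>_. 1" u] u by simp
    also have "\<dots> = ennreal (word_integral (coding_image M x \<Lambda>) (\<lambda>_. 1) u)"
      by (subst ennreal_word_integral[OF \<mu> _ _ u]) simp_all
    finally show "emeasure \<Lambda> (word_cylinder M m u) = ennreal (word_integral (coding_image M x \<Lambda>) (\<lambda>_. 1) u)" .
  qed
qed

end

section \<open>Tightness along an orbit of an invariant measure\<close>

context markov
begin

abbreviation occupation :: "'k set \<Rightarrow> nat \<Rightarrow> 'k \<Rightarrow> ennreal" where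
  "occupation B n z \<equiv> (\<Sum>k=1..n. (markov_op M ^^ k) (indicator B) z)"

lemma markov_op_sum:
  "finite K \<Longrightarrow> markov_op M (\<lambda>z. \<Sum>k\<in>K. f k z) z = (\<Sum>k\<in>K. markov_op M (f k) z)"
  by (induction K rule: finite_induct) (simp_all add: markov_op_add)

lemma occupation_Suc:
  "occupation B (Suc n) z = markov_op M (indicator B) z + markov_op M (occupation B n) z"
proof -
  have "(\<Sum>k=1..Suc n. (markov_op M ^^ k) (indicator B) z) =
        markov_op M (indicator B) z + (\<Sum>k=2..Suc n. (markov_op M ^^ k) (indicator B) z)"
    by (subst sum.atLeast_Suc_atMost) (simp_all add: numeral_2_eq_2)
  also have "(\<Sum>k=2..Suc n. (markov_op M ^^ k) (indicator B) z) =
             (\<Sum>k=1..n. (markov_op M ^^ Suc k) (indicator B) z)"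
    by (rule sum.reindex_bij_witness[of _ Suc "\<lambda>k. k - 1"]) auto
  also have "\<dots> = markov_op M (occupation B n) z"
    by (simp add: markov_op_sum)
  finally show ?thesis .
qed

lemma markov_op_pow_indicator_le_1: "(markov_op M ^^ k) (indicator B) z \<le> 1"
proof (induction k arbitrary: z)
  case (Suc k)
  have "markov_op M ((markov_op M ^^ k) (indicator B)) z \<le> markov_op M (\<lambda>_. 1) z"
    by (intro markov_op_mono Suc)
  then show ?case by simp
qed (simp add: indicator_def)

lemma occupation_le: "occupation B n z \<le> of_nat n"
  using sum_mono[of "{1..n}" "\<lambda>k. (markov_op M ^^ k) (indicator B) z" "\<lambda>_. 1"]
  by (simp add: markov_op_pow_indicator_le_1)

lemma measurable_occupation: "B \<in> sets borel \<Longrightarrow> occupation B n \<in> borel_measurable borel"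
  by (intro borel_measurable_sum measurable_markov_op_pow) simp

text \<open>
  Let \<open>P N\<close> be the maximum over \<open>n \<le> N\<close> of the excess of the \<open>n\<close>-th occupation sum over \<open>n c\<close>.
  Where it is positive it is attained at some \<open>n = m + 1\<close>, and splitting off the first step bounds it
  by \<open>U 1\<^sub>B + U (P N) - c\<close>.  Invariance cancels the integrals of \<open>P N\<close> and \<open>U (P N)\<close>; this is Garsia's
  proof of the maximal ergodic theorem.
\<close>
lemma maximal_inequality:
  assumes \<mu>: "\<mu> \<in> invariant_measures M" and B [measurable]: "B \<in> sets borel" and c: "0 < c"
  shows "ennreal c * emeasure \<mu> {z. \<exists>n. of_nat n * ennreal c < occupation B n z} \<le> emeasure \<mu> B"
proof -
  interpret prob_space \<mu>
    using \<mu> by (simp add: invariant_measures_def)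
  have sets_\<mu> [measurable_cong]: "sets \<mu> = sets borel"
    using \<mu> by (simp add: invariant_measures_def)
  have sp: "space \<mu> = UNIV"
    using sets_eq_imp_space_eq[OF sets_\<mu>] by simp
  note [measurable] = measurable_occupation[OF B]
  define P where "P N z = Max ((\<lambda>n. occupation B n z - of_nat n * ennreal c) ` {..N})" for N z
  have P_ge: "occupation B n z - of_nat n * ennreal c \<le> P N z" if "n \<le> N" for n N z
    unfolding P_def using that by (intro Max_ge) auto
  have P_meas [measurable]: "P N \<in> borel_measurable borel" for N
    unfolding P_def by (rule borel_measurable_Max) measurable
  have P_le: "P N z \<le> of_nat N" for N z
  proof -
    have "occupation B n z - of_nat n * ennreal c \<le> of_nat N" if "n \<le> N" for n
    proof -
      have "occupation B n z - of_nat n * ennreal c \<le> occupation B n z"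
        by (rule diff_le_self_ennreal)
      also have "\<dots> \<le> of_nat n"
        by (rule occupation_le)
      also have "\<dots> \<le> of_nat N"
        using that by simp
      finally show ?thesis .
    qed
    then show ?thesis
      unfolding P_def by (subst Max_le_iff) auto
  qed
  \<comment> \<open>where \<open>P N\<close> vanishes this is trivial, so it holds everywhere and can be integrated\<close>
  have step: "P N z + ennreal c * indicator {z. 0 < P N z} z \<le> markov_op M (indicator B) z + markov_op M (P N) z" for N z
  proof (cases "P N z = 0")
    case False
    have "P N z \<in> (\<lambda>n. occupation B n z - of_nat n * ennreal c) ` {..N}"
      unfolding P_def by (rule Max_in) auto
    then obtain n where n: "n \<le> N" "P N z = occupation B n z - of_nat n * ennreal c"
      by auto
    obtain m where m: "n = Suc m"
      using n(2) False by (cases n) auto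
    have fin: "of_nat n * ennreal c \<noteq> \<infinity>"
      by (simp add: ennreal_mult_eq_top_iff)
    have "of_nat n * ennreal c \<le> occupation B n z"
    proof (rule ccontr)
      assume "\<not> of_nat n * ennreal c \<le> occupation B n z"
      then have "occupation B n z \<le> of_nat n * ennreal c"
        by (simp only: not_le less_imp_le)
      then have "occupation B n z - of_nat n * ennreal c = 0"
        by (rule diff_eq_0_ennreal[OF le_less_trans[OF occupation_le of_nat_less_top]])
      with n(2) False show False
        by (simp only:)
    qed
    then have eq: "occupation B n z = P N z + of_nat n * ennreal c"
      unfolding n(2) by (simp add: diff_add_cancel_ennreal)
    have "occupation B m y \<le> 1 * P N y + of_nat m * ennreal c" for y
    proof -
      have "occupation B m y \<le> (occupation B m y - of_nat m * ennreal c) + of_nat m * ennreal c"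
      proof (cases "of_nat m * ennreal c \<le> occupation B m y")
        case True
        then show ?thesis
          by (simp only: diff_add_cancel_ennreal order_refl)
      next
        case False
        then show ?thesis
          by (intro add_increasing) simp_all
      qed
      also have "\<dots> \<le> P N y + of_nat m * ennreal c"
        using n(1) m by (intro add_right_mono P_ge) simp
      finally show ?thesis by simp
    qed
    then have "markov_op M (occupation B m) z \<le> markov_op M (\<lambda>y. 1 * P N y + of_nat m * ennreal c) z"
      by (rule markov_op_mono)
    also have "\<dots> = markov_op M (P N) z + of_nat m * ennreal c"
      by (subst markov_op_affine) simp
    finally have "markov_op M (indicator B) z + markov_op M (occupation B m) z \<le>
        markov_op M (indicator B) z + (markov_op M (P N) z + of_nat m * ennreal c)"
      by (rule add_left_mono)
    then have "P N z + of_nat n * ennreal c \<le> markov_op M (indicator B) z + (markov_op M (P N) z + of_nat m * ennreal c)"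
      unfolding eq[symmetric] unfolding m occupation_Suc .
    then have "of_nat m * ennreal c + (P N z + ennreal c) \<le> of_nat m * ennreal c + (markov_op M (indicator B) z + markov_op M (P N) z)"
      by (simp add: m distrib_right add_ac)
    moreover have "of_nat m * ennreal c \<noteq> \<infinity>"
      by (simp add: ennreal_mult_eq_top_iff)
    ultimately have "P N z + ennreal c \<le> markov_op M (indicator B) z + markov_op M (P N) z"
      by (simp add: ennreal_add_left_cancel_le)
    with False show ?thesis
      by (simp add: zero_less_iff_neq_zero)
  qed simp
  have bound: "ennreal c * emeasure \<mu> {z. 0 < P N z} \<le> emeasure \<mu> B" for N
  proof -
    have intP: "(\<integral>\<^sup>+ z. P N z \<partial>\<mu>) \<noteq> \<infinity>"
    proof -
      have "(\<integral>\<^sup>+ z. P N z \<partial>\<mu>) \<le> (\<integral>\<^sup>+ z. of_nat N \<partial>\<mu>)"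
        by (intro nn_integral_mono P_le)
      then show ?thesis
        by (auto simp: emeasure_space_1 top_unique)
    qed
    have [measurable]: "{z. 0 < P N z} \<in> sets \<mu>"
      using borel_measurable_less[of "\<lambda>_. 0" borel "P N"] by (simp add: sets_\<mu> pred_def)
    have "(\<integral>\<^sup>+ z. P N z \<partial>\<mu>) + ennreal c * emeasure \<mu> {z. 0 < P N z} =
          (\<integral>\<^sup>+ z. P N z + ennreal c * indicator {z. 0 < P N z} z \<partial>\<mu>)"
      by (subst nn_integral_add) (simp_all add: nn_integral_cmult)
    also have "\<dots> \<le> (\<integral>\<^sup>+ z. markov_op M (indicator B) z + markov_op M (P N) z \<partial>\<mu>)"
      by (intro nn_integral_mono step)
    also have "\<dots> = (\<integral>\<^sup>+ z. markov_op M (indicator B) z \<partial>\<mu>) + (\<integral>\<^sup>+ z. markov_op M (P N) z \<partial>\<mu>)"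
      using measurable_markov_op[OF countable_markov_system]
      by (intro nn_integral_add) (simp_all cong: measurable_cong_sets add: sets_\<mu>)
    also have "\<dots> = emeasure \<mu> B + (\<integral>\<^sup>+ z. P N z \<partial>\<mu>)"
      by (simp add: invariant_nn_integral[OF \<mu>] sets_\<mu>)
    finally show ?thesis
      using intP by (simp add: add.commute[of "emeasure \<mu> B"] ennreal_add_left_cancel_le)
  qed
  have mono: "incseq (\<lambda>N. {z. 0 < P N z})"
  proof (rule incseq_SucI, safe)
    fix N z assume "0 < P N z"
    moreover have "P N z \<le> P (Suc N) z"
      unfolding P_def by (intro Max_mono) auto
    ultimately show "0 < P (Suc N) z" by simp
  qed
  have sets_P: "{z. 0 < P N z} \<in> sets \<mu>" for N
    using borel_measurable_less[of "\<lambda>_. 0" borel "P N"] by (simp add: sets_\<mu> pred_def)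
  have U: "{z. \<exists>n. of_nat n * ennreal c < occupation B n z} \<subseteq> (\<Union>N. {z. 0 < P N z})"
  proof safe
    fix z n assume "of_nat n * ennreal c < occupation B n z"
    then have "0 < occupation B n z - of_nat n * ennreal c"
      by (simp add: diff_gr0_ennreal)
    also have "\<dots> \<le> P n z"
      by (rule P_ge) simp
    finally show "z \<in> (\<Union>N. {z. 0 < P N z})"
      by blast
  qed
  have "ennreal c * emeasure \<mu> (\<Union>N. {z. 0 < P N z}) = (SUP N. ennreal c * emeasure \<mu> {z. 0 < P N z})"
    using sets_P mono by (subst SUP_emeasure_incseq[symmetric]) (auto simp: SUP_mult_left_ennreal)
  also have "\<dots> \<le> emeasure \<mu> B"
    by (intro SUP_least bound)
  finally have "ennreal c * emeasure \<mu> (\<Union>N. {z. 0 < P N z}) \<le> emeasure \<mu> B" .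
  moreover have "emeasure \<mu> {z. \<exists>n. of_nat n * ennreal c < occupation B n z} \<le> emeasure \<mu> (\<Union>N. {z. 0 < P N z})"
    using sets_P by (intro emeasure_mono U sets.countable_UN) auto
  ultimately show ?thesis
    by (meson mult_left_mono order_trans zero_le)
qed

text \<open>
  For a set \<open>V\<close> of vertices, the part of the space where tightness asks for small mass.
\<close>
definition outer_cells :: "nat set \<Rightarrow> 'k set" where
  "outer_cells V = (\<Union>j\<in>vertices M - V. cell M j)"

lemma outer_cells_borel [measurable]: "outer_cells V \<in> sets borel"
  unfolding outer_cells_def by (intro sets.countable_UN'') auto

lemma in_outer_cells_iff: "z \<in> outer_cells V \<longleftrightarrow> cell_index z \<notin> V"
  using cell_index_in in_cell_index by (auto simp: outer_cells_def in_cell_iff)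

lemma prob_space_orbit: "prob_space ((adjoint_op M ^^ k) (return borel z))"
  and sets_orbit [simp]: "sets ((adjoint_op M ^^ k) (return borel z)) = sets borel"
proof -
  have "prob_space ((adjoint_op M ^^ k) (return borel z)) \<and> sets ((adjoint_op M ^^ k) (return borel z)) = sets borel"
    by (induction k) (auto intro: prob_space_return prob_space_adjoint_op)
  then show "prob_space ((adjoint_op M ^^ k) (return borel z))" "sets ((adjoint_op M ^^ k) (return borel z)) = sets borel"
    by auto
qed

lemma nn_integral_orbit:
  assumes "f \<in> borel_measurable borel"
  shows "(\<integral>\<^sup>+ y. f y \<partial>(adjoint_op M ^^ k) (return borel z)) = (markov_op M ^^ k) f z"
  by (subst nn_integral_adjoint_op_pow)
     (auto intro!: nn_integral_return measurable_markov_op_pow assms)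

lemma emeasure_alpha:
  "emeasure (alpha M z n) (vertices M - V) = ennreal (1 / real n) * occupation (outer_cells V) n z"
proof -
  let ?\<nu> = "\<lambda>k. (adjoint_op M ^^ k) (return borel z)"
  have inner: "(\<integral>\<^sup>+ j. emeasure (?\<nu> k) (cell M j) \<partial>count_space (vertices M - V)) =
      (markov_op M ^^ k) (indicator (outer_cells V)) z" for k
  proof -
    have "disjoint_family_on (cell M) (vertices M - V)"
      using countable_markov_system by (auto simp: countable_markov_system_def disjoint_family_on_def)
    then have "(\<integral>\<^sup>+ j. emeasure (?\<nu> k) (cell M j) \<partial>count_space (vertices M - V)) = emeasure (?\<nu> k) (outer_cells V)"
      unfolding outer_cells_def by (intro emeasure_UN_countable[symmetric]) auto
    also have "\<dots> = (\<integral>\<^sup>+ y. indicator (outer_cells V) y \<partial>?\<nu> k)"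
      by simp
    also have "\<dots> = (markov_op M ^^ k) (indicator (outer_cells V)) z"
      by (rule nn_integral_orbit) simp
    finally show ?thesis .
  qed
  have "emeasure (alpha M z n) (vertices M - V) =
     (\<integral>\<^sup>+ j. ennreal (1 / real n * (\<Sum>k=1..n. measure (?\<nu> k) (cell M j))) * indicator (vertices M - V) j \<partial>count_space (vertices M))"
    unfolding alpha_def point_measure_def by (subst emeasure_density) auto
  also have "\<dots> = (\<integral>\<^sup>+ j. ennreal (1 / real n * (\<Sum>k=1..n. measure (?\<nu> k) (cell M j))) \<partial>count_space (vertices M - V))"
    by (auto simp: nn_integral_count_space_indicator intro!: nn_integral_cong split: split_indicator)
  also have "\<dots> = (\<integral>\<^sup>+ j. ennreal (1 / real n) * (\<Sum>k=1..n. emeasure (?\<nu> k) (cell M j)) \<partial>count_space (vertices M - V))"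
  proof (rule nn_integral_cong)
    fix j
    have "emeasure (?\<nu> k) (cell M j) = ennreal (measure (?\<nu> k) (cell M j))" for k
    proof -
      interpret N: prob_space "?\<nu> k" by (rule prob_space_orbit)
      show ?thesis by (rule N.emeasure_eq_measure)
    qed
    then have "(\<Sum>k=1..n. emeasure (?\<nu> k) (cell M j)) = ennreal (\<Sum>k=1..n. measure (?\<nu> k) (cell M j))"
      by (simp add: sum_nonneg)
    then show "ennreal (1 / real n * (\<Sum>k=1..n. measure (?\<nu> k) (cell M j))) =
      ennreal (1 / real n) * (\<Sum>k=1..n. emeasure (?\<nu> k) (cell M j))"
      by (simp only:) (rule ennreal_mult'', simp add: sum_nonneg)
  qed
  also have "\<dots> = ennreal (1 / real n) * (\<Sum>k=1..n. \<integral>\<^sup>+ j. emeasure (?\<nu> k) (cell M j) \<partial>count_space (vertices M - V))"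
    by (simp add: nn_integral_cmult nn_integral_sum)
  also have "\<dots> = ennreal (1 / real n) * occupation (outer_cells V) n z"
    by (simp only: inner)
  finally show ?thesis .
qed

lemma measure_alpha:
  assumes "1 \<le> n"
  shows "measure (alpha M z n) (vertices M - V) < \<epsilon> \<longleftrightarrow>
    ennreal (1 / real n) * occupation (outer_cells V) n z < ennreal \<epsilon>"
proof -
  have "ennreal (1 / real n) * occupation (outer_cells V) n z \<le> ennreal (1 / real n) * of_nat n"
    by (intro mult_left_mono occupation_le) simp
  also have "\<dots> = 1"
    using assms by (simp add: ennreal_of_nat_eq_real_of_nat ennreal_mult'[symmetric])
  finally have "emeasure (alpha M z n) (vertices M - V) \<noteq> \<infinity>"
    unfolding emeasure_alpha by (auto simp: top_unique)
  then have "ennreal (measure (alpha M z n) (vertices M - V)) = emeasure (alpha M z n) (vertices M - V)"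
    by (simp add: emeasure_eq_ennreal_measure)
  also note emeasure_alpha
  finally have "ennreal (measure (alpha M z n) (vertices M - V)) = ennreal (1 / real n) * occupation (outer_cells V) n z" .
  then show ?thesis
    by (metis ennreal_less_iff measure_nonneg)
qed

text \<open>
  Choose \<open>V\<^sub>k\<close> so large that the invariant mass outside is at most \<open>4\<^sup>-\<^sup>k / 4\<close>.  By the maximal
  inequality, all averages outside of \<open>V\<^sub>k\<close> are at most \<open>2\<^sup>-\<^sup>k\<close> except on a set of measure at most
  \<open>2\<^sup>-\<^sup>k / 4\<close>.  These sets do not cover the space, as their measures sum up to at most \<open>1/2\<close>.
\<close>
lemma exists_tight_orbit:
  assumes \<mu>: "\<mu> \<in> invariant_measures M"
  shows "\<exists>z. alpha_uniformly_tight M z"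
proof -
  interpret prob_space \<mu>
    using \<mu> by (simp add: invariant_measures_def)
  have sets_\<mu> [measurable_cong]: "sets \<mu> = sets borel"
    using \<mu> by (simp add: invariant_measures_def)
  have "\<exists>N. emeasure \<mu> (outer_cells {..N}) \<le> ennreal r" if "0 < r" for r
  proof -
    have "(\<lambda>N. emeasure \<mu> (outer_cells {..N})) \<longlonglongrightarrow> emeasure \<mu> (\<Inter>N. outer_cells {..N})"
    proof (rule Lim_emeasure_decseq)
      show "decseq (\<lambda>N. outer_cells {..N})"
        by (auto simp: decseq_def in_outer_cells_iff)
    qed (auto simp: sets_\<mu> emeasure_eq_measure)
    moreover have "(\<Inter>N. outer_cells {..N}) = {}"
      by (auto simp: in_outer_cells_iff)
    ultimately have "(\<lambda>N. emeasure \<mu> (outer_cells {..N})) \<longlonglongrightarrow> 0"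
      by simp
    then have "\<forall>\<^sub>F N in sequentially. emeasure \<mu> (outer_cells {..N}) < ennreal r"
      using that by (intro order_tendstoD(2)) auto
    then show ?thesis
      by (auto simp: eventually_sequentially intro: less_imp_le)
  qed
  then have "\<exists>N. emeasure \<mu> (outer_cells {..N}) \<le> ennreal ((1 / 4) ^ k / 4)" for k :: nat
    by simp
  then obtain N where N: "\<And>k. emeasure \<mu> (outer_cells {..N k}) \<le> ennreal ((1 / 4) ^ k / 4)"
    by metis
  define bad where "bad k = {z. \<exists>n. of_nat n * ennreal ((1 / 2) ^ k) < occupation (outer_cells {..N k}) n z}" for k :: nat
  have bad_sets: "bad k \<in> sets \<mu>" for k
  proof -
    have "{z \<in> space borel. \<exists>n. of_nat n * ennreal ((1 / 2) ^ k) < occupation (outer_cells {..N k}) n z} \<in> sets borel"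
      by (intro sets.sets_Collect_countable_Ex borel_measurable_less measurable_const measurable_occupation outer_cells_borel) simp
    then show ?thesis
      by (simp add: bad_def sets_\<mu>)
  qed
  have bad_le: "emeasure \<mu> (bad k) \<le> ennreal ((1 / 2) ^ k / 4)" for k
  proof -
    have "ennreal ((1 / 2) ^ k) * emeasure \<mu> (bad k) \<le> ennreal ((1 / 4) ^ k / 4)"
      unfolding bad_def by (rule order_trans[OF maximal_inequality[OF \<mu>] N]) simp_all
    then have "(1 / 2) ^ k * measure \<mu> (bad k) \<le> (1 / 4) ^ k / 4"
      by (simp add: emeasure_eq_measure ennreal_mult'[symmetric])
    also have "\<dots> = (1 / 2) ^ k * ((1 / 2) ^ k / 4)"
      by (simp add: power_mult_distrib[symmetric])
    finally have "measure \<mu> (bad k) \<le> (1 / 2) ^ k / 4"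
      by (rule mult_left_le_imp_le) simp
    then show ?thesis
      by (simp add: emeasure_eq_measure ennreal_leI)
  qed
  have "emeasure \<mu> (\<Union>k. bad k) \<le> (\<Sum>k. emeasure \<mu> (bad k))"
    using bad_sets by (intro emeasure_subadditive_countably) auto
  also have "\<dots> \<le> (\<Sum>k. ennreal ((1 / 2) ^ k / 4))"
    by (intro suminf_le bad_le) auto
  also have "\<dots> = ennreal (1 / 2)"
    using sums_divide[OF geometric_sums[of "1 / 2 :: real"], of 4] by (intro suminf_ennreal_eq) simp_all
  also have "\<dots> < emeasure \<mu> (space \<mu>)"
  proof -
    have "ennreal (1 / 2) < ennreal 1"
      by (rule ennreal_lessI) simp_all
    then show ?thesis
      by (simp only: emeasure_space_1 ennreal_1)
  qed
  finally have "(\<Union>k. bad k) \<noteq> space \<mu>"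
    by (metis less_irrefl)
  then have "(\<Union>k. bad k) \<noteq> UNIV"
    using sets_eq_imp_space_eq[OF sets_\<mu>] by simp
  then obtain z where z: "\<And>k. z \<notin> bad k"
    by blast
  have "alpha_uniformly_tight M z"
    unfolding alpha_uniformly_tight_def
  proof (intro allI impI)
    fix \<epsilon> :: real assume "0 < \<epsilon>"
    then obtain k where k: "(1 / 2 :: real) ^ k < \<epsilon>"
      using real_arch_pow_inv[of \<epsilon> "1 / 2"] by auto
    have "measure (alpha M z n) (vertices M - (vertices M \<inter> {..N k})) < \<epsilon>" if n: "1 \<le> n" for n
    proof -
      have "occupation (outer_cells {..N k}) n z \<le> of_nat n * ennreal ((1 / 2) ^ k)"
        using z[of k] by (auto simp: bad_def not_less)
      then have "ennreal (1 / real n) * occupation (outer_cells {..N k}) n z \<le>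
          ennreal (1 / real n) * (of_nat n * ennreal ((1 / 2) ^ k))"
        by (rule mult_left_mono) simp
      also have "\<dots> = ennreal ((1 / 2) ^ k)"
        using n by (simp add: ennreal_of_nat_eq_real_of_nat ennreal_mult'[symmetric])
      also have "\<dots> < ennreal \<epsilon>"
        using k by (simp add: ennreal_less_iff)
      finally have "measure (alpha M z n) (vertices M - {..N k}) < \<epsilon>"
        using measure_alpha[OF n] by blast
      moreover have "vertices M - (vertices M \<inter> {..N k}) = vertices M - {..N k}"
        by auto
      ultimately show ?thesis by simp
    qed
    then show "\<exists>V\<subseteq>vertices M. finite V \<and> (\<forall>n\<ge>1. measure (alpha M z n) (vertices M - V) < \<epsilon>)"
      by (intro exI[of _ "vertices M \<inter> {..N k}"]) auto
  qed
  then show ?thesis ..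
qed

end

section \<open>Cesaro averages along an orbit\<close>

context markov
begin

text \<open>
  The law of the position at a uniformly distributed time in \<open>{1..n+1}\<close>; shifting the index keeps the
  average non-empty.
\<close>
definition cesaro :: "'k \<Rightarrow> nat \<Rightarrow> 'k measure" where
  "cesaro z n = measure_pmf (pmf_of_set {1..Suc n}) \<bind> (\<lambda>k. (adjoint_op M ^^ k) (return borel z))"

lemma orbit_measurable:
  "(\<lambda>k. (adjoint_op M ^^ k) (return borel z)) \<in> measurable (measure_pmf p) (subprob_algebra borel)"
  by (auto simp: space_subprob_algebra intro: prob_space_imp_subprob_space prob_space_orbit)

lemma sets_cesaro [simp]: "sets (cesaro z n) = sets borel"
  unfolding cesaro_def by (rule sets_bind) simp_all

lemma prob_space_cesaro: "prob_space (cesaro z n)"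
  unfolding cesaro_def
  by (rule measure_pmf.prob_space_bind[OF _ orbit_measurable]) (simp add: prob_space_orbit)

lemma nn_integral_cesaro:
  assumes f: "f \<in> borel_measurable borel"
  shows "(\<integral>\<^sup>+ y. f y \<partial>cesaro z n) = ennreal (1 / real (Suc n)) * (\<Sum>k=1..Suc n. (markov_op M ^^ k) f z)"
proof -
  have inv: "u / of_nat (Suc n) = ennreal (1 / real (Suc n)) * u" for u :: ennreal
    unfolding divide_ennreal_def ennreal_of_nat_eq_real_of_nat
    by (subst inverse_ennreal) (simp_all add: mult.commute inverse_eq_divide)
  have "(\<integral>\<^sup>+ y. f y \<partial>cesaro z n) =
    (\<integral>\<^sup>+ k. (markov_op M ^^ k) f z \<partial>measure_pmf (pmf_of_set {1..Suc n}))"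
    unfolding cesaro_def by (subst nn_integral_bind[OF f orbit_measurable]) (simp add: nn_integral_orbit[OF f])
  also have "\<dots> = (\<Sum>k=1..Suc n. (markov_op M ^^ k) f z) / of_nat (Suc n)"
    by (subst nn_integral_pmf_of_set) simp_all
  finally show ?thesis
    unfolding inv .
qed

lemma markov_op_pow_le_1:
  assumes "\<And>z. f z \<le> 1"
  shows "(markov_op M ^^ k) f z \<le> 1"
proof (induction k arbitrary: z)
  case (Suc k)
  have "markov_op M ((markov_op M ^^ k) f) z \<le> markov_op M (\<lambda>_. 1) z"
    by (intro markov_op_mono Suc)
  then show ?case by simp
qed (use assms in simp)

text \<open>
  Applying the operator shifts the average by one step, which changes only its two end terms.
\<close>
lemma cesaro_almost_invariant:
  assumes f: "f \<in> borel_measurable borel" "\<And>z. f z \<le> 1"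
  shows "(\<integral>\<^sup>+ y. markov_op M f y \<partial>cesaro z n) \<le> (\<integral>\<^sup>+ y. f y \<partial>cesaro z n) + ennreal (1 / real (Suc n))"
    and "(\<integral>\<^sup>+ y. f y \<partial>cesaro z n) \<le> (\<integral>\<^sup>+ y. markov_op M f y \<partial>cesaro z n) + ennreal (1 / real (Suc n))"
proof -
  let ?u = "\<lambda>k. (markov_op M ^^ k) f z"
  have shift: "(\<Sum>k=1..N. ?u (Suc k)) + ?u 1 = (\<Sum>k=1..N. ?u k) + ?u (Suc N)" for N
  proof (induction N)
    case (Suc N)
    have "(\<Sum>k=1..Suc N. ?u (Suc k)) + ?u 1 = ((\<Sum>k=1..N. ?u (Suc k)) + ?u 1) + ?u (Suc (Suc N))"
      by (simp add: add_ac)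
    also have "\<dots> = (\<Sum>k=1..Suc N. ?u k) + ?u (Suc (Suc N))"
      unfolding Suc by (simp add: add_ac)
    finally show ?case .
  qed simp
  have U: "(markov_op M ^^ k) (markov_op M f) z = ?u (Suc k)" for k
    by (simp add: funpow_swap1)
  have le1: "?u k \<le> 1" for k
    by (rule markov_op_pow_le_1) (rule f(2))
  have a: "(\<Sum>k=1..Suc n. ?u (Suc k)) \<le> (\<Sum>k=1..Suc n. ?u k) + 1"
  proof -
    have "(\<Sum>k=1..Suc n. ?u (Suc k)) \<le> (\<Sum>k=1..Suc n. ?u (Suc k)) + ?u 1"
      by simp
    also have "\<dots> \<le> (\<Sum>k=1..Suc n. ?u k) + 1"
      unfolding shift by (intro add_left_mono le1)
    finally show ?thesis .
  qed
  have b: "(\<Sum>k=1..Suc n. ?u k) \<le> (\<Sum>k=1..Suc n. ?u (Suc k)) + 1"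
  proof -
    have "(\<Sum>k=1..Suc n. ?u k) \<le> (\<Sum>k=1..Suc n. ?u k) + ?u (Suc (Suc n))"
      by simp
    also have "\<dots> \<le> (\<Sum>k=1..Suc n. ?u (Suc k)) + 1"
      unfolding shift[symmetric] by (intro add_left_mono le1)
    finally show ?thesis .
  qed
  show "(\<integral>\<^sup>+ y. markov_op M f y \<partial>cesaro z n) \<le> (\<integral>\<^sup>+ y. f y \<partial>cesaro z n) + ennreal (1 / real (Suc n))"
    unfolding nn_integral_cesaro[OF f(1)] nn_integral_cesaro[OF measurable_markov_op[OF countable_markov_system f(1)]] U
    using mult_left_mono[OF a, of "ennreal (1 / real (Suc n))"] by (simp only: distrib_left mult_1_right zero_le simp_thms)
  show "(\<integral>\<^sup>+ y. f y \<partial>cesaro z n) \<le> (\<integral>\<^sup>+ y. markov_op M f y \<partial>cesaro z n) + ennreal (1 / real (Suc n))"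
    unfolding nn_integral_cesaro[OF f(1)] nn_integral_cesaro[OF measurable_markov_op[OF countable_markov_system f(1)]] U
    using mult_left_mono[OF b, of "ennreal (1 / real (Suc n))"] by (simp only: distrib_left mult_1_right zero_le simp_thms)
qed

lemma emeasure_cesaro_outer_cells:
  "measure (alpha M z (Suc n)) (vertices M - V) < \<epsilon> \<longleftrightarrow> emeasure (cesaro z n) (outer_cells V) < ennreal \<epsilon>"
proof -
  have "emeasure (cesaro z n) (outer_cells V) = (\<integral>\<^sup>+ y. indicator (outer_cells V) y \<partial>cesaro z n)"
    by simp
  also have "\<dots> = ennreal (1 / real (Suc n)) * occupation (outer_cells V) (Suc n) z"
    by (rule nn_integral_cesaro) simp
  finally show ?thesis
    using measure_alpha[of "Suc n" z V \<epsilon>] by (simp only: le_add1 One_nat_def Suc_le_mono zero_le simp_thms)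
qed

end

section \<open>Limit laws of a tight orbit\<close>

context contractive_markov
begin

lemma lyap_cesaro: "(\<integral>\<^sup>+ y. ennreal (lyap y) \<partial>cesaro z n) \<le> ennreal (lyap z + b / (1 - a))"
proof -
  have c: "0 \<le> b / (1 - a)"
    using b_nonneg a_less_1 by (intro divide_nonneg_pos) linarith+
  have "(markov_op M ^^ k) (\<lambda>y. ennreal (lyap y)) z \<le> ennreal (lyap z + b / (1 - a))" for k
  proof -
    have "ennreal (a ^ k) * ennreal (lyap z) \<le> 1 * ennreal (lyap z)"
      by (intro mult_right_mono) (simp_all add: ennreal_le_1 power_le_one less_imp_le)
    then show ?thesis
      using order_trans[OF drift_pow add_right_mono] c by (subst ennreal_plus) auto
  qed
  then have "(\<Sum>k=1..Suc n. (markov_op M ^^ k) (\<lambda>y. ennreal (lyap y)) z) \<le> of_nat (Suc n) * ennreal (lyap z + b / (1 - a))"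
    using sum_bounded_above[of "{1..Suc n}" "\<lambda>k. (markov_op M ^^ k) (\<lambda>y. ennreal (lyap y)) z"] by simp
  then have "(\<integral>\<^sup>+ y. ennreal (lyap y) \<partial>cesaro z n) \<le>
      ennreal (1 / real (Suc n)) * (of_nat (Suc n) * ennreal (lyap z + b / (1 - a)))"
    by (subst nn_integral_cesaro) (simp_all only: mult_left_mono zero_le, measurable)
  also have "\<dots> = ennreal (lyap z + b / (1 - a))"
    using c by (simp add: ennreal_of_nat_eq_real_of_nat ennreal_mult'[symmetric] mult.assoc[symmetric] del: of_nat_Suc)
  finally show ?thesis .
qed

text \<open>
  All word probabilities converge along a diagonal subsequence, and Fatou's lemma gives one inequality
  in each consistency condition.  On the left, no mass is lost: outside of finitely many cells the mass is
  uniformly small, and from the remaining cells the edges are dominated by the summable suprema of their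
  probabilities.  On the right, equality then follows since both sides have total mass one.
\<close>
lemma tight_limit_law:
  assumes dom: "dominating_markov_chain M" and tight: "alpha_uniformly_tight M z"
  obtains r q where "strict_mono (r :: nat \<Rightarrow> nat)" "word_law M q"
    "\<And>u. set u \<subseteq> edges M \<Longrightarrow> (\<lambda>n. word_integral (cesaro z (r n)) (\<lambda>_. 1) u) \<longlonglongrightarrow> q u"
proof -
  let ?S = "lists (edges M)"
  let ?w = "\<lambda>n. word_integral (cesaro z n) (\<lambda>_. 1)"
  have bounds: "0 \<le> ?w n u \<and> ?w n u \<le> 1" if "set u \<subseteq> edges M" for n u
    using word_integral_bounds[OF prob_space_cesaro sets_cesaro _ _ that, of "\<lambda>_. 1"] by simp
  have "\<exists>r. strict_mono r \<and> (\<forall>u\<in>?S. \<exists>l. (\<lambda>n. ?w (r n) u) \<longlonglongrightarrow> l)"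
  proof (rule function_convergent_subsequence[of ?S ?w 1])
    show "countable ?S"
      by (simp add: countable_edges)
    show "norm (?w n u) \<le> 1" if "u \<in> ?S" for n u
    proof -
      have "set u \<subseteq> edges M"
        using that by auto
      from bounds[OF this, of n] show ?thesis
        by simp
    qed
  qed blast
  then obtain r where r: "strict_mono r" "\<forall>u\<in>?S. \<exists>l. (\<lambda>n. ?w (r n) u) \<longlonglongrightarrow> l"
    by blast
  define q where "q u = lim (\<lambda>n. ?w (r n) u)" for u
  have q: "(\<lambda>n. ?w (r n) u) \<longlonglongrightarrow> q u" if "set u \<subseteq> edges M" for u
    using r(2) that unfolding q_def by (metis in_listsI limI subsetD)
  have q_nonneg: "0 \<le> q u" if "set u \<subseteq> edges M" for u
    by (rule LIMSEQ_le_const[OF q[OF that]]) (use bounds[OF that] in blast)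
  have "(\<lambda>n. 1 / real (Suc n)) \<longlonglongrightarrow> 0"
    by (rule LIMSEQ_Suc[OF lim_1_over_n])
  then have inv0: "(\<lambda>n. 1 / real (Suc (r n))) \<longlonglongrightarrow> 0"
    using LIMSEQ_subseq_LIMSEQ[OF _ r(1)] by (auto simp: o_def)
  have step: "(\<integral>\<^sup>+ e. ennreal (?w n (e # u)) \<partial>count_space (edges M)) \<le> ennreal (?w n u + 1 / real (Suc n))"
    "ennreal (?w n u) \<le> (\<integral>\<^sup>+ e. ennreal (?w n (e # u)) \<partial>count_space (edges M)) + ennreal (1 / real (Suc n))"
    if u: "set u \<subseteq> edges M" for n u
  proof -
    note [measurable] = measurable_word_prb[OF u]
    have sum: "(\<integral>\<^sup>+ e. ennreal (?w n (e # u)) \<partial>count_space (edges M)) =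
      (\<integral>\<^sup>+ y. markov_op M (\<lambda>y. ennreal (word_prb M u y)) y \<partial>cesaro z n)"
      using sum_word_integral_Cons[OF prob_space_cesaro sets_cesaro _ _ u, of "\<lambda>_. 1"] by simp
    have int: "ennreal (?w n u) = (\<integral>\<^sup>+ y. ennreal (word_prb M u y) \<partial>cesaro z n)"
      by (subst ennreal_word_integral[OF prob_space_cesaro sets_cesaro _ _ u]) simp_all
    have m: "(\<lambda>y. ennreal (word_prb M u y)) \<in> borel_measurable borel"
      by measurable
    have le1: "ennreal (word_prb M u y) \<le> 1" for y
      using u by (simp add: ennreal_le_1)
    show "(\<integral>\<^sup>+ e. ennreal (?w n (e # u)) \<partial>count_space (edges M)) \<le> ennreal (?w n u + 1 / real (Suc n))"
      using cesaro_almost_invariant(1)[OF m le1, of z n] bounds[OF u, of n]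
      by (subst ennreal_plus) (simp_all only: sum int zero_le_divide_1_iff of_nat_0_le_iff)
    show "ennreal (?w n u) \<le> (\<integral>\<^sup>+ e. ennreal (?w n (e # u)) \<partial>count_space (edges M)) + ennreal (1 / real (Suc n))"
      unfolding sum int by (rule cesaro_almost_invariant(2)[OF m le1])
  qed
  have left: "(\<integral>\<^sup>+ e. ennreal (q (e # u)) \<partial>count_space (edges M)) = ennreal (q u)" if u: "set u \<subseteq> edges M" for u
  proof (rule antisym)
    have "(\<integral>\<^sup>+ e. ennreal (q (e # u)) \<partial>count_space (edges M)) =
        (\<integral>\<^sup>+ e. liminf (\<lambda>n. ennreal (?w (r n) (e # u))) \<partial>count_space (edges M))"
      using u by (intro nn_integral_cong lim_imp_Liminf[symmetric] tendsto_ennrealI q) auto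
    also have "\<dots> \<le> liminf (\<lambda>n. \<integral>\<^sup>+ e. ennreal (?w (r n) (e # u)) \<partial>count_space (edges M))"
      by (rule nn_integral_liminf) simp
    also have "\<dots> \<le> liminf (\<lambda>n. ennreal (?w (r n) u + 1 / real (Suc (r n))))"
      by (intro Liminf_mono always_eventually allI step(1) u)
    also have "\<dots> = ennreal (q u)"
    proof (rule lim_imp_Liminf)
      have "(\<lambda>n. ?w (r n) u + 1 / real (Suc (r n))) \<longlonglongrightarrow> q u + 0"
        by (intro tendsto_add q u inv0)
      then show "(\<lambda>n. ennreal (?w (r n) u + 1 / real (Suc (r n)))) \<longlonglongrightarrow> ennreal (q u)"
        by (intro tendsto_ennrealI) simp
    qed simp
    finally show "(\<integral>\<^sup>+ e. ennreal (q (e # u)) \<partial>count_space (edges M)) \<le> ennreal (q u)" .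
    show "ennreal (q u) \<le> (\<integral>\<^sup>+ e. ennreal (q (e # u)) \<partial>count_space (edges M))"
    proof (rule ennreal_le_epsilon)
      fix \<epsilon> :: real assume \<epsilon>: "0 < \<epsilon>"
      then obtain V where V: "V \<subseteq> vertices M" "finite V" "\<forall>n\<ge>1. measure (alpha M z n) (vertices M - V) < \<epsilon>"
        using tight unfolding alpha_uniformly_tight_def by blast
      have outer: "emeasure (cesaro z n) (outer_cells V) \<le> ennreal \<epsilon>" for n
        using V(3) emeasure_cesaro_outer_cells[of z n V \<epsilon>] by (auto intro: less_imp_le)
      let ?E = "{e \<in> edges M. src M e \<in> V}" and ?E' = "{e \<in> edges M. src M e \<notin> V}"
      let ?h = "\<lambda>e. SUP y\<in>cell M (src M e). ennreal (prb M e y)"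
      have prb_le_h: "ennreal (prb M e y) \<le> ?h e" if "e \<in> edges M" for e y
      proof (cases "y \<in> cell M (src M e)")
        case True
        then show ?thesis by (rule SUP_upper)
      qed (simp add: prb_outside[OF that])
      have prb_int: "ennreal (?w n (e # u)) \<le> (\<integral>\<^sup>+ y. ennreal (prb M e y) \<partial>cesaro z n)" if e: "e \<in> edges M" for n e
      proof -
        have "ennreal (?w n (e # u)) = (\<integral>\<^sup>+ y. ennreal (word_prb M (e # u) y) * ennreal 1 \<partial>cesaro z n)"
          using u e by (intro ennreal_word_integral[OF prob_space_cesaro sets_cesaro]) auto
        also have "\<dots> \<le> (\<integral>\<^sup>+ y. ennreal (prb M e y) \<partial>cesaro z n)"
          using u e by (intro nn_integral_mono) (auto intro!: ennreal_leI mult_left_le)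
        finally show ?thesis .
      qed
      have w_le_h: "ennreal (?w n (e # u)) \<le> ?h e" if e: "e \<in> edges M" for n e
      proof -
        interpret C: prob_space "cesaro z n" by (rule prob_space_cesaro)
        have "(\<integral>\<^sup>+ y. ennreal (prb M e y) \<partial>cesaro z n) \<le> (\<integral>\<^sup>+ y. ?h e \<partial>cesaro z n)"
          by (intro nn_integral_mono prb_le_h e)
        with prb_int[OF e, of n] show ?thesis
          by (simp add: C.emeasure_space_1)
      qed
      \<comment> \<open>edges that depart from outside of \<open>V\<close> carry at most the mass of the outer cells\<close>
      have tail: "(\<integral>\<^sup>+ e. ennreal (?w n (e # u)) \<partial>count_space ?E') \<le> ennreal \<epsilon>" for n
      proof -
        have "(\<integral>\<^sup>+ e. ennreal (?w n (e # u)) \<partial>count_space ?E') \<le>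
            (\<integral>\<^sup>+ e. \<integral>\<^sup>+ y. ennreal (prb M e y) \<partial>cesaro z n \<partial>count_space ?E')"
          by (intro nn_integral_mono prb_int) simp
        also have "\<dots> = (\<integral>\<^sup>+ y. \<integral>\<^sup>+ e. ennreal (prb M e y) \<partial>count_space ?E' \<partial>cesaro z n)"
        proof (rule nn_integral_count_space_nn_integral[symmetric])
          show "countable ?E'"
            by (rule countable_subset[OF _ countable_edges]) auto
          fix e assume "e \<in> ?E'"
          then have "(\<lambda>y. ennreal (prb M e y)) \<in> borel_measurable borel"
            by simp
          then show "(\<lambda>y. ennreal (prb M e y)) \<in> borel_measurable (cesaro z n)"
            by (subst measurable_cong_sets[OF sets_cesaro refl])
        qed
        also have "\<dots> \<le> (\<integral>\<^sup>+ y. indicator (outer_cells V) y \<partial>cesaro z n)"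
        proof (rule nn_integral_mono)
          fix y
          show "(\<integral>\<^sup>+ e. ennreal (prb M e y) \<partial>count_space ?E') \<le> indicator (outer_cells V) y"
          proof (cases "y \<in> outer_cells V")
            case True
            have "(\<integral>\<^sup>+ e. ennreal (prb M e y) \<partial>count_space ?E') \<le> (\<integral>\<^sup>+ e. ennreal (prb M e y) \<partial>count_space (edges M))"
              by (auto simp: nn_integral_count_space_indicator intro!: nn_integral_mono split: split_indicator)
            with True show ?thesis
              by (simp add: sum_prb)
          next
            case False
            then have "prb M e y = 0" if "e \<in> ?E'" for e
              using that cell_index_eq[of "src M e" y] by (intro prb_outside) (auto simp: in_outer_cells_iff)
            then have "(\<integral>\<^sup>+ e. ennreal (prb M e y) \<partial>count_space ?E') = (\<integral>\<^sup>+ e. 0 \<partial>count_space ?E')"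
              by (intro nn_integral_cong) simp
            then show ?thesis by simp
          qed
        qed
        also have "\<dots> \<le> ennreal \<epsilon>"
          using outer[of n] by simp
        finally show ?thesis .
      qed
      \<comment> \<open>the dominating function is summable because only finitely many sources are involved\<close>
      have h_fin: "(\<integral>\<^sup>+ e. ?h e \<partial>count_space ?E) < \<infinity>"
      proof -
        have "(\<integral>\<^sup>+ e. ?h e \<partial>count_space ?E) \<le> (\<integral>\<^sup>+ e. (\<Sum>j\<in>V. ?h e * indicator (out_edges M j) e) \<partial>count_space ?E)"
        proof (rule nn_integral_mono)
          fix e assume "e \<in> space (count_space ?E)"
          then have e: "e \<in> edges M" "src M e \<in> V" by auto
          then have "?h e = ?h e * indicator (out_edges M (src M e)) e"
            by (simp add: out_edges_def)
          also have "\<dots> \<le> (\<Sum>j\<in>V. ?h e * indicator (out_edges M j) e)"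
            using V(2) e(2) by (intro member_le_sum) auto
          finally show "?h e \<le> (\<Sum>j\<in>V. ?h e * indicator (out_edges M j) e)" .
        qed
        also have "\<dots> = (\<Sum>j\<in>V. \<integral>\<^sup>+ e. ?h e * indicator (out_edges M j) e \<partial>count_space ?E)"
          by (rule nn_integral_sum) simp
        also have "\<dots> < \<infinity>"
        proof -
          have "(\<integral>\<^sup>+ e. ?h e * indicator (out_edges M j) e \<partial>count_space ?E) < \<infinity>" if j: "j \<in> V" for j
          proof -
            have "(\<integral>\<^sup>+ e. ?h e * indicator (out_edges M j) e \<partial>count_space ?E) \<le>
                (\<integral>\<^sup>+ e. (SUP y\<in>cell M j. ennreal (prb M e y)) \<partial>count_space (out_edges M j))"
              by (auto simp: nn_integral_count_space_indicator out_edges_def intro!: nn_integral_mono split: split_indicator)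
            also have "\<dots> < \<infinity>"
              using dom j V(1) unfolding dominating_markov_chain_def by blast
            finally show ?thesis .
          qed
          with V(2) show ?thesis
            by (simp add: less_top)
        qed
        finally show ?thesis .
      qed
      have lim: "(\<lambda>n. \<integral>\<^sup>+ e. ennreal (?w (r n) (e # u)) \<partial>count_space ?E) \<longlonglongrightarrow> (\<integral>\<^sup>+ e. ennreal (q (e # u)) \<partial>count_space ?E)"
        using u by (intro nn_integral_dominated_convergence[OF _ _ _ _ h_fin])
          (auto simp: AE_count_space intro!: w_le_h tendsto_ennrealI q)
      have split: "(\<integral>\<^sup>+ e. f e \<partial>count_space (edges M)) = (\<integral>\<^sup>+ e. f e \<partial>count_space ?E) + (\<integral>\<^sup>+ e. f e \<partial>count_space ?E')"
        for f :: "'e \<Rightarrow> ennreal"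
      proof -
        have "(\<integral>\<^sup>+ e. f e \<partial>count_space (edges M)) = (\<integral>\<^sup>+ e. f e * indicator ?E e + f e * indicator ?E' e \<partial>count_space UNIV)"
          by (auto simp: nn_integral_count_space_indicator intro!: nn_integral_cong split: split_indicator)
        then show ?thesis
          by (simp add: nn_integral_add nn_integral_count_space_indicator)
      qed
      have "ennreal (q u) \<le> (\<integral>\<^sup>+ e. ennreal (q (e # u)) \<partial>count_space ?E) + ennreal \<epsilon> + ennreal 0"
      proof (rule LIMSEQ_le[OF tendsto_ennrealI[OF q[OF u]]
            tendsto_add[OF tendsto_add[OF lim tendsto_const] tendsto_ennrealI[OF inv0]]])
        have "ennreal (?w (r n) u) \<le> (\<integral>\<^sup>+ e. ennreal (?w (r n) (e # u)) \<partial>count_space ?E) + ennreal \<epsilon> + ennreal (1 / real (Suc (r n)))" for n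
        proof -
          have "ennreal (?w (r n) u) \<le> (\<integral>\<^sup>+ e. ennreal (?w (r n) (e # u)) \<partial>count_space (edges M)) + ennreal (1 / real (Suc (r n)))"
            by (rule step(2)[OF u])
          also have "\<dots> \<le> (\<integral>\<^sup>+ e. ennreal (?w (r n) (e # u)) \<partial>count_space ?E) + ennreal \<epsilon> + ennreal (1 / real (Suc (r n)))"
            unfolding split by (intro add_right_mono add_left_mono tail)
          finally show ?thesis .
        qed
        then show "\<exists>N. \<forall>n\<ge>N. ennreal (?w (r n) u) \<le> (\<integral>\<^sup>+ e. ennreal (?w (r n) (e # u)) \<partial>count_space ?E) + ennreal \<epsilon> + ennreal (1 / real (Suc (r n)))"
          by blast
      qed
      also have "\<dots> \<le> (\<integral>\<^sup>+ e. ennreal (q (e # u)) \<partial>count_space (edges M)) + ennreal \<epsilon>"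
        by (auto simp: nn_integral_count_space_indicator intro!: add_right_mono nn_integral_mono split: split_indicator)
      finally show "ennreal (q u) \<le> (\<integral>\<^sup>+ e. ennreal (q (e # u)) \<partial>count_space (edges M)) + ennreal \<epsilon>" .
    qed
  qed
  have nil: "q [] = 1"
  proof -
    have "?w n [] = 1" for n
      using prob_space.prob_space[OF prob_space_cesaro, of z n] by (simp add: word_integral_def)
    then show ?thesis
      using q[of "[]"] by (simp add: LIMSEQ_const_iff)
  qed
  have total: "(\<integral>\<^sup>+ w. ennreal (q w) \<partial>count_space (words M n)) = 1" for n
    using sum_words_left[where q = "\<lambda>w. ennreal (q w)" and w = "[]" and n = n, OF left] nil by simp
  have right: "(\<integral>\<^sup>+ e. ennreal (q (u @ [e])) \<partial>count_space (edges M)) = ennreal (q u)" if u: "set u \<subseteq> edges M" for u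
  proof -
    let ?f = "\<lambda>w. \<integral>\<^sup>+ e. ennreal (q (w @ [e])) \<partial>count_space (edges M)"
    let ?W = "words M (length u)"
    have le: "?f w \<le> ennreal (q w)" if w: "set w \<subseteq> edges M" for w
    proof -
      have "?f w = (\<integral>\<^sup>+ e. liminf (\<lambda>n. ennreal (?w (r n) (w @ [e]))) \<partial>count_space (edges M))"
        using w by (intro nn_integral_cong lim_imp_Liminf[symmetric] tendsto_ennrealI q) auto
      also have "\<dots> \<le> liminf (\<lambda>n. \<integral>\<^sup>+ e. ennreal (?w (r n) (w @ [e])) \<partial>count_space (edges M))"
        by (rule nn_integral_liminf) simp
      also have "\<dots> = liminf (\<lambda>n. ennreal (?w (r n) w))"
        by (simp only: sum_word_integral_snoc[OF prob_space_cesaro sets_cesaro w])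
      also have "\<dots> = ennreal (q w)"
        by (intro lim_imp_Liminf tendsto_ennrealI q w) simp
      finally show ?thesis .
    qed
    have f_one: "(\<integral>\<^sup>+ w. ?f w \<partial>count_space ?W) = 1"
      using total[of "Suc (length u)"] by (simp add: nn_integral_words_snoc)
    have "(\<integral>\<^sup>+ w. ennreal (q w) - ?f w \<partial>count_space ?W) =
        (\<integral>\<^sup>+ w. ennreal (q w) \<partial>count_space ?W) - (\<integral>\<^sup>+ w. ?f w \<partial>count_space ?W)"
    proof (rule nn_integral_diff)
      show "(\<integral>\<^sup>+ w. ?f w \<partial>count_space ?W) \<noteq> \<infinity>"
        by (simp add: f_one)
      show "AE w in count_space ?W. ?f w \<le> ennreal (q w)"
        using le by (auto simp: AE_count_space words_def)
    qed simp_all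
    also have "\<dots> = 0"
      by (simp add: f_one total)
    finally have "\<forall>w\<in>?W. ennreal (q w) - ?f w = 0"
      by (subst (asm) nn_integral_0_iff_AE) (simp_all add: AE_count_space)
    then have "ennreal (q u) - ?f u = 0"
      using u by (simp add: words_def)
    then have "ennreal (q u) \<le> ?f u"
      by (simp add: diff_eq_0_iff_ennreal)
    with le[OF u] show ?thesis
      by (rule antisym)
  qed
  have "word_law M q"
    by unfold_locales (simp_all add: q_nonneg nil left right)
  with r(1) q show thesis
    using that by blast
qed

end

section \<open>Existence of equilibrium states\<close>

context uniform_markov
begin

text \<open>
  Uniform continuity provides the extension, and continuity makes it unique.
\<close>
lemma closure_prb:
  assumes e: "e \<in> edges M"
  shows continuous_closure_prb: "continuous_on (closure (cell M (src M e))) (closure_prb M e)"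
    and closure_prb_cell: "z \<in> cell M (src M e) \<Longrightarrow> closure_prb M e z = prb M e z"
    and closure_prb_outside: "z \<notin> closure (cell M (src M e)) \<Longrightarrow> closure_prb M e z = 0"
proof -
  let ?C = "cell M (src M e)"
  let ?P = "\<lambda>g. continuous_on (closure ?C) g \<and> (\<forall>z\<in>?C. g z = prb M e z) \<and> (\<forall>z. z \<notin> closure ?C \<longrightarrow> g z = 0)"
  have "uniformly_continuous_on ?C (prb M e)"
    using uniform e by (simp add: uniformly_continuous_system_def)
  then obtain g where g: "uniformly_continuous_on (closure ?C) g" "\<And>z. z \<in> ?C \<Longrightarrow> prb M e z = g z"
    "\<And>Y h z. ?C \<subseteq> Y \<Longrightarrow> Y \<subseteq> closure ?C \<Longrightarrow> continuous_on Y h \<Longrightarrow> (\<And>z. z \<in> ?C \<Longrightarrow> prb M e z = h z) \<Longrightarrow> z \<in> Y \<Longrightarrow> h z = g z"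
    using uniformly_continuous_on_extension_on_closure by blast
  have "\<exists>!g. ?P g"
  proof (rule ex1I)
    let ?g = "\<lambda>z. if z \<in> closure ?C then g z else 0"
    have "continuous_on (closure ?C) ?g \<longleftrightarrow> continuous_on (closure ?C) g"
      by (rule continuous_on_cong) simp_all
    then show "?P ?g"
      using uniformly_continuous_imp_continuous[OF g(1)] g(2) closure_subset[of ?C] by auto
    fix h assume h: "?P h"
    show "h = ?g"
    proof
      fix z
      show "h z = ?g z"
        using g(3)[OF closure_subset order_refl, of h z] h by simp
    qed
  qed
  then have "?P (closure_prb M e)"
    unfolding closure_prb_def by (rule theI')
  then show "continuous_on (closure ?C) (closure_prb M e)" "z \<in> ?C \<Longrightarrow> closure_prb M e z = prb M e z"
    "z \<notin> closure ?C \<Longrightarrow> closure_prb M e z = 0"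
    by blast+
qed

lemma closure_prb_bounds:
  assumes e: "e \<in> edges M"
  shows "0 \<le> closure_prb M e z \<and> closure_prb M e z \<le> 1"
proof (cases "z \<in> closure (cell M (src M e))")
  case True
  then obtain y where y: "\<And>n. y n \<in> cell M (src M e)" "y \<longlonglongrightarrow> z"
    unfolding closure_sequential by blast
  have "(\<lambda>n. closure_prb M e (y n)) \<longlonglongrightarrow> closure_prb M e z"
    by (rule continuous_on_tendsto_compose[OF continuous_closure_prb[OF e] y(2) True])
       (intro always_eventually allI subsetD[OF closure_subset y(1)])
  moreover have "closure_prb M e (y n) \<in> {0..1}" for n
    using e by (simp add: closure_prb_cell[OF e y(1)])
  ultimately have "closure_prb M e z \<in> {0..1}"
    by (rule closed_sequentially[OF closed_atLeastAtMost, rotated])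
  then show ?thesis by simp
qed (simp add: closure_prb_outside[OF e])

lemma measurable_closure_prb:
  assumes e: "e \<in> edges M"
  shows "closure_prb M e \<in> borel_measurable borel"
proof -
  have "(\<lambda>z. indicator (closure (cell M (src M e))) z *\<^sub>R closure_prb M e z) \<in> borel_measurable borel"
    by (intro borel_measurable_continuous_on_indicator continuous_closure_prb[OF e]) simp
  also have "(\<lambda>z. indicator (closure (cell M (src M e))) z *\<^sub>R closure_prb M e z) = closure_prb M e"
    by (auto simp: fun_eq_iff indicator_def closure_prb_outside[OF e])
  finally show ?thesis .
qed

lemma cellwise_uniform_prb:
  assumes e: "e \<in> edges M"
  shows "cellwise_uniform (prb M e)"
  unfolding cellwise_uniform_def
proof (intro conjI allI impI)
  fix \<epsilon> :: real assume \<epsilon>: "0 < \<epsilon>"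
  have "uniformly_continuous_on (cell M (src M e)) (prb M e)"
    using uniform e by (simp add: uniformly_continuous_system_def)
  then obtain \<delta> where \<delta>: "0 < \<delta>" "\<And>s t. s \<in> cell M (src M e) \<Longrightarrow> t \<in> cell M (src M e) \<Longrightarrow> dist t s < \<delta> \<Longrightarrow>
      dist (prb M e t) (prb M e s) < \<epsilon>"
    using \<epsilon> unfolding uniformly_continuous_on_def by metis
  have "\<bar>prb M e s - prb M e t\<bar> < \<epsilon>"
    if "j \<in> vertices M" "s \<in> cell M j" "t \<in> cell M j" "dist s t < \<delta>" for j s t
  proof (cases "j = src M e")
    case True
    with \<delta>(2)[of t s] that show ?thesis
      by (simp add: dist_real_def)
  next
    case False
    then have "s \<notin> cell M (src M e)" "t \<notin> cell M (src M e)"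
      using that e by (auto simp: in_cell_iff)
    with e \<epsilon> show ?thesis
      by (simp add: prb_outside)
  qed
  with \<delta>(1) show "\<exists>\<delta>>0. \<forall>j\<in>vertices M. \<forall>s\<in>cell M j. \<forall>t\<in>cell M j. dist s t < \<delta> \<longrightarrow> \<bar>prb M e s - prb M e t\<bar> < \<epsilon>"
    by blast
qed (use e in auto)

text \<open>
  The conditional probabilities in the definition of the closure equilibrium states, as a function of
  the past.
\<close>
definition closure_kernel :: "'e \<Rightarrow> (int \<Rightarrow> 'e option) \<Rightarrow> real" where
  "closure_kernel e \<sigma> = (if trg' M (\<sigma> 0) = src M e then closure_prb M e (past_limit \<sigma>) else 0)"

lemma measurable_closure_kernel:
  assumes e: "e \<in> edges M"
  shows "closure_kernel e \<in> borel_measurable (past_algebra M)"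
proof -
  have "Measurable.pred (past_algebra M) (\<lambda>\<sigma>. trg' M (\<sigma> 0) = src M e)"
    by (rule measurable_past_finite[of _ _ 0]) auto
  then show ?thesis
    unfolding closure_kernel_def
    by (intro measurable_If measurable_compose[OF measurable_past_limit measurable_closure_prb[OF e]] measurable_const predE) simp_all
qed

lemma closure_kernel_bounds: "e \<in> edges M \<Longrightarrow> 0 \<le> closure_kernel e \<sigma>" "e \<in> edges M \<Longrightarrow> closure_kernel e \<sigma> \<le> 1"
  using closure_prb_bounds by (auto simp: closure_kernel_def)

lemma path_trg:
  assumes "\<sigma> \<in> path_space M"
  shows "trg' M (\<sigma> 0) = trg M (the (\<sigma> 0))"
  using path_spaceD(1)[OF assms, of 0] by auto

text \<open>
  The backward iterates stay in the cell of the target of \<open>\<sigma> 0\<close>.  If it is the cell of the source of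
  \<open>e\<close>, the extension is continuous at their limit; otherwise \<open>prb M e\<close> vanishes along the sequence.
\<close>
lemma closure_kernel_limit:
  assumes D: "\<sigma> \<in> coding_domain M x" and e: "e \<in> edges M"
  shows "(\<lambda>n. prb M e (backward_iterate M x \<sigma> n)) \<longlonglongrightarrow> closure_kernel e \<sigma>"
proof -
  note p = coding_domainD(1)[OF D]
  have Y: "backward_iterate M x \<sigma> n \<in> cell M (trg M (the (\<sigma> 0)))" for n
    by (rule backward_iterate_in_cell[OF p])
  have lim: "backward_iterate M x \<sigma> \<longlonglongrightarrow> past_limit \<sigma>"
    using coding_domainD(2)[OF D] by (simp add: coding_map_eq_past_limit[OF D])
  show ?thesis
  proof (cases "trg M (the (\<sigma> 0)) = src M e")
    case True
    have cl: "past_limit \<sigma> \<in> closure (cell M (src M e))"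
      using Y lim True unfolding closure_sequential by auto
    have "(\<lambda>n. closure_prb M e (backward_iterate M x \<sigma> n)) \<longlonglongrightarrow> closure_prb M e (past_limit \<sigma>)"
      by (rule continuous_on_tendsto_compose[OF continuous_closure_prb[OF e] lim cl])
         (intro always_eventually allI subsetD[OF closure_subset Y[unfolded True]])
    then show ?thesis
      using Y True by (simp add: closure_kernel_def path_trg[OF p] closure_prb_cell[OF e])
  next
    case False
    have "trg M (the (\<sigma> 0)) \<in> vertices M"
      by (intro trg_in path_spaceD(4)[OF p])
    then have "backward_iterate M x \<sigma> n \<notin> cell M (src M e)" for n
      using Y[of n] False e by (simp add: in_cell_iff)
    then show ?thesis
      using False by (simp add: closure_kernel_def path_trg[OF p] prb_outside[OF e])
  qed
qed

lemma closure_equilibrium_statesI: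
  assumes \<Lambda>: "\<Lambda> \<in> shift_invariant_measures M" and D: "AE \<sigma> in \<Lambda>. \<sigma> \<in> coding_domain M x"
    and ker: "\<And>e. e \<in> edges M \<Longrightarrow> past_kernel \<Lambda> e (closure_kernel e)"
  shows "\<Lambda> \<in> closure_equilibrium_states M x"
proof -
  note * = shift_invariantD(1,2)[OF \<Lambda>]
  have "AE \<sigma> in \<Lambda>. cond_prob_edge M \<Lambda> e \<sigma> =
      closure_prb M e (coding_map M x \<sigma>) * indicator (path_space_at M (src M e)) \<sigma>" if e: "e \<in> edges M" for e
  proof -
    have "AE \<sigma> in \<Lambda>. cond_prob_edge M \<Lambda> e \<sigma> = closure_kernel e \<sigma>"
      using e ker by (subst cond_prob_edge_iff[OF * measurable_closure_kernel]) (auto intro: closure_kernel_bounds)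
    with D show ?thesis
    proof eventually_elim
      fix \<sigma> assume D: "\<sigma> \<in> coding_domain M x" and c: "cond_prob_edge M \<Lambda> e \<sigma> = closure_kernel e \<sigma>"
      show "cond_prob_edge M \<Lambda> e \<sigma> = closure_prb M e (coding_map M x \<sigma>) * indicator (path_space_at M (src M e)) \<sigma>"
        unfolding c using coding_domainD(1)[OF D]
        by (simp add: closure_kernel_def path_space_at_def indicator_def coding_map_eq_past_limit[OF D])
    qed
  qed
  then show ?thesis
    using \<Lambda> D AE_coding_domain_iff[OF *] by (simp add: closure_equilibrium_states_def)
qed

text \<open>
  The set provided by non-degeneracy consists of good codes up to a null set, and on good codes the
  extended probabilities are the original ones.
\<close>
lemma invariant_from_closure_kernel:
  assumes \<Lambda>: "\<Lambda> \<in> shift_invariant_measures M" and D: "AE \<sigma> in \<Lambda>. \<sigma> \<in> coding_domain M x"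
    and ker: "\<And>e. e \<in> edges M \<Longrightarrow> past_kernel \<Lambda> e (closure_kernel e)"
    and j: "j \<in> vertices M"
    and pos: "0 < emeasure \<Lambda> (path_space_at M j \<inter> {\<sigma> \<in> code_space M. coding_map M x \<sigma> \<in> cell M j})"
  shows "invariant_measures M \<noteq> {}"
proof -
  interpret K: coded_kernel M x a b \<Lambda> closure_kernel
  proof
    fix e assume e: "e \<in> edges M"
    show "AE \<sigma> in \<Lambda>. \<sigma> \<in> good_codes \<longrightarrow> closure_kernel e \<sigma> = prb M e (past_limit \<sigma>)"
    proof (rule AE_I2, rule impI)
      fix \<sigma> assume "\<sigma> \<in> good_codes"
      then have g: "cell_index (past_limit \<sigma>) = trg' M (\<sigma> 0)"
        by (simp add: good_codes_def)
      show "closure_kernel e \<sigma> = prb M e (past_limit \<sigma>)"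
      proof (cases "trg' M (\<sigma> 0) = src M e")
        case True
        then have "past_limit \<sigma> \<in> cell M (src M e)"
          using g e by (simp add: in_cell_iff)
        with True show ?thesis
          by (simp add: closure_kernel_def closure_prb_cell[OF e])
      next
        case False
        then have "past_limit \<sigma> \<notin> cell M (src M e)"
          using g e by (simp add: in_cell_iff)
        with False show ?thesis
          by (simp add: closure_kernel_def prb_outside[OF e])
      qed
    qed
  qed (use \<Lambda> D ker measurable_closure_kernel in auto)
  have "emeasure \<Lambda> (path_space_at M j \<inter> {\<sigma> \<in> code_space M. coding_map M x \<sigma> \<in> cell M j}) \<le> emeasure \<Lambda> good_codes"
  proof (rule emeasure_mono_AE)
    show "AE \<sigma> in \<Lambda>. \<sigma> \<in> path_space_at M j \<inter> {\<sigma> \<in> code_space M. coding_map M x \<sigma> \<in> cell M j} \<longrightarrow> \<sigma> \<in> good_codes"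
      using D by eventually_elim (auto simp: path_space_at_def good_codes_iff path_trg)
  qed simp
  with pos have "emeasure \<Lambda> good_codes \<noteq> 0"
    by auto
  then show ?thesis
    using K.good_codes_invariant_measure by blast
qed

text \<open>
  The measure of \<open>tight_limit_law\<close> is a closure equilibrium state: \<open>limit_integral\<close> for \<open>prb M e\<close>
  computes the probability that \<open>e\<close> follows a given past word.
\<close>
lemma invariant_measure_if_tight:
  assumes nd: "non_degenerate M x" and dom: "dominating_markov_chain M" and tight: "alpha_uniformly_tight M z"
  shows "invariant_measures M \<noteq> {}"
proof -
  obtain r q where r: "strict_mono (r :: nat \<Rightarrow> nat)" and "word_law M q"
    and lim: "\<And>u. set u \<subseteq> edges M \<Longrightarrow> (\<lambda>n. word_integral (cesaro z (r n)) (\<lambda>_. 1) u) \<longlonglongrightarrow> q u"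
    using tight_limit_law[OF dom tight] by blast
  interpret W: word_law M q by fact
  let ?\<Lambda> = "W.stationary_measure"
  have law: "measure ?\<Lambda> (word_cylinder M 0 u) = q u" if "set u \<subseteq> edges M" for u
    using W.emeasure_stationary_measure[OF that, of 0] W.q_nonneg[OF that] by (simp add: measure_def)
  interpret L: limit_law M x a b ?\<Lambda> "\<lambda>n. cesaro z (r n)" "lyap z + b / (1 - a)"
  proof (intro limit_law.intro limit_law_axioms.intro contractive_markov_axioms)
    have "0 \<le> b / (1 - a)"
      using b_nonneg a_less_1 by (intro divide_nonneg_pos) linarith+
    then show "0 \<le> lyap z + b / (1 - a)"
      using lyap_nonneg[of z] by linarith
    show "(\<lambda>n. word_integral (cesaro z (r n)) (\<lambda>_. 1) u) \<longlonglongrightarrow> measure ?\<Lambda> (word_cylinder M 0 u)"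
      if "set u \<subseteq> edges M" for u
      using lim[OF that] by (simp only: law[OF that])
  qed (rule W.stationary_measure_shift_invariant W.AE_stationary_measure prob_space_cesaro sets_cesaro lyap_cesaro)+
  have ker: "past_kernel ?\<Lambda> e (closure_kernel e)" if e: "e \<in> edges M" for e
  proof (rule past_kernel_from_words[OF W.stationary_measure_shift_invariant W.AE_stationary_measure e measurable_closure_kernel[OF e]])
    fix u assume u: "set u \<subseteq> edges M"
    have "(\<integral>\<^sup>+ \<sigma>. ennreal (closure_kernel e \<sigma>) * indicator (word_cylinder M (1 - int (length u)) u) \<sigma> \<partial>?\<Lambda>) =
        ennreal (q (u @ [e]))"
    proof (rule L.limit_integral[where l = "\<lambda>u. q (u @ [e])", OF cellwise_uniform_prb[OF e] _ _ _ _ u])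
      fix v assume v: "set v \<subseteq> edges M"
      have "word_integral \<nu> (prb M e) v = word_integral \<nu> (\<lambda>_. 1) (v @ [e])" for \<nu>
        by (simp add: word_integral_def word_prb_append)
      then show "(\<lambda>n. word_integral (cesaro z (r n)) (prb M e) v) \<longlonglongrightarrow> q (v @ [e])"
        using lim[of "v @ [e]"] v e by simp
      show "(\<integral>\<^sup>+ d. ennreal (q ((d # v) @ [e])) \<partial>count_space (edges M)) = ennreal (q (v @ [e]))"
        using W.q_left[of "v @ [e]"] v e by simp
    next
      show "closure_kernel e \<in> borel_measurable (code_borel M)"
        by (rule measurable_past_code[OF measurable_closure_kernel[OF e]])
      show "AE \<sigma> in ?\<Lambda>. (\<lambda>n. prb M e (backward_iterate M x \<sigma> n)) \<longlonglongrightarrow> closure_kernel e \<sigma>"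
        using L.AE_coding_domain by eventually_elim (rule closure_kernel_limit[OF _ e])
    qed
    also have "\<dots> = emeasure ?\<Lambda> (word_cylinder M (1 - int (length u)) (u @ [e]))"
      using u e by (simp add: W.emeasure_stationary_measure)
    finally show "(\<integral>\<^sup>+ \<sigma>. ennreal (closure_kernel e \<sigma>) * indicator (word_cylinder M (1 - int (length u)) u) \<sigma> \<partial>?\<Lambda>) =
        emeasure ?\<Lambda> (word_cylinder M (1 - int (length u)) (u @ [e]))" .
  qed
  have "?\<Lambda> \<in> closure_equilibrium_states M x"
    by (rule closure_equilibrium_statesI[OF W.stationary_measure_shift_invariant L.AE_coding_domain ker])
  then obtain j where "j \<in> vertices M"
    "0 < emeasure ?\<Lambda> (path_space_at M j \<inter> {\<sigma> \<in> code_space M. coding_map M x \<sigma> \<in> cell M j})"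
    using nd unfolding non_degenerate_def by blast
  then show ?thesis
    by (intro invariant_from_closure_kernel[OF W.stationary_measure_shift_invariant L.AE_coding_domain ker])
qed

end

lemma uniform_markovI:
  assumes "countable_markov_system M" "base_points M x" "contractive M a"
    "uniformly_continuous_system M" "displacement_bound M x < \<infinity>"
  shows "uniform_markov M x a (enn2real (displacement_bound M x))"
  using assms by unfold_locales simp_all

theorem corollary1:
  fixes M :: "('k::complete_space, 'e) markov_system"
    and x :: "nat \<Rightarrow> 'k"
  assumes "countable_markov_system M"
    and "base_points M x"
    and "\<exists>a. contractive M a"
    and "uniformly_continuous_system M"
    and "non_degenerate M x"
    and "displacement_bound M x < \<infinity>"
  shows
    "(dominating_markov_chain M \<longrightarrow>
        (equilibrium_states M x \<noteq> {} \<longleftrightarrow> (\<exists>x\<^sub>0. alpha_uniformly_tight M x\<^sub>0))) \<and>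
     ((\<forall>\<Lambda>\<in>equilibrium_states M x. coding_image M x \<Lambda> \<in> invariant_measures M) \<and>
      (\<forall>\<mu>\<in>invariant_measures M. markov_path_measure M \<mu> \<in> equilibrium_states M x) \<and>
      (\<forall>\<Lambda>\<in>equilibrium_states M x. markov_path_measure M (coding_image M x \<Lambda>) = \<Lambda>) \<and>
      (\<forall>\<mu>\<in>invariant_measures M. coding_image M x (markov_path_measure M \<mu>) = \<mu>)) \<and>
     (\<forall>y. base_points M y \<and> displacement_bound M y < \<infinity> \<longrightarrow>
        equilibrium_states M y = equilibrium_states M x \<and>
        (\<forall>\<Lambda>\<in>equilibrium_states M x. coding_image M y \<Lambda> = coding_image M x \<Lambda>))"
proof -
  obtain a where a: "contractive M a"
    using assms(3) by blast
  interpret X: uniform_markov M x a "enn2real (displacement_bound M x)"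
    by (rule uniform_markovI[OF assms(1,2) a assms(4,6)])
  have inverse: "(\<forall>\<Lambda>\<in>equilibrium_states M x. coding_image M x \<Lambda> \<in> invariant_measures M) \<and>
      (\<forall>\<mu>\<in>invariant_measures M. markov_path_measure M \<mu> \<in> equilibrium_states M x) \<and>
      (\<forall>\<Lambda>\<in>equilibrium_states M x. markov_path_measure M (coding_image M x \<Lambda>) = \<Lambda>) \<and>
      (\<forall>\<mu>\<in>invariant_measures M. coding_image M x (markov_path_measure M \<mu>) = \<mu>)"
    using X.equilibrium_coding X.invariant_coding by blast
  have existence: "equilibrium_states M x \<noteq> {} \<longleftrightarrow> (\<exists>x\<^sub>0. alpha_uniformly_tight M x\<^sub>0)"
    if dom: "dominating_markov_chain M"
  proof
    assume "equilibrium_states M x \<noteq> {}"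
    then show "\<exists>x\<^sub>0. alpha_uniformly_tight M x\<^sub>0"
      using X.equilibrium_coding(1) X.exists_tight_orbit by blast
  next
    assume "\<exists>x\<^sub>0. alpha_uniformly_tight M x\<^sub>0"
    then show "equilibrium_states M x \<noteq> {}"
      using X.invariant_measure_if_tight[OF assms(5) dom] X.invariant_coding(1) by blast
  qed
  have independence: "equilibrium_states M y = equilibrium_states M x \<and>
        (\<forall>\<Lambda>\<in>equilibrium_states M x. coding_image M y \<Lambda> = coding_image M x \<Lambda>)"
    if y: "base_points M y" "displacement_bound M y < \<infinity>" for y
  proof -
    interpret Y: uniform_markov M y a "enn2real (displacement_bound M y)"
      by (rule uniform_markovI[OF assms(1) y(1) a assms(4) y(2)])
    have "\<Lambda> \<in> equilibrium_states M y \<and> coding_image M y \<Lambda> = coding_image M x \<Lambda>"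
      if "\<Lambda> \<in> equilibrium_states M x" for \<Lambda>
      using X.equilibrium_coding[OF that] Y.invariant_coding[of "coding_image M x \<Lambda>"] by simp
    moreover have "\<Lambda> \<in> equilibrium_states M x" if "\<Lambda> \<in> equilibrium_states M y" for \<Lambda>
      using Y.equilibrium_coding[OF that] X.invariant_coding[of "coding_image M y \<Lambda>"] by simp
    ultimately show ?thesis
      by blast
  qed
  show ?thesis
    using inverse existence independence by blast
qed

end
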